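(* Let $\alpha\ge\gamma$, $y\in\mathbb R^N$ and $\mathbf b=(b_1,\dots,b_M)\in\mathbb R^M$. Define $\mathbf v=(v_1,\dots,v_M)$ by $$v_i(x)=\inf\ \mathbb E_i\left[\int_0^\tau L_{\omega(s)}(x+\mathcal I(\Xi)(s),-\Xi(s))+\alpha\,ds+b_{\omega(\tau)}\right],\qquad i\in\{1,\dots,M\},$$ where the infimum is taken over all bounded stopping times $\tau$ and all $\Xi\in\mathcal K(\tau,y-x)$. Then $\mathbf v$ is a subsolution of (HJ$\alpha$).
   Context: **System.** $\mathbb T^N=\mathbb R^N/\mathbb Z^N$ is the flat torus; $+,-$ also denote its group operations, and points of $\mathbb R^N$ are identified with their projections on $\mathbb T^N$ where needed. For $i\in\{1,\dots,M\}$, $H_i:\mathbb T^N\times\mathbb R^N\to\mathbb R$, $(x,p)\mapsto H_i(x,p)$, is continuous in both variables, convex in $p$ and superlinear in $p$. The Lagrangians are $L_i(x,q)=\max_{p\in\mathbb R^N}(p\cdot q-H_i(x,p))$. $\Lambda=(\Lambda_{ij})$ is an $M\times M$ real matrix with rows $\Lambda^1,\dots,\Lambda^M$ such that every non-diagonal entry is nonpositive, every row sums to $0$, and $\Lambda$ is irreducible (for every nonempty $I\subsetneq\{1,\dots,M\}$ there are $i\in I$, $j\notin I$ with $\Lambda_{ij}\neq0$). For $\alpha\in\mathbb R$, (HJ$\alpha$) is the system $H_i(x,Du_i)+\Lambda^i\cdot\mathbf u=\alpha$ on $\mathbb T^N$, $i=1,\dots,M$. A continuous $\mathbf u=(u_1,\dots,u_M):\mathbb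 T^N\to\mathbb R^M$ is a subsolution (resp. supersolution) of (HJ$\alpha$) if $H_i(x,D\psi(x))+\Lambda^i\cdot\mathbf u(x)\le\alpha$ (resp. $\ge\alpha$) for every $x\in\mathbb T^N$, $i$, and $\psi\in C^1(\mathbb T^N)$ such that $u_i-\psi$ attains a maximum (resp. minimum) at $x$; a solution is both. The critical value is $\gamma=\inf\{\alpha\in\mathbb R : \text{(HJ}\alpha)\text{ admits subsolutions}\}$. **Random setting.** $\mathcal D$ is the space of cadlag paths $\omega:[0,+\infty)\to\{1,\dots,M\}$; $\mathcal F$ is the $\sigma$-algebra generated by the evaluations $\omega\mapsto\omega(s)$, $s\ge0$, and $\mathcal F_t$ the one generated by those with $s\le t$. $\mathcal S\subset\mathbb R^M$ is the simplex of probability vectors (regarded as row vectors). For $\mathbf a\in\mathcal S$, $\mathbb P_{\mathbf a}$ is the unique probability measure on $(\mathcal D,\mathcal F)$ with $$\mathbb P_{\mathbf a}(\omega(t_1)=j_1,\dots,\omega(t_k)=j_k)=(\mathbf a e^{-t_1\Lambda})_{j_1}\prod_{l=2}^k\big(e^{-(t_l-t_{l-1})\Lambda}\big)_{j_{l-1}j_l}$$ for all $k\in\mathbb N$, $0\le t_1<\dots<t_k$ and indices $j_1,\dots,j_k$. $\mathbb E_{\mathbf a}$ is the expectation with respect to $\mathbb P_{\mathbf a}$, and $\mathbb E_i=\mathbb E_{\mathbf e_i}$ with $\mathbf e_i$ the $i$-th canonical basis vector. "Almost surely" (a.s.) means up to a set that is $\mathbb P_{\mathbf a}$-null for some, equivalently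 all, $\mathbf a\in\mathcal S$ with strictly positive components. A stopping time is a nonnegative random variable $\tau$ on $(\mathcal D,\mathcal F)$ with $\{\tau\le t\}\in\mathcal F_t$ for all $t\ge0$. **Controls.** $\mathcal D(0,+\infty;\mathbb R^N)$ is the space of cadlag paths $[0,+\infty)\to\mathbb R^N$ with the Skorohod metric and its Borel $\sigma$-algebra (generated by the evaluations). A control is a measurable map $\Xi:\mathcal D\to\mathcal D(0,+\infty;\mathbb R^N)$ such that (i) for every $t>0$ there is $R>0$ with $\sup_{[0,t]}|\Xi|<R$ a.s.; (ii) $\Xi$ is nonanticipating: for every $t>0$, $\omega_1=\omega_2$ in $[0,t]$ implies $\Xi(\omega_1)=\Xi(\omega_2)$ in $[0,t]$. For $\xi\in\mathcal D(0,+\infty;\mathbb R^N)$, $\mathcal I(\xi)(t)\in\mathbb T^N$ is the projection on $\mathbb T^N$ of $\int_0^t\xi\,ds$; $\mathcal I(\Xi)$ is defined $\omega$ by $\omega$. For a bounded stopping time $\tau$ and $x,y\in\mathbb T^N$, $\mathcal K(\tau,y-x)$ is the set of controls $\Xi$ with $\mathcal I(\Xi)(\tau)=y-x$ a.s. *)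

theory Defs
  imports "HOL-Probability.Probability"
begin

section \<open>The flat torus\<close>

definition int_equiv :: "real^'n \<Rightarrow> real^'n \<Rightarrow> bool" where
  "int_equiv x y \<longleftrightarrow> (\<forall>k. x $ k - y $ k \<in> \<int>)"

lemma equivp_int_equiv: "equivp int_equiv"
proof (rule equivpI)
  show "reflp int_equiv"
    by (simp add: reflp_def int_equiv_def)
  show "symp int_equiv"
    unfolding symp_def int_equiv_def by (metis Ints_minus minus_diff_eq)
  show "transp int_equiv"
    unfolding transp_def int_equiv_def
  proof (intro allI impI)
    fix x y z :: "real^'n" and k
    assume "\<forall>k. x $ k - y $ k \<in> \<int>" "\<forall>k. y $ k - z $ k \<in> \<int>"
    then have "(x $ k - y $ k) + (y $ k - z $ k) \<in> \<int>"
      by (intro Ints_add) auto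
    then show "x $ k - z $ k \<in> \<int>"
      by simp
  qed
qed

quotient_type 'n torus = "real^('n::finite)" / int_equiv
  morphisms torus_rep torus_proj
  by (rule equivp_int_equiv)

instantiation torus :: (finite) ab_group_add
begin

lift_definition zero_torus :: "'a torus" is 0 .

lift_definition plus_torus :: "'a torus \<Rightarrow> 'a torus \<Rightarrow> 'a torus" is "(+)"
  unfolding int_equiv_def
  by (metis (no_types, lifting) Ints_add add_diff_add vector_add_component)

lift_definition uminus_torus :: "'a torus \<Rightarrow> 'a torus" is uminus
  unfolding int_equiv_def
  by (metis Ints_minus minus_diff_eq minus_diff_minus vector_uminus_component)

lift_definition minus_torus :: "'a torus \<Rightarrow> 'a torus \<Rightarrow> 'a torus" is "(-)"
  unfolding int_equiv_def
proof -
  fix a b c d :: "real^'a"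
  assume *: "\<forall>k. a $ k - b $ k \<in> \<int>" "\<forall>k. c $ k - d $ k \<in> \<int>"
  have "(a - c) $ k - (b - d) $ k = (a $ k - b $ k) - (c $ k - d $ k)" for k
    by simp
  with * show "\<forall>k. (a - c) $ k - (b - d) $ k \<in> \<int>"
    by (metis Ints_diff)
qed

instance
  by standard (transfer; simp add: int_equiv_def algebra_simps)+

end

text \<open>The quotient topology.\<close>

instantiation torus :: (finite) topological_space
begin

definition open_torus :: "'a torus set \<Rightarrow> bool" where
  "open_torus U \<longleftrightarrow> open (torus_proj -` U)"

instance
  by standard (auto simp: open_torus_def vimage_Union intro!: open_INT)

end

text \<open>\<open>C1_gradient \<psi> g\<close>: the function \<open>\<psi>\<close> belongs to \<open>C\<^sup>1\<close> of the torus and \<open>g = D\<psi>\<close>.\<close>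

definition C1_gradient :: "('n::finite torus \<Rightarrow> real) \<Rightarrow> ('n torus \<Rightarrow> real^'n) \<Rightarrow> bool" where
  "C1_gradient \<psi> g \<longleftrightarrow> continuous_on UNIV g \<and>
     (\<forall>z. GDERIV (\<lambda>w. \<psi> (torus_proj w)) z :> g (torus_proj z))"

section \<open>The weakly coupled system\<close>

definition superlinear :: "(real^'n \<Rightarrow> real) \<Rightarrow> bool" where
  "superlinear h \<longleftrightarrow> filterlim (\<lambda>p. h p / norm p) at_top at_infinity"

text \<open>For the Hamiltonians considered here the supremum is attained, hence is a maximum.\<close>

definition lagrangian ::
  "('m \<Rightarrow> 'n torus \<Rightarrow> real^'n \<Rightarrow> real) \<Rightarrow> 'm \<Rightarrow> 'n::finite torus \<Rightarrow> real^'n \<Rightarrow> real" where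
  "lagrangian H i x q = (SUP p. p \<bullet> q - H i x p)"

definition irreducible_matrix :: "real^'m^'m \<Rightarrow> bool" where
  "irreducible_matrix \<Lambda> \<longleftrightarrow>
     (\<forall>I. I \<noteq> {} \<and> I \<noteq> UNIV \<longrightarrow> (\<exists>i\<in>I. \<exists>j\<in>-I. \<Lambda> $ i $ j \<noteq> 0))"

definition subsolution ::
  "('m \<Rightarrow> 'n torus \<Rightarrow> real^'n \<Rightarrow> real) \<Rightarrow> real^'m^'m \<Rightarrow> real \<Rightarrow> ('n::finite torus \<Rightarrow> real^'m) \<Rightarrow> bool"
where
  "subsolution H \<Lambda> \<alpha> u \<longleftrightarrow> continuous_on UNIV u \<and>
     (\<forall>x i \<psi> g. C1_gradient \<psi> g \<longrightarrow> (\<forall>z. u z $ i - \<psi> z \<le> u x $ i - \<psi> x) \<longrightarrow>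
        H i x (g x) + \<Lambda> $ i \<bullet> u x \<le> \<alpha>)"

definition critical_value ::
  "('m \<Rightarrow> 'n::finite torus \<Rightarrow> real^'n \<Rightarrow> real) \<Rightarrow> real^'m^'m \<Rightarrow> real" where
  "critical_value H \<Lambda> = Inf {\<alpha>. \<exists>u. subsolution H \<Lambda> \<alpha> u}"

section \<open>Path spaces\<close>

text \<open>Paths on \<open>[0, \<infinity>)\<close> are represented by functions on the reals with the fixed value
  \<^const>\<open>undefined\<close> at negative times.\<close>

definition cadlag_paths :: "'a topology \<Rightarrow> (real \<Rightarrow> 'a) set" where
  "cadlag_paths X = {\<omega> \<in> extensional {0..}.
     (\<forall>t\<ge>0. limitin X \<omega> (\<omega> t) (at_right t)) \<and>
     (\<forall>t>0. \<exists>l. limitin X \<omega> l (at_left t))}"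

text \<open>The \<open>\<sigma>\<close>-algebra generated by the evaluations at times in \<open>I\<close>, the state space carrying
  its Borel \<open>\<sigma>\<close>-algebra.\<close>

definition eval_algebra :: "'a topology \<Rightarrow> real set \<Rightarrow> (real \<Rightarrow> 'a) measure" where
  "eval_algebra X I = sigma (cadlag_paths X)
     {{\<omega> \<in> cadlag_paths X. \<omega> s \<in> U} | s U. s \<in> I \<and> openin X U}"

abbreviation index_paths :: "(real \<Rightarrow> 'm) set" where
  "index_paths \<equiv> cadlag_paths (discrete_topology UNIV)"

abbreviation path_algebra :: "(real \<Rightarrow> 'm) measure" where
  "path_algebra \<equiv> eval_algebra (discrete_topology UNIV) {0..}"

abbreviation path_filtration :: "real \<Rightarrow> (real \<Rightarrow> 'm) measure" where
  "path_filtration t \<equiv> eval_algebra (discrete_topology UNIV) {0..t}"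

section \<open>The random switching\<close>

text \<open>The multiplication of the type class \<^class>\<open>times\<close> on matrices is componentwise, so
  \<^const>\<open>exp\<close> and \<^const>\<open>power\<close> are not the matrix notions.\<close>

definition matrix_exp :: "real^'m^'m \<Rightarrow> real^'m^'m" where
  "matrix_exp A = (\<Sum>k. (1 / fact k) *\<^sub>R (((**) A ^^ k) (mat 1)))"

definition prob_simplex :: "(real^'m) set" where
  "prob_simplex = {a. (\<forall>i. 0 \<le> a $ i) \<and> (\<Sum>i\<in>UNIV. a $ i) = 1}"

text \<open>\<open>\<mu>\<close> is the law on the path space of the Markov chain with initial distribution \<open>a\<close> and
  transition matrices \<open>exp (- t \<Lambda>)\<close>; it is determined by \<open>a\<close> and \<open>\<Lambda>\<close>.\<close>

definition is_chain_law :: "real^'m^'m \<Rightarrow> real^'m \<Rightarrow> (real \<Rightarrow> 'm) measure \<Rightarrow> bool" where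
  "is_chain_law \<Lambda> a \<mu> \<longleftrightarrow>
     prob_space \<mu> \<and> space \<mu> = index_paths \<and> sets \<mu> = sets path_algebra \<and>
     (\<forall>(k::nat) (t :: nat \<Rightarrow> real) (j :: nat \<Rightarrow> 'm). 1 \<le> k \<longrightarrow> 0 \<le> t 1 \<longrightarrow> strict_mono_on {1..k} t \<longrightarrow>
        measure \<mu> {\<omega> \<in> index_paths. \<forall>l\<in>{1..k}. \<omega> (t l) = j l} =
          (a v* matrix_exp (- t 1 *\<^sub>R \<Lambda>)) $ j 1 *
          (\<Prod>l = 2..k. matrix_exp (- (t l - t (l - 1)) *\<^sub>R \<Lambda>) $ j (l - 1) $ j l))"

text \<open>In the following, \<open>P a\<close> stands for the law with initial distribution \<open>a\<close>.\<close>

definition almost_surely ::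
  "(real^'m \<Rightarrow> (real \<Rightarrow> 'm) measure) \<Rightarrow> ((real \<Rightarrow> 'm) \<Rightarrow> bool) \<Rightarrow> bool" where
  "almost_surely P Q \<longleftrightarrow> (\<exists>a\<in>prob_simplex. (\<forall>i. 0 < a $ i) \<and> (AE \<omega> in P a. Q \<omega>))"

definition bounded_stopping_time :: "((real \<Rightarrow> 'm) \<Rightarrow> real) \<Rightarrow> bool" where
  "bounded_stopping_time \<tau> \<longleftrightarrow> stopping_time path_filtration \<tau> \<and>
     (\<exists>T. \<forall>\<omega>\<in>index_paths. 0 \<le> \<tau> \<omega> \<and> \<tau> \<omega> \<le> T)"

section \<open>Controls and the value function\<close>

definition control ::
  "(real^'m \<Rightarrow> (real \<Rightarrow> 'm) measure) \<Rightarrow> ((real \<Rightarrow> 'm) \<Rightarrow> real \<Rightarrow> real^'n) \<Rightarrow> bool" where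
  "control P \<Xi> \<longleftrightarrow>
     \<Xi> \<in> path_algebra \<rightarrow>\<^sub>M eval_algebra euclidean {0..} \<and>
     (\<forall>t>0. \<exists>R>0. almost_surely P (\<lambda>\<omega>. (SUP s\<in>{0..t}. norm (\<Xi> \<omega> s)) < R)) \<and>
     (\<forall>t>0. \<forall>\<omega>\<^sub>1\<in>index_paths. \<forall>\<omega>\<^sub>2\<in>index_paths.
        (\<forall>s\<in>{0..t}. \<omega>\<^sub>1 s = \<omega>\<^sub>2 s) \<longrightarrow> (\<forall>s\<in>{0..t}. \<Xi> \<omega>\<^sub>1 s = \<Xi> \<omega>\<^sub>2 s))"

definition torus_primitive :: "(real \<Rightarrow> real^'n) \<Rightarrow> real \<Rightarrow> 'n::finite torus" where
  "torus_primitive \<xi> t = torus_proj (LINT s:{0..t}|lborel. \<xi> s)"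

definition controls_to ::
  "(real^'m \<Rightarrow> (real \<Rightarrow> 'm) measure) \<Rightarrow> ((real \<Rightarrow> 'm) \<Rightarrow> real) \<Rightarrow> 'n::finite torus \<Rightarrow>
   ((real \<Rightarrow> 'm) \<Rightarrow> real \<Rightarrow> real^'n) set" where
  "controls_to P \<tau> z =
     {\<Xi>. control P \<Xi> \<and> almost_surely P (\<lambda>\<omega>. torus_primitive (\<Xi> \<omega>) (\<tau> \<omega>) = z)}"

definition cost ::
  "(real^'m \<Rightarrow> (real \<Rightarrow> 'm) measure) \<Rightarrow> ('m \<Rightarrow> 'n torus \<Rightarrow> real^'n \<Rightarrow> real) \<Rightarrow> real \<Rightarrow> real^'m \<Rightarrow>
   'm \<Rightarrow> 'n::finite torus \<Rightarrow> ((real \<Rightarrow> 'm) \<Rightarrow> real) \<Rightarrow> ((real \<Rightarrow> 'm) \<Rightarrow> real \<Rightarrow> real^'n) \<Rightarrow> real" where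
  "cost P L \<alpha> b i x \<tau> \<Xi> =
     (LINT \<omega>|P (axis i 1).
        (LINT s:{0..\<tau> \<omega>}|lborel. L (\<omega> s) (x + torus_primitive (\<Xi> \<omega>) s) (- \<Xi> \<omega> s) + \<alpha>)
        + b $ \<omega> (\<tau> \<omega>))"

text \<open>The infimum is taken in the extended reals, so that its finiteness is not presupposed.\<close>

definition value_fun ::
  "(real^'m \<Rightarrow> (real \<Rightarrow> 'm) measure) \<Rightarrow> ('m \<Rightarrow> 'n torus \<Rightarrow> real^'n \<Rightarrow> real) \<Rightarrow> real \<Rightarrow> real^'m \<Rightarrow>
   real^'n \<Rightarrow> 'm \<Rightarrow> 'n::finite torus \<Rightarrow> ereal" where
  "value_fun P L \<alpha> b y i x =
     Inf {ereal (cost P L \<alpha> b i x \<tau> \<Xi>) | \<tau> \<Xi>.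
            bounded_stopping_time \<tau> \<and> \<Xi> \<in> controls_to P \<tau> (torus_proj y - x)}"

end

theory Submission
  imports Defs
begin

text \<open>
  Subsolution property. Fix \<open>h > 0\<close> and a velocity \<open>q\<close>. Moving with speed \<open>q\<close> up to time \<open>h\<close> and
  then, by the Markov property, restarting with almost optimal strategies for the state reached
  gives \<open>v\<^sub>i(z) \<le> E\<^sub>i[\<integral>\<^sub>0\<^sup>h L(z + s q, - q) + \<alpha> ds + v\<^bsub>\<omega>(h)\<^esub>(z + h q)]\<close>. Since \<open>h\<close> and \<open>q\<close> are
  deterministic, only one strategy per index is needed and no measurable selection occurs. For
  unit vectors \<open>q\<close> this makes \<open>v\<close> Lipschitz continuous; with \<open>- q\<close> an approximate subgradient of
  \<open>H\<^sub>i(x, \<cdot>)\<close> at \<open>D\<psi>(x)\<close> and \<open>h \<rightarrow> 0\<close> it is the subsolution inequality.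

  Finiteness. A subsolution \<open>u\<close> bounds the cost from below. Its sup-convolution is touched from below
  by a paraboloid at every point, with a slope that satisfies the Hamilton-Jacobi inequality nearby;
  this gives a one-step estimate along any displacement without differentiability, which is summed
  over a time grid that is refined towards the stopping time. Subsolutions are only given at levels
  above the critical value, so the bound is applied at levels \<open>\<beta> \<down> \<alpha>\<close>; it is uniform because the
  oscillation of subsolutions is, by irreducibility.
\<close>

subsection \<open>The torus\<close>

text \<open>A subsolution is merely continuous and a control is a random cadlag path, so
  \<open>u\<close> has no derivative along a trajectory. Summing T / h grid steps tolerates only an
  O(h^2) loss per step. Three effects are of this order: the opening of the paraboloid over a
  displacement of size O(h), the time spent in another index (probability O(h) over a duration h),
  and the remainder of the transition matrix after its linear term. Their constants depend on the
  regularisation parameter \<open>e\<close>; hence the grid is refined with \<open>e\<close> fixed,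
  and \<open>e\<close> tends to 0 only afterwards.

  The chain is conditioned in two directions: on the state at time \<open>h\<close> with the future
  as the object (restarting strategies), and on the past up to time \<open>s\<close> with the next
  state as the object (the grid steps). Both are derived from the finite-dimensional distributions
  as identities between restricted, unnormalised measures, so a state of probability 0 never has to
  be excluded.

  The infimum lives in the extended reals, while the passage from dynamic programming to the
  subsolution inequality works with bounded real functions. The lower bound is therefore proved for
  all strategies before the infimum is handled.\<close>

lemma torus_proj_eq_iff: "torus_proj x = torus_proj y \<longleftrightarrow> int_equiv x y"
  using torus.abs_eq_iff by blast

lemma torus_proj_add: "torus_proj (x + y) = torus_proj x + torus_proj y"
  by (simp add: plus_torus.abs_eq)

lemma torus_proj_rep [simp]: "torus_proj (torus_rep x) = x"
  by (rule Quotient_abs_rep[OF Quotient_torus])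

lemma torus_surj: "\<exists>z. x = torus_proj z"
  by (metis torus_proj_rep)

lemma torus_rep_proj: "int_equiv (torus_rep (torus_proj z)) z"
  by (metis torus_proj_eq_iff torus_proj_rep)

lemma continuous_on_torus_proj: "continuous_on S torus_proj"
  by (rule continuous_on_subset[of UNIV]) (auto simp: continuous_on_open_vimage open_torus_def)

lemma continuous_on_torusI:
  fixes f :: "'n::finite torus \<Rightarrow> 'b::topological_space"
  assumes "continuous_on UNIV (\<lambda>z. f (torus_proj z))"
  shows "continuous_on UNIV f"
  using assms by (simp add: continuous_on_open_vimage open_torus_def vimage_def)

definition frac_vec :: "real^'n \<Rightarrow> real^'n" where
  "frac_vec z = (\<chi> k. frac (z $ k))"

lemma torus_proj_translate: "int_equiv d 0 \<Longrightarrow> torus_proj (z + d) = torus_proj z"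
  unfolding torus_proj_eq_iff by (simp add: int_equiv_def)

lemma int_equiv_frac_vec: "int_equiv (frac_vec z - z) 0"
  by (simp add: int_equiv_def frac_vec_def frac_def)

lemma frac_vec_in_cbox: "frac_vec z \<in> cbox 0 1"
  by (auto simp: mem_box_cart frac_vec_def less_imp_le[OF frac_lt_1])

lemma torus_proj_frac_vec [simp]: "torus_proj (frac_vec z) = torus_proj z"
  using torus_proj_translate[OF int_equiv_frac_vec, of z z] by simp

lemma torus_representative:
  obtains d where "int_equiv d 0" "z + d \<in> cbox 0 (1::real^'n)"
  using int_equiv_frac_vec[of z] frac_vec_in_cbox[of z] that[of "frac_vec z - z"] by simp

lemma norm_cbox01: "z \<in> cbox 0 (1::real^'n) \<Longrightarrow> norm z \<le> real CARD('n)"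
  by (rule order_trans[OF norm_le_l1_cart])
    (use sum_bounded_above[of UNIV "\<lambda>i. \<bar>z $ i\<bar>" 1] in \<open>auto simp: mem_box_cart\<close>)

text \<open>The second argument ranges over a compact set so that one statement serves Hamiltonians
  at bounded momenta, Lagrangians at bounded velocities and, with a one-point \<open>C\<close>,
  functions of the position alone.\<close>

lemma periodic_bounded:
  fixes f :: "'n::finite torus \<Rightarrow> 'b::metric_space \<Rightarrow> real"
  assumes c: "continuous_on (UNIV \<times> C) (\<lambda>(z, p). f (torus_proj z) p)" and C: "compact C"
  obtains B where "B \<ge> 0" "\<And>z p. p \<in> C \<Longrightarrow> \<bar>f z p\<bar> \<le> B"
proof -
  have "compact ((\<lambda>(z, p). f (torus_proj z) p) ` (cbox 0 1 \<times> C))"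
    by (intro compact_continuous_image compact_Times C compact_cbox continuous_on_subset[OF c]) auto
  then obtain B where B: "\<And>z p. z \<in> cbox 0 1 \<Longrightarrow> p \<in> C \<Longrightarrow> \<bar>f (torus_proj z) p\<bar> \<le> B"
    unfolding compact_eq_bounded_closed bounded_iff by (force simp: image_iff)
  have *: "\<bar>f x p\<bar> \<le> \<bar>B\<bar>" if "p \<in> C" for x p
  proof -
    obtain z where z: "x = torus_proj z" using torus_surj by blast
    show ?thesis
      using B[OF frac_vec_in_cbox that, of z] by (simp add: z)
  qed
  show ?thesis by (rule that[OF _ *]) auto
qed

text \<open>Both points are translated by the same lattice vector, which keeps their distance;
  reducing each to the unit cube separately could tear neighbours apart.\<close>

lemma periodic_uniformly_continuous:
  fixes f :: "'n::finite torus \<Rightarrow> 'b::metric_space \<Rightarrow> real"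
  assumes c: "continuous_on (UNIV \<times> C) (\<lambda>(z, p). f (torus_proj z) p)" and C: "compact C"
    and e: "e > 0"
  obtains d where "d > 0"
    "\<And>z z' p. dist z z' < d \<Longrightarrow> p \<in> C \<Longrightarrow> \<bar>f (torus_proj z) p - f (torus_proj z') p\<bar> < e"
proof -
  \<comment> \<open>The translated first point lies in the unit cube, hence has norm at most
    \<open>CARD('n)\<close>; the extra 1 leaves room for its neighbour.\<close>
  let ?K = "cball (0::real^'n) (real CARD('n) + 1)"
  have "uniformly_continuous_on (?K \<times> C) (\<lambda>(z, p). f (torus_proj z) p)"
    by (intro compact_uniformly_continuous compact_Times C compact_cball continuous_on_subset[OF c]) auto
  then obtain d where d: "d > 0" "\<And>a b. a \<in> ?K \<times> C \<Longrightarrow> b \<in> ?K \<times> C \<Longrightarrow> dist b a < d \<Longrightarrow>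
     dist ((\<lambda>(z, p). f (torus_proj z) p) b) ((\<lambda>(z, p). f (torus_proj z) p) a) < e"
    unfolding uniformly_continuous_on_def using e by metis
  show ?thesis
  proof (rule that[of "min d 1"])
    fix z z' :: "real^'n" and p assume *: "dist z z' < min d 1" "p \<in> C"
    obtain k where k: "int_equiv k 0" "z + k \<in> cbox 0 1" by (rule torus_representative)
    have a: "norm (z + k) \<le> real CARD('n)" using norm_cbox01[OF k(2)] .
    have "norm (z' + k) \<le> norm (z + k) + dist z z'"
      unfolding dist_norm by (metis add_diff_cancel_right norm_minus_commute norm_triangle_sub)
    with a * have "(z + k, p) \<in> ?K \<times> C" "(z' + k, p) \<in> ?K \<times> C" by auto
    from d(2)[OF this] * show "\<bar>f (torus_proj z) p - f (torus_proj z') p\<bar> < e"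
      by (simp add: dist_Pair_Pair torus_proj_translate[OF k(1)] dist_real_def dist_commute abs_minus_commute)
  qed (use d in auto)
qed

subsection \<open>Hamiltonians and Lagrangians\<close>

locale hamiltonian =
  fixes H :: "'m::finite \<Rightarrow> 'n::finite torus \<Rightarrow> real^'n \<Rightarrow> real"
  assumes H_continuous: "\<And>i. continuous_on UNIV (\<lambda>(x, p). H i x p)"
    and H_convex: "\<And>i x. convex_on UNIV (H i x)"
    and H_superlinear: "\<And>i x. superlinear (H i x)"
begin

abbreviation "L \<equiv> lagrangian H"

lemma continuous_on_H: "continuous_on S (\<lambda>(z, p). H i (torus_proj z) p)"
proof -
  have "continuous_on S (\<lambda>zp. (torus_proj (fst zp) :: 'n torus, snd zp :: real^'n))"
    by (intro continuous_on_Pair continuous_on_snd continuous_on_id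
        continuous_on_compose2[OF continuous_on_torus_proj continuous_on_fst[OF continuous_on_id]]) auto
  from continuous_on_compose2[OF H_continuous[of i] this]
  show ?thesis by (simp add: case_prod_beta)
qed

lemma continuous_on_H_snd: "continuous_on S (H i x)"
proof -
  have "continuous_on S ((\<lambda>(x, p). H i x p) \<circ> (\<lambda>p. (x, p)))"
    by (intro continuous_on_compose continuous_intros continuous_on_subset[OF H_continuous]) auto
  then show ?thesis by (simp add: comp_def)
qed

lemma H_bounded:
  obtains B where "B \<ge> 0" "\<And>x p. norm p \<le> K \<Longrightarrow> \<bar>H i x p\<bar> \<le> B"
  by (rule periodic_bounded[OF continuous_on_H compact_cball, of 0 K i]) auto

lemma H_superlinear_ge: obtains K where "K > 0" "\<And>p. norm p \<ge> K \<Longrightarrow> H i x p \<ge> c * norm p"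
proof -
  have "eventually (\<lambda>p. H i x p / norm p \<ge> c) at_infinity"
    using H_superlinear[of i x] unfolding superlinear_def filterlim_at_top by blast
  then obtain b where b: "\<And>p. norm p \<ge> b \<Longrightarrow> H i x p / norm p \<ge> c"
    unfolding eventually_at_infinity by blast
  show ?thesis
  proof (rule that[of "max b 1"])
    fix p :: "real^'n" assume p: "norm p \<ge> max b 1"
    then have "norm p > 0" by linarith
    with b[of p] p show "H i x p \<ge> c * norm p" by (simp add: field_simps)
  qed auto
qed

text \<open>Superlinearity is assumed for each position separately; compactness and convexity make
  it uniform. If it failed along momenta going to infinity, convexity would carry the failure
  inwards along the segments to 0, down to a sphere of fixed radius. There a limit of positions and
  directions exists and contradicts superlinearity at the limit position.\<close>

lemma H_uniformly_superlinear:
  obtains K where "K > 0" "\<And>x p. norm p \<ge> K \<Longrightarrow> H i x p - H i x 0 \<ge> c * norm p"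
proof (rule ccontr)
  assume neg: "\<not> thesis"
  note K_rule = that
  have "\<exists>z p. z \<in> cbox 0 1 \<and> norm (p :: real^'n) \<ge> real (Suc n) \<and> H i (torus_proj z) p - H i (torus_proj z) 0 < c * norm p" for n
  proof -
    obtain x p where "norm p \<ge> real (Suc n)" "H i x p - H i x 0 < c * norm p"
      using neg K_rule[of "real (Suc n)"] by (metis not_le of_nat_0_less_iff zero_less_Suc)
    moreover obtain z where "x = torus_proj (frac_vec z)"
      using torus_surj[of x] torus_proj_frac_vec by metis
    ultimately show ?thesis using frac_vec_in_cbox[of z] by blast
  qed
  then obtain z p where zp: "\<And>n. z n \<in> cbox 0 (1::real^'n)" "\<And>n. norm (p n) \<ge> real (Suc n)"
      "\<And>n. H i (torus_proj (z n)) (p n) - H i (torus_proj (z n)) 0 < c * norm (p n)"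
    by metis
  define e where "e n = p n /\<^sub>R norm (p n)" for n
  have pos: "norm (p n) > 0" for n using zp(2)[of n] by linarith
  have "compact (cbox 0 (1::real^'n) \<times> sphere (0::real^'n) 1)"
    by (intro compact_Times) auto
  moreover have "\<forall>n. (z n, e n) \<in> cbox 0 1 \<times> sphere 0 1"
    using zp(1) pos by (auto simp: e_def)
  ultimately obtain l r where l: "l \<in> cbox 0 1 \<times> sphere 0 1" and r: "strict_mono r"
      and lim: "((\<lambda>n. (z n, e n)) \<circ> r) \<longlonglongrightarrow> l"
    unfolding compact_def by meson
  define z0 e0 where "z0 = fst l" and "e0 = snd l"
  have e0: "norm e0 = 1" using l by (auto simp: e0_def)
  define x0 where "x0 = torus_proj z0"
  \<comment> \<open>The slope exceeds \<open>c\<close> by enough to absorb \<open>H i x0 0\<close>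
    and still leave a strict inequality, provided that the radius is at least 1.\<close>
  obtain K0 where K0: "K0 > 0" "\<And>p. norm p \<ge> K0 \<Longrightarrow> H i x0 p \<ge> (c + 1 + \<bar>H i x0 0\<bar>) * norm p"
    using H_superlinear_ge by blast
  define K where "K = max K0 1"
  have K: "K \<ge> 1" "K \<ge> K0" by (auto simp: K_def)
  have limz: "(\<lambda>n. z (r n)) \<longlonglongrightarrow> z0" and lime: "(\<lambda>n. e (r n)) \<longlonglongrightarrow> e0"
    using tendsto_fst[OF lim] tendsto_snd[OF lim] by (auto simp: z0_def e0_def comp_def)
  have c': "isCont (\<lambda>(z, p). H i (torus_proj z) p) a" for a
    using continuous_on_H[of UNIV i] by (cases a) (simp add: continuous_on_eq_continuous_at)
  have "(\<lambda>n. (z (r n), K *\<^sub>R e (r n))) \<longlonglongrightarrow> (z0, K *\<^sub>R e0)"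
    by (intro tendsto_intros limz lime)
  from isCont_tendsto_compose[OF c' this]
  have l1: "(\<lambda>n. H i (torus_proj (z (r n))) (K *\<^sub>R e (r n))) \<longlonglongrightarrow> H i x0 (K *\<^sub>R e0)"
    by (simp add: x0_def)
  have "(\<lambda>n. (z (r n), 0 :: real^'n)) \<longlonglongrightarrow> (z0, 0)"
    by (intro tendsto_intros limz)
  from isCont_tendsto_compose[OF c' this]
  have l2: "(\<lambda>n. H i (torus_proj (z (r n))) 0) \<longlonglongrightarrow> H i x0 0"
    by (simp add: x0_def)
  have "H i (torus_proj (z n)) (K *\<^sub>R e n) - H i (torus_proj (z n)) 0 \<le> c * K" if n: "real n \<ge> K" for n
  proof -
    \<comment> \<open>The weight that writes the point of norm \<open>K\<close> in the direction of
      \<open>p n\<close> as a convex combination of 0 and \<open>p n\<close>.\<close>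
    define t where "t = K / norm (p n)"
    have t: "0 \<le> t" "t \<le> 1" using n zp(2)[of n] K pos[of n] by (auto simp: t_def)
    have "K *\<^sub>R e n = (1 - t) *\<^sub>R 0 + t *\<^sub>R p n"
      by (simp add: e_def t_def divide_inverse)
    then have "H i (torus_proj (z n)) (K *\<^sub>R e n)
        \<le> (1 - t) * H i (torus_proj (z n)) 0 + t * H i (torus_proj (z n)) (p n)"
      using convex_onD[OF H_convex, of t 0 "p n" i "torus_proj (z n)"] t by simp
    then have "H i (torus_proj (z n)) (K *\<^sub>R e n) - H i (torus_proj (z n)) 0
        \<le> t * (H i (torus_proj (z n)) (p n) - H i (torus_proj (z n)) 0)"
      by (simp add: algebra_simps)
    also have "\<dots> \<le> t * (c * norm (p n))"
      by (intro mult_left_mono less_imp_le zp t)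
    also have "\<dots> = c * K" using pos[of n] by (simp add: t_def)
    finally show ?thesis .
  qed
  moreover have "real (r n) \<ge> K" if "n \<ge> nat \<lceil>K\<rceil>" for n
    using seq_suble[OF r, of n] that by linarith
  ultimately have "\<forall>n\<ge>nat \<lceil>K\<rceil>. H i (torus_proj (z (r n))) (K *\<^sub>R e (r n)) - H i (torus_proj (z (r n))) 0 \<le> c * K"
    by auto
  from LIMSEQ_le_const2[OF tendsto_diff[OF l1 l2]] this have "H i x0 (K *\<^sub>R e0) - H i x0 0 \<le> c * K"
    by blast
  moreover have "H i x0 (K *\<^sub>R e0) \<ge> (c + 1 + \<bar>H i x0 0\<bar>) * K"
    using K0(2)[of "K *\<^sub>R e0"] K e0 by simp
  moreover have "\<bar>H i x0 0\<bar> * K \<ge> \<bar>H i x0 0\<bar>" using K(1) by (simp add: mult_le_cancel_left1)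
  ultimately show False using K(1) by (simp add: algebra_simps)
qed

text \<open>The supremum in \<open>lagrangian\<close> is taken in the reals and says something only
  about bounded sets. Beyond a large radius the linear term is beaten by \<open>H\<close>, and on
  the remaining ball everything is bounded.\<close>

lemma bdd_above_Fenchel: "bdd_above (range (\<lambda>p. p \<bullet> q - H i x p))"
proof -
  obtain K where K: "K > 0" "\<And>x p. norm p \<ge> K \<Longrightarrow> H i x p - H i x 0 \<ge> norm q * norm p"
    by (rule H_uniformly_superlinear[where i=i and c="norm q"]) blast
  obtain B where B: "B \<ge> 0" "\<And>x p. norm p \<le> K \<Longrightarrow> \<bar>H i x p\<bar> \<le> B" using H_bounded by blast
  show ?thesis
  proof (rule bdd_aboveI2)
    fix p
    have 1: "p \<bullet> q \<le> norm q * norm p" by (metis norm_cauchy_schwarz mult.commute)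
    show "p \<bullet> q - H i x p \<le> K * norm q + B"
    proof (cases "norm p \<ge> K")
      case True
      from K(2)[OF this, of x] B(2)[of 0 x] 1 K(1) have "p \<bullet> q - H i x p \<le> B" by (auto simp: abs_le_iff)
      with K(1) show ?thesis by (smt (verit) mult_nonneg_nonneg norm_ge_zero)
    next
      case False
      then have "norm q * norm p \<le> norm q * K" by (intro mult_left_mono) auto
      with 1 B(2)[of p x] False show ?thesis by (auto simp: abs_le_iff algebra_simps)
    qed
  qed
qed

lemma Fenchel_le: "p \<bullet> q \<le> H i x p + L i x q"
  using cSUP_upper[OF UNIV_I bdd_above_Fenchel, of p q i x] unfolding lagrangian_def by simp

lemma L_leI: "(\<And>p. p \<bullet> q - H i x p \<le> c) \<Longrightarrow> L i x q \<le> c"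
  unfolding lagrangian_def by (rule cSUP_least) auto

text \<open>The point at height \<open>e\<close> below the graph is strictly separated from the
  closed convex epigraph, and the slope of the hyperplane is an \<open>e\<close>-subgradient. An
  error \<open>e\<close> is harmless in the subsolution inequality, so no exact subgradient is
  constructed.\<close>

lemma approximate_subgradient:
  assumes "e > 0" obtains q where "H i x p + L i x q \<le> p \<bullet> q + e"
proof -
  let ?E = "epigraph UNIV (H i x)"
  have "closed ?E"
  proof -
    have "?E = {xy. H i x (fst xy) - snd xy \<le> 0}" by (auto simp: epigraph_def)
    also have "closed \<dots>"
      by (intro closed_Collect_le continuous_intros continuous_on_compose2[OF continuous_on_H_snd[of UNIV]]) auto
    finally show ?thesis .
  qed
  moreover have "convex ?E" by (rule convex_epigraphI[OF H_convex])
  moreover have "(p, H i x p - e) \<notin> ?E" using assms by (simp add: epigraph_def)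
  ultimately obtain a b where ab: "a \<bullet> (p, H i x p - e) < b" "\<And>y. y \<in> ?E \<Longrightarrow> a \<bullet> y > b"
    using separating_hyperplane_closed_point by metis
  obtain a1 c where a: "a = (a1, c)" by (cases a)
  have sep: "a1 \<bullet> p + c * (H i x p - e) < a1 \<bullet> p' + c * H i x p'" for p'
    using ab(1) ab(2)[of "(p', H i x p')"] by (simp add: a epigraph_def)
  \<comment> \<open>Comparing the point with the graph above it shows that the separating hyperplane
    is not vertical.\<close>
  have "c * e > 0" using sep[of p] by (simp add: algebra_simps)
  then have c: "c > 0" using assms by (simp add: zero_less_mult_iff)
  show ?thesis
  proof (rule that[of "- a1 /\<^sub>R c"])
    have "L i x (- a1 /\<^sub>R c) \<le> p \<bullet> (- a1 /\<^sub>R c) - H i x p + e"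
    proof (rule L_leI)
      fix p'
      have "(a1 \<bullet> p + c * (H i x p - e)) / c < (a1 \<bullet> p' + c * H i x p') / c"
        using sep[of p'] c by (rule divide_strict_right_mono)
      then show "p' \<bullet> (- a1 /\<^sub>R c) - H i x p' \<le> p \<bullet> (- a1 /\<^sub>R c) - H i x p + e"
        using c by (simp add: field_simps inner_commute)
    qed
    then show "H i x p + L i x (- a1 /\<^sub>R c) \<le> p \<bullet> (- a1 /\<^sub>R c) + e" by simp
  qed
qed

text \<open>For velocities up to \<open>R\<close> the supremum defining \<open>L\<close> is decided
  by momenta in a fixed ball of radius \<open>K\<close>. There \<open>p \<bullet> q\<close> is
  \<open>K\<close>-Lipschitz in \<open>q\<close> and \<open>H\<close> is uniformly continuous in the
  position. The radius is chosen before \<open>e\<close>, so the Lipschitz constant in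
  \<open>q\<close> does not depend on it.\<close>

lemma L_modulus:
  assumes "R \<ge> 0"
  obtains K where "K \<ge> 0" "\<And>e. e > 0 \<Longrightarrow> \<exists>d>0. \<forall>z z' q q'. dist z z' < d \<longrightarrow> norm q \<le> R \<longrightarrow> norm q' \<le> R \<longrightarrow>
    L i (torus_proj z) q \<le> L i (torus_proj z') q' + K * dist q q' + e"
proof -
  obtain K where K: "K > 0" "\<And>x p. norm p \<ge> K \<Longrightarrow> H i x p - H i x 0 \<ge> R * norm p"
    by (rule H_uniformly_superlinear[where i=i and c=R]) blast
  show ?thesis
  proof (rule that[of K])
    fix e :: real assume e: "e > 0"
    obtain d where d: "d > 0"
      "\<And>z z' p. dist z z' < d \<Longrightarrow> p \<in> cball 0 K \<Longrightarrow> \<bar>H i (torus_proj z) p - H i (torus_proj z') p\<bar> < e"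
      using periodic_uniformly_continuous[OF continuous_on_H[of "UNIV \<times> cball 0 K" i] compact_cball e] by blast
    have "L i (torus_proj z) q \<le> L i (torus_proj z') q' + K * dist q q' + e"
      if *: "dist z z' < d" "norm q \<le> R" "norm q' \<le> R" for z z' q q'
    proof (rule L_leI)
      fix p
      have small: "p' \<bullet> q - H i (torus_proj z) p' \<le> L i (torus_proj z') q' + K * dist q q' + e"
        if p': "norm p' \<le> K" for p'
      proof -
        have "p' \<bullet> q - p' \<bullet> q' \<le> norm p' * norm (q - q')"
          by (metis inner_diff_right norm_cauchy_schwarz)
        also have "\<dots> \<le> K * dist q q'" unfolding dist_norm by (intro mult_right_mono p') auto
        finally show ?thesis
          using Fenchel_le[of p' q' i "torus_proj z'"] d(2)[OF *(1), of p'] p' by (auto simp: abs_less_iff)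
      qed
      show "p \<bullet> q - H i (torus_proj z) p \<le> L i (torus_proj z') q' + K * dist q q' + e"
      proof (cases "norm p \<le> K")
        case False
        \<comment> \<open>Momenta outside the ball do no better than the momentum 0.\<close>
        have "p \<bullet> q \<le> norm p * R"
          by (rule order_trans[OF norm_cauchy_schwarz]) (intro mult_left_mono *, simp)
        with K(2)[of p "torus_proj z"] False have "p \<bullet> q - H i (torus_proj z) p \<le> 0 \<bullet> q - H i (torus_proj z) 0"
          by (simp add: mult.commute)
        with small[of 0] K show ?thesis by simp
      qed (rule small)
    qed
    then show "\<exists>d>0. \<forall>z z' q q'. dist z z' < d \<longrightarrow> norm q \<le> R \<longrightarrow> norm q' \<le> R \<longrightarrow>
      L i (torus_proj z) q \<le> L i (torus_proj z') q' + K * dist q q' + e" using d(1) by blast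
  qed (use K in auto)
qed

lemma continuous_on_L: "continuous_on S (\<lambda>(z, q). L i (torus_proj z) q)"
proof (rule continuous_on_subset[of UNIV], unfold continuous_on_iff, safe)
  fix z0 :: "real^'n" and q0 :: "real^'n" and e :: real assume e: "e > 0"
  obtain K where K: "K \<ge> 0" "\<And>e. e > 0 \<Longrightarrow> \<exists>d>0. \<forall>z z' q q'. dist z z' < d \<longrightarrow> norm q \<le> norm q0 + 1 \<longrightarrow> norm q' \<le> norm q0 + 1 \<longrightarrow>
    L i (torus_proj z) q \<le> L i (torus_proj z') q' + K * dist q q' + e"
    by (rule L_modulus[where i=i and R="norm q0 + 1"]) auto
  have "e / 3 > 0" using e by simp
  from K(2)[OF this] obtain d where d: "d > 0" "\<And>z z' q q'. dist z z' < d \<Longrightarrow> norm q \<le> norm q0 + 1 \<Longrightarrow> norm q' \<le> norm q0 + 1 \<Longrightarrow>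
    L i (torus_proj z) q \<le> L i (torus_proj z') q' + K * dist q q' + e / 3" by blast
  define d' where "d' = min d (min 1 (e / (3 * (K + 1))))"
  have d': "d' > 0" using d e K by (auto simp: d'_def)
  show "\<exists>d>0. \<forall>x'\<in>UNIV. dist x' (z0, q0) < d \<longrightarrow>
      dist (case x' of (z, q) \<Rightarrow> L i (torus_proj z) q) (L i (torus_proj z0) q0) < e"
  proof (intro exI[of _ d'] conjI d' ballI impI)
    fix zq assume *: "dist zq (z0, q0) < d'"
    obtain z q where zq: "zq = (z, q)" by (cases zq)
    have dz: "dist z z0 < d'" and dq: "dist q q0 < d'"
      using * dist_fst_le[of zq "(z0, q0)"] dist_snd_le[of zq "(z0, q0)"] by (auto simp: zq)
    have "norm q \<le> norm q0 + 1"
      using dq norm_triangle_sub[of q q0] by (auto simp: d'_def dist_norm)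
    moreover have "K * dist q q0 \<le> e / 3"
    proof -
      have "K * dist q q0 \<le> (K + 1) * (e / (3 * (K + 1)))"
        using dq K by (intro mult_mono) (auto simp: d'_def)
      also have "\<dots> = e / 3" using K by (simp add: field_simps)
      finally show ?thesis .
    qed
    moreover have "dist z z0 < d" "dist z0 z < d" using dz by (auto simp: d'_def dist_commute)
    ultimately show "dist (case zq of (z, q) \<Rightarrow> L i (torus_proj z) q) (L i (torus_proj z0) q0) < e"
      using d(2)[of z z0 q q0] d(2)[of z0 z q0 q] e
      unfolding zq prod.case dist_real_def by (simp add: dist_commute abs_less_iff)
  qed
qed auto

lemma L_bounded:
  obtains C where "C \<ge> 0" "\<And>i x q. norm q \<le> R \<Longrightarrow> \<bar>L i x q\<bar> \<le> C"
proof -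
  have "\<exists>C. C \<ge> 0 \<and> (\<forall>x q. norm q \<le> R \<longrightarrow> \<bar>L i x q\<bar> \<le> C)" for i
    by (rule periodic_bounded[OF continuous_on_L compact_cball, of 0 R i]) auto
  then obtain C where C: "\<And>i. C i \<ge> 0" "\<And>i x q. norm q \<le> R \<Longrightarrow> \<bar>L i x q\<bar> \<le> C i" by metis
  show ?thesis
  proof (rule that[of "\<Sum>i\<in>UNIV. C i"])
    fix i :: 'm and x and q :: "real^'n" assume "norm q \<le> R"
    then have "\<bar>L i x q\<bar> \<le> C i" by (rule C)
    also have "\<dots> \<le> (\<Sum>i\<in>UNIV. C i)" by (rule member_le_sum) (auto simp: C)
    finally show "\<bar>L i x q\<bar> \<le> (\<Sum>i\<in>UNIV. C i)" .
  qed (auto intro: sum_nonneg C)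
qed

lemma L_uniformly_continuous:
  assumes "e > 0"
  obtains d where "d > 0"
    "\<And>i z z' q. dist z z' < d \<Longrightarrow> norm q \<le> R \<Longrightarrow> \<bar>L i (torus_proj z) q - L i (torus_proj z') q\<bar> < e"
proof -
  have "\<exists>d>0. \<forall>z z' q. dist z z' < d \<longrightarrow> norm q \<le> R \<longrightarrow> \<bar>L i (torus_proj z) q - L i (torus_proj z') q\<bar> < e" for i
    by (rule periodic_uniformly_continuous[OF continuous_on_L compact_cball assms, of 0 R i]) auto
  then obtain d where d: "\<And>i. d i > 0"
    "\<And>i z z' q. dist z z' < d i \<Longrightarrow> norm q \<le> R \<Longrightarrow> \<bar>L i (torus_proj z) q - L i (torus_proj z') q\<bar> < e"
    by metis
  show ?thesis by (rule that[of "Min (range d)"]) (auto simp: d)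
qed

end

subsection \<open>Cadlag paths\<close>

lemma limitin_discrete: "limitin (discrete_topology UNIV) f l F \<longleftrightarrow> (\<forall>\<^sub>F x in F. f x = l)"
  unfolding limitin_def by (auto elim: eventually_mono dest: spec[of _ "{l}"])

lemma index_paths_iff:
  "\<omega> \<in> index_paths \<longleftrightarrow> \<omega> \<in> extensional {0..} \<and> (\<forall>t\<ge>0. \<forall>\<^sub>F s in at_right t. \<omega> s = \<omega> t) \<and>
    (\<forall>t>0. \<exists>l. \<forall>\<^sub>F s in at_left t. \<omega> s = l)"
  by (simp add: cadlag_paths_def limitin_discrete)

abbreviation vector_paths :: "(real \<Rightarrow> 'a::topological_space) set" where
  "vector_paths \<equiv> cadlag_paths euclidean"

lemma vector_paths_iff:
  "\<xi> \<in> vector_paths \<longleftrightarrow> \<xi> \<in> extensional {0..} \<and> (\<forall>t\<ge>0. (\<xi> \<longlongrightarrow> \<xi> t) (at_right t)) \<and>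
    (\<forall>t>0. \<exists>l. (\<xi> \<longlongrightarrow> l) (at_left t))"
  by (simp add: cadlag_paths_def)

lemma space_eval_algebra [simp]: "space (eval_algebra X I) = cadlag_paths X"
  by (auto simp: eval_algebra_def space_measure_of_conv)

lemma eval_algebra_sets:
  "s \<in> I \<Longrightarrow> openin X U \<Longrightarrow> {\<omega> \<in> cadlag_paths X. \<omega> s \<in> U} \<in> sets (eval_algebra X I)"
  unfolding eval_algebra_def by (subst sets_measure_of) (auto intro: sigma_sets.Basic)

lemma measurable_eval_discrete [measurable (raw)]:
  "s \<in> I \<Longrightarrow> (\<lambda>\<omega>. \<omega> s) \<in> eval_algebra (discrete_topology UNIV) I \<rightarrow>\<^sub>M count_space UNIV"
  by (rule measurableI)
    (use eval_algebra_sets[of s I "discrete_topology UNIV"] in \<open>auto simp: vimage_def Int_def conj_commute\<close>)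

lemma measurable_eval_vector:
  "s \<in> I \<Longrightarrow> (\<lambda>\<xi>. \<xi> s) \<in> eval_algebra euclidean I \<rightarrow>\<^sub>M borel"
  by (rule borel_measurableI)
    (use eval_algebra_sets[of s I euclidean] in \<open>auto simp: vimage_def Int_def conj_commute\<close>)

lemma measurable_eval_algebraI:
  assumes "f \<in> space M \<rightarrow> cadlag_paths X"
    and "\<And>s U. s \<in> I \<Longrightarrow> openin X U \<Longrightarrow> {w \<in> space M. f w s \<in> U} \<in> sets M"
  shows "f \<in> M \<rightarrow>\<^sub>M eval_algebra X I"
  unfolding eval_algebra_def
proof (rule measurable_measure_of)
  fix A assume "A \<in> {{\<omega> \<in> cadlag_paths X. \<omega> s \<in> U} |s U. s \<in> I \<and> openin X U}"
  then obtain s U where A: "A = {\<omega> \<in> cadlag_paths X. \<omega> s \<in> U}" "s \<in> I" "openin X U" by blast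
  have "f -` A \<inter> space M = {w \<in> space M. f w s \<in> U}" using assms(1) by (auto simp: A)
  with assms(2) A show "f -` A \<inter> space M \<in> sets M" by simp
qed (use assms in auto)

lemma measurable_index_pathsI:
  assumes "\<And>w. w \<in> space M \<Longrightarrow> f w \<in> index_paths"
    and "\<And>s. s \<in> I \<Longrightarrow> (\<lambda>w. f w s) \<in> M \<rightarrow>\<^sub>M count_space UNIV"
  shows "f \<in> M \<rightarrow>\<^sub>M eval_algebra (discrete_topology UNIV) I"
  using assms measurable_sets[OF assms(2)]
  by (intro measurable_eval_algebraI) (auto simp: vimage_def Int_def conj_commute)

lemma measurable_vector_pathsI:
  assumes "\<And>w. w \<in> space M \<Longrightarrow> f w \<in> vector_paths"
    and "\<And>s. s \<in> I \<Longrightarrow> (\<lambda>w. f w s) \<in> M \<rightarrow>\<^sub>M borel"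
  shows "f \<in> M \<rightarrow>\<^sub>M eval_algebra euclidean I"
proof (rule measurable_eval_algebraI)
  fix s and U :: "'b set" assume "s \<in> I" "openin euclidean U"
  then show "{w \<in> space M. f w s \<in> U} \<in> sets M"
    using measurable_sets[OF assms(2), of s U] by (auto simp: vimage_def Int_def conj_commute)
qed (use assms in auto)

lemma measurable_eval_algebra_mono:
  assumes f: "f \<in> eval_algebra (discrete_topology UNIV) I \<rightarrow>\<^sub>M N" and "I \<subseteq> J"
  shows "f \<in> eval_algebra (discrete_topology UNIV) J \<rightarrow>\<^sub>M N"
proof -
  have "(\<lambda>\<omega>. \<omega>) \<in> eval_algebra (discrete_topology UNIV) J \<rightarrow>\<^sub>M eval_algebra (discrete_topology UNIV) I"
    by (rule measurable_index_pathsI) (use assms(2) in \<open>auto intro!: measurable_eval_discrete\<close>)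
  from measurable_compose[OF this f] show ?thesis .
qed

lemma sets_eval_algebra_mono:
  assumes "I \<subseteq> J"
  shows "sets (eval_algebra (discrete_topology UNIV) I) \<subseteq> sets (eval_algebra (discrete_topology UNIV) J)"
proof
  fix A :: "(real \<Rightarrow> 'a) set" assume A: "A \<in> sets (eval_algebra (discrete_topology UNIV) I)"
  have "(\<lambda>\<omega>. \<omega>) -` A \<inter> index_paths \<in> sets (eval_algebra (discrete_topology UNIV) J)"
    using measurable_sets[OF measurable_eval_algebra_mono[OF measurable_ident assms] A] by (simp add: id_def)
  moreover have "(\<lambda>\<omega>. \<omega>) -` A \<inter> index_paths = A" using sets.sets_into_space[OF A] by auto
  ultimately show "A \<in> sets (eval_algebra (discrete_topology UNIV) J)" by simp
qed

lemma filterlim_minus_at_right: "filterlim (\<lambda>s. s - h) (at_right (t - h)) (at_right (t::real))"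
  unfolding filterlim_at
  by (auto intro!: tendsto_intros eventually_at_rightI[of t "t + 1"])

lemma filterlim_minus_at_left: "filterlim (\<lambda>s. s - h) (at_left (t - h)) (at_left (t::real))"
  unfolding filterlim_at
  by (auto intro!: tendsto_intros eventually_at_leftI[of "t - 1" t])

lemma filterlim_plus_at_right: "filterlim (\<lambda>s. h + s) (at_right (h + t)) (at_right (t::real))"
  using filterlim_minus_at_right[of "-h" t] by (simp add: add.commute)

lemma filterlim_plus_at_left: "filterlim (\<lambda>s. h + s) (at_left (h + t)) (at_left (t::real))"
  using filterlim_minus_at_left[of "-h" t] by (simp add: add.commute)

lemma eventually_at_right_ge0: "t \<ge> 0 \<Longrightarrow> \<forall>\<^sub>F s in at_right t. s \<ge> (0::real)"
  by (auto intro!: eventually_at_rightI[of t "t + 1"])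

lemma eventually_at_left_ge0: "t > 0 \<Longrightarrow> \<forall>\<^sub>F s in at_left t. s \<ge> (0::real)"
  by (auto intro!: eventually_at_leftI[of 0 t])

section \<open>Shifting, stopping and concatenating paths\<close>

definition shift_path :: "real \<Rightarrow> (real \<Rightarrow> 'a) \<Rightarrow> real \<Rightarrow> 'a" where
  "shift_path h \<omega> = (\<lambda>s. if s \<ge> 0 then \<omega> (h + s) else undefined)"

definition stop_path :: "real \<Rightarrow> (real \<Rightarrow> 'a) \<Rightarrow> real \<Rightarrow> 'a" where
  "stop_path t \<omega> = (\<lambda>s. if s \<ge> 0 then \<omega> (min s t) else undefined)"

lemma shift_path_in:
  assumes w: "\<omega> \<in> index_paths" and h: "h \<ge> 0"
  shows "shift_path h \<omega> \<in> index_paths"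
  unfolding index_paths_iff
proof (intro conjI allI impI)
  fix t :: real assume t: "t \<ge> 0"
  have "\<forall>\<^sub>F s in at_right t. \<omega> (h + s) = \<omega> (h + t)"
  proof -
    have "\<forall>\<^sub>F s in at_right (h + t). \<omega> s = \<omega> (h + t)"
      using w h t unfolding index_paths_iff by simp
    then show ?thesis using filterlim_plus_at_right[of h t] unfolding filterlim_iff by blast
  qed
  then show "\<forall>\<^sub>F s in at_right t. shift_path h \<omega> s = shift_path h \<omega> t"
    using eventually_at_right_ge0[OF t] by eventually_elim (use t in \<open>auto simp: shift_path_def\<close>)
next
  fix t :: real assume t: "t > 0"
  obtain l where "\<forall>\<^sub>F s in at_left (h + t). \<omega> s = l"
    using w h t unfolding index_paths_iff by (metis add_nonneg_pos)
  then have "\<forall>\<^sub>F s in at_left t. \<omega> (h + s) = l"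
    using filterlim_plus_at_left[of h t] unfolding filterlim_iff by blast
  then have "\<forall>\<^sub>F s in at_left t. shift_path h \<omega> s = l"
    using eventually_at_left_ge0[OF t] by eventually_elim (auto simp: shift_path_def)
  then show "\<exists>l. \<forall>\<^sub>F s in at_left t. shift_path h \<omega> s = l" ..
qed (auto simp: shift_path_def extensional_def)

lemma stop_path_in:
  assumes w: "\<omega> \<in> index_paths" and T: "T \<ge> 0"
  shows "stop_path T \<omega> \<in> index_paths"
  unfolding index_paths_iff
proof (intro conjI allI impI)
  fix t :: real assume t: "t \<ge> 0"
  show "\<forall>\<^sub>F s in at_right t. stop_path T \<omega> s = stop_path T \<omega> t"
  proof (cases "t < T")
    case True
    have "\<forall>\<^sub>F s in at_right t. \<omega> s = \<omega> t" using w t unfolding index_paths_iff by blast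
    moreover have "\<forall>\<^sub>F s in at_right t. s < T" using True by (auto intro!: eventually_at_rightI[of t T])
    ultimately show ?thesis
      using eventually_at_right_ge0[OF t] by eventually_elim (use t True in \<open>auto simp: stop_path_def min_def\<close>)
  next
    case False
    then show ?thesis
      by (intro eventually_at_rightI[of t "t + 1"]) (use t in \<open>auto simp: stop_path_def min_def\<close>)
  qed
next
  fix t :: real assume t: "t > 0"
  show "\<exists>l. \<forall>\<^sub>F s in at_left t. stop_path T \<omega> s = l"
  proof (cases "t \<le> T")
    case True
    obtain l where "\<forall>\<^sub>F s in at_left t. \<omega> s = l" using w t unfolding index_paths_iff by blast
    moreover have "\<forall>\<^sub>F s in at_left t. 0 < s \<and> s < t" using t by (auto intro!: eventually_at_leftI[of 0 t])
    ultimately have "\<forall>\<^sub>F s in at_left t. stop_path T \<omega> s = l"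
      by eventually_elim (use True in \<open>auto simp: stop_path_def min_def\<close>)
    then show ?thesis ..
  next
    case False
    then have "\<forall>\<^sub>F s in at_left t. stop_path T \<omega> s = \<omega> T"
      by (intro eventually_at_leftI[of T t]) (use T in \<open>auto simp: stop_path_def min_def\<close>)
    then show ?thesis ..
  qed
qed (auto simp: stop_path_def extensional_def)

lemma shift_path_0: "\<omega> \<in> index_paths \<Longrightarrow> shift_path 0 \<omega> = \<omega>"
  by (auto simp: shift_path_def index_paths_iff extensional_def fun_eq_iff)

lemma measurable_shift_path:
  assumes "h \<ge> 0" "\<And>s. s \<in> J \<Longrightarrow> s \<ge> 0 \<and> h + s \<in> I"
  shows "shift_path h \<in> eval_algebra (discrete_topology UNIV) I \<rightarrow>\<^sub>M eval_algebra (discrete_topology UNIV) J"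
  by (rule measurable_index_pathsI)
    (use assms in \<open>auto simp: shift_path_def intro!: measurable_eval_discrete shift_path_in[unfolded shift_path_def]\<close>)

text \<open>This turns pathwise nonanticipation into measurability: a functional that depends on the
  path up to time \<open>t\<close> only is unchanged by composition with \<open>stop_path t\<close>,
  and is therefore measurable at time \<open>t\<close>.\<close>

lemma measurable_stop_path:
  assumes "t \<ge> 0"
  shows "stop_path t \<in> path_filtration t \<rightarrow>\<^sub>M path_algebra"
proof (rule measurable_index_pathsI)
  show "stop_path t \<omega> \<in> index_paths" if "\<omega> \<in> space (path_filtration t)" for \<omega> :: "real \<Rightarrow> 'a"
    using stop_path_in that assms by simp
  show "(\<lambda>\<omega>. stop_path t \<omega> s) \<in> path_filtration t \<rightarrow>\<^sub>M count_space UNIV" if "s \<in> {0..}" for s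
    using that assms by (auto simp: stop_path_def intro!: measurable_eval_discrete)
qed

text \<open>The constant piece lives on the half-open interval up to \<open>h\<close>, which keeps
  the path right continuous at \<open>h\<close>. Negative times return to \<open>undefined\<close>
  because paths are extensional on the half-line.\<close>

definition concat_path :: "real \<Rightarrow> 'a \<Rightarrow> (real \<Rightarrow> 'a) \<Rightarrow> real \<Rightarrow> 'a" where
  "concat_path h c \<xi> = (\<lambda>s. if s < 0 then undefined else if s < h then c else \<xi> (s - h))"

lemma concat_path_in:
  assumes x: "\<xi> \<in> vector_paths" and h: "h \<ge> 0"
  shows "concat_path h c \<xi> \<in> vector_paths"
  unfolding vector_paths_iff
proof (intro conjI allI impI)
  fix t :: real assume t: "t \<ge> 0"
  show "(concat_path h c \<xi> \<longlongrightarrow> concat_path h c \<xi> t) (at_right t)"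
  proof (cases "t < h")
    case True
    then have "\<forall>\<^sub>F s in at_right t. concat_path h c \<xi> s = concat_path h c \<xi> t"
      by (intro eventually_at_rightI[of t h]) (use t in \<open>auto simp: concat_path_def\<close>)
    then show ?thesis by (rule tendsto_eventually)
  next
    case False
    then have "(\<xi> \<longlongrightarrow> \<xi> (t - h)) (at_right (t - h))" using x unfolding vector_paths_iff by simp
    from filterlim_compose[OF this filterlim_minus_at_right]
    have "((\<lambda>s. \<xi> (s - h)) \<longlongrightarrow> concat_path h c \<xi> t) (at_right t)"
      using False t by (simp add: concat_path_def)
    moreover have "\<forall>\<^sub>F s in at_right t. concat_path h c \<xi> s = \<xi> (s - h)"
      using False t by (intro eventually_at_rightI[of t "t + 1"]) (auto simp: concat_path_def)
    ultimately show ?thesis using tendsto_cong by fast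
  qed
next
  fix t :: real assume t: "t > 0"
  show "\<exists>l. (concat_path h c \<xi> \<longlongrightarrow> l) (at_left t)"
  proof (cases "t \<le> h")
    case True
    then have "\<forall>\<^sub>F s in at_left t. concat_path h c \<xi> s = c"
      by (intro eventually_at_leftI[of 0 t]) (use t in \<open>auto simp: concat_path_def\<close>)
    then show ?thesis using tendsto_eventually by blast
  next
    case False
    then obtain l where "(\<xi> \<longlongrightarrow> l) (at_left (t - h))" using x unfolding vector_paths_iff by force
    from filterlim_compose[OF this filterlim_minus_at_left]
    have "((\<lambda>s. \<xi> (s - h)) \<longlongrightarrow> l) (at_left t)" .
    moreover have "\<forall>\<^sub>F s in at_left t. concat_path h c \<xi> s = \<xi> (s - h)"
      using False h by (intro eventually_at_leftI[of h t]) (auto simp: concat_path_def)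
    ultimately show ?thesis using tendsto_cong by fast
  qed
qed (auto simp: concat_path_def extensional_def)

text \<open>One-sided limits bound the path near each time, and a bisection argument
  (\<open>Bolzano\<close>) glues local bounds on a compact interval.\<close>

lemma vector_path_bounded:
  fixes \<xi> :: "real \<Rightarrow> 'a::real_normed_vector"
  assumes x: "\<xi> \<in> vector_paths"
  obtains R where "R > 0" "\<And>s. 0 \<le> s \<Longrightarrow> s \<le> t \<Longrightarrow> norm (\<xi> s) \<le> R"
proof -
  have ev: "\<forall>\<^sub>F s in F. norm (\<xi> s) \<le> norm l + 1" if "(\<xi> \<longlongrightarrow> l) F" for F l
    using order_tendstoD(2)[OF tendsto_norm[OF that], of "norm l + 1"] by (simp add: eventually_mono)
  have "\<exists>R. \<forall>s. 0 \<le> s \<longrightarrow> s \<le> t \<longrightarrow> norm (\<xi> s) \<le> R"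
  proof (cases "0 \<le> t")
    case True
    \<comment> \<open>The condition \<open>0 \<le> s\<close> is built in because the small intervals
      of the bisection principle may reach to negative times, where nothing is known.\<close>
    define Q where "Q a b \<longleftrightarrow> (\<exists>R. \<forall>s. 0 \<le> s \<and> a \<le> s \<and> s \<le> b \<longrightarrow> norm (\<xi> s) \<le> R)" for a b
    have "Q 0 t" using True
    proof (induction rule: Bolzano)
      case (trans a b c)
      then obtain R1 R2 where R: "\<And>s. 0 \<le> s \<Longrightarrow> a \<le> s \<Longrightarrow> s \<le> b \<Longrightarrow> norm (\<xi> s) \<le> R1" "\<And>s. 0 \<le> s \<Longrightarrow> b \<le> s \<Longrightarrow> s \<le> c \<Longrightarrow> norm (\<xi> s) \<le> R2"
        unfolding Q_def by blast
      show ?case unfolding Q_def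
      proof (intro exI[of _ "max R1 R2"] allI impI)
        fix s assume "0 \<le> s \<and> a \<le> s \<and> s \<le> c"
        then show "norm (\<xi> s) \<le> max R1 R2" using R[of s] by (cases "s \<le> b") (auto simp: le_max_iff_disj)
      qed
    next
      case (local y)
      have "(\<xi> \<longlongrightarrow> \<xi> y) (at_right y)" using x local unfolding vector_paths_iff by blast
      from ev[OF this] obtain b where b: "b > y" "\<And>s. y < s \<Longrightarrow> s < b \<Longrightarrow> norm (\<xi> s) \<le> norm (\<xi> y) + 1"
        unfolding eventually_at_right_field by blast
      have "\<exists>c R. c < y \<and> (\<forall>s. c < s \<and> s < y \<and> 0 \<le> s \<longrightarrow> norm (\<xi> s) \<le> R)"
      proof (cases "y = 0")
        case True
        then show ?thesis by (intro exI[of _ "-1"]) auto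
      next
        case False
        with local obtain l where "(\<xi> \<longlongrightarrow> l) (at_left y)" using x unfolding vector_paths_iff by fastforce
        from ev[OF this] show ?thesis unfolding eventually_at_left_field by blast
      qed
      then obtain c R where c: "c < y" "\<And>s. c < s \<Longrightarrow> s < y \<Longrightarrow> 0 \<le> s \<Longrightarrow> norm (\<xi> s) \<le> R" by blast
      show ?case
      proof (intro exI[of _ "min (b - y) (y - c)"] conjI allI impI)
        fix a' b' assume *: "a' \<le> y \<and> y \<le> b' \<and> b' - a' < min (b - y) (y - c)"
        show "Q a' b'" unfolding Q_def
        proof (intro exI[of _ "max R (norm (\<xi> y) + 1)"] allI impI)
          fix s assume s: "0 \<le> s \<and> a' \<le> s \<and> s \<le> b'"
          consider "s < y" | "s = y" | "s > y" by linarith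
          then show "norm (\<xi> s) \<le> max R (norm (\<xi> y) + 1)"
            using b(2)[of s] c(2)[of s] * s by cases (auto simp: le_max_iff_disj)
        qed
      qed (use b c in auto)
    qed
    then show ?thesis unfolding Q_def by blast
  next
    case False
    then show ?thesis by auto
  qed
  then obtain R where "\<And>s. 0 \<le> s \<Longrightarrow> s \<le> t \<Longrightarrow> norm (\<xi> s) \<le> R" by blast
  then show ?thesis by (intro that[of "max R 1"]) (auto simp: le_max_iff_disj)
qed

text \<open>Each time is approximated from the right by grid times. A function evaluated at the grid
  time takes countably many measurable forms, and right continuity passes to the limit. The
  truncation \<open>max 0 s\<close> makes the statement meaningful on the whole line although paths
  carry information only at nonnegative times.\<close>

lemma measurable_right_continuous:
  fixes f :: "'w \<Rightarrow> real \<Rightarrow> 'b::metric_space"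
  assumes m: "\<And>s. 0 \<le> s \<Longrightarrow> (\<lambda>w. f w s) \<in> borel_measurable M"
    and rc: "\<And>w s. w \<in> space M \<Longrightarrow> 0 \<le> s \<Longrightarrow> (f w \<longlongrightarrow> f w s) (at_right s)"
  shows "(\<lambda>(w, s). f w (max 0 s)) \<in> borel_measurable (M \<Otimes>\<^sub>M borel)"
proof (rule borel_measurable_LIMSEQ_metric)
  \<comment> \<open>Adding 1 after rounding down makes the grid time strictly larger than
    \<open>max 0 s\<close>, as convergence along \<open>at_right\<close> demands.\<close>
  define g where "g n s = real (nat \<lfloor>real (Suc n) * max 0 s\<rfloor> + 1) / real (Suc n)" for n and s :: real
  show "(\<lambda>(w, s). f w (g n s)) \<in> borel_measurable (M \<Otimes>\<^sub>M borel)" for n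
  proof -
    have *: "(\<lambda>ws. f (fst ws) (real (k + 1) / real (Suc n))) \<in> borel_measurable (M \<Otimes>\<^sub>M borel)" for k
      by (rule measurable_compose[OF measurable_fst m]) auto
    have "(\<lambda>s::real. nat \<lfloor>real (Suc n) * max 0 s\<rfloor>) \<in> borel \<rightarrow>\<^sub>M count_space UNIV" by measurable
    from measurable_compose[OF measurable_snd this]
    have "(\<lambda>ws. nat \<lfloor>real (Suc n) * max 0 (snd ws)\<rfloor>) \<in> M \<Otimes>\<^sub>M borel \<rightarrow>\<^sub>M count_space UNIV" .
    from measurable_compose_countable[where f="\<lambda>k ws. f (fst ws) (real (k + 1) / real (Suc n))", OF * this] show ?thesis
      unfolding case_prod_beta g_def .
  qed
  fix ws assume "ws \<in> space (M \<Otimes>\<^sub>M (borel :: real measure))"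
  then obtain w s where ws: "ws = (w, s)" "w \<in> space M" by (auto simp: space_pair_measure)
  have g: "max 0 s < g n s \<and> g n s \<le> max 0 s + 1 / real (Suc n)" for n
  proof -
    define y where "y = real (Suc n) * max 0 s"
    have "y \<ge> 0" by (simp add: y_def)
    then have "real (nat \<lfloor>y\<rfloor>) = of_int \<lfloor>y\<rfloor>" by simp
    then have 1: "y < real (nat \<lfloor>y\<rfloor> + 1)" "real (nat \<lfloor>y\<rfloor> + 1) \<le> y + 1" by linarith+
    have 2: "max 0 s = y / real (Suc n)" by (simp add: y_def)
    have "y / real (Suc n) < real (nat \<lfloor>y\<rfloor> + 1) / real (Suc n)"
      by (rule divide_strict_right_mono[OF 1(1)]) simp
    moreover have "real (nat \<lfloor>y\<rfloor> + 1) / real (Suc n) \<le> (y + 1) / real (Suc n)"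
      by (rule divide_right_mono[OF 1(2)]) simp
    ultimately show ?thesis
      unfolding g_def y_def[symmetric] 2 by (simp add: add_divide_distrib)
  qed
  have "(\<lambda>n. g n s) \<longlonglongrightarrow> max 0 s"
  proof (rule real_tendsto_sandwich[of "\<lambda>_. max 0 s" _ _ "\<lambda>n. max 0 s + 1 / real (Suc n)"])
    show "(\<lambda>n. max 0 s + 1 / real (Suc n)) \<longlonglongrightarrow> max 0 s"
      using tendsto_add[OF tendsto_const LIMSEQ_inverse_real_of_nat, of "max 0 s"]
      by (simp add: inverse_eq_divide)
  qed (use g in \<open>auto intro!: always_eventually less_imp_le\<close>)
  then have "filterlim (\<lambda>n. g n s) (at_right (max 0 s)) sequentially"
    unfolding filterlim_at using g by (auto intro!: always_eventually simp: less_imp_neq[symmetric])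
  from filterlim_compose[OF rc[OF ws(2), of "max 0 s"] this]
  show "(\<lambda>n. case ws of (w, s) \<Rightarrow> f w (g n s)) \<longlonglongrightarrow> (case ws of (w, s) \<Rightarrow> f w (max 0 s))"
    by (simp add: ws)
qed

text \<open>The right-continuity argument is stated for metric values, so it is applied to the real
  indicator of each single index.\<close>

lemma measurable_index_path [measurable]:
  "(\<lambda>(\<omega>, s). \<omega> (max 0 s)) \<in> path_algebra \<Otimes>\<^sub>M borel \<rightarrow>\<^sub>M (count_space UNIV :: 'm::finite measure)"
proof (subst measurable_count_space_eq2, safe)
  fix j :: 'm
  let ?f = "\<lambda>(\<omega> :: real \<Rightarrow> 'm) s. if \<omega> s = j then 1 else 0 :: real"
  have "(\<lambda>(\<omega>, s). ?f \<omega> (max 0 s)) \<in> borel_measurable (path_algebra \<Otimes>\<^sub>M borel)"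
  proof (rule measurable_right_continuous)
    show "(\<lambda>\<omega>. ?f \<omega> s) \<in> borel_measurable path_algebra" if "0 \<le> s" for s
    proof -
      have "(\<lambda>\<omega>. \<omega> s) \<in> path_algebra \<rightarrow>\<^sub>M (count_space UNIV :: 'm measure)"
        using that by (intro measurable_eval_discrete) simp
      from measurable_compose[OF this, of "\<lambda>i. if i = j then 1 else 0" borel] show ?thesis by simp
    qed
    fix \<omega> :: "real \<Rightarrow> 'm" and s :: real assume "\<omega> \<in> space path_algebra" "0 \<le> s"
    then have "\<forall>\<^sub>F t in at_right s. \<omega> t = \<omega> s" by (simp add: index_paths_iff)
    then have "\<forall>\<^sub>F t in at_right s. ?f \<omega> t = ?f \<omega> s" by eventually_elim simp
    then show "(?f \<omega> \<longlongrightarrow> ?f \<omega> s) (at_right s)" by (rule tendsto_eventually)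
  qed
  from measurable_sets[OF this, of "{1}"]
  show "(\<lambda>(\<omega>, s). \<omega> (max 0 s)) -` {j} \<inter> space (path_algebra \<Otimes>\<^sub>M borel) \<in> sets (path_algebra \<Otimes>\<^sub>M borel)"
    by (rule back_subst[where P="\<lambda>A. A \<in> _"]) (auto split: if_splits)
qed auto

lemma measurable_vector_path:
  fixes \<Xi> :: "'w \<Rightarrow> real \<Rightarrow> 'b::metric_space"
  assumes "\<Xi> \<in> M \<rightarrow>\<^sub>M eval_algebra euclidean {0..}"
  shows "(\<lambda>(w, s). \<Xi> w (max 0 s)) \<in> borel_measurable (M \<Otimes>\<^sub>M borel)"
proof (rule measurable_right_continuous)
  show "(\<lambda>w. \<Xi> w s) \<in> borel_measurable M" if "0 \<le> s" for s
    using measurable_compose[OF assms measurable_eval_vector, of s] that by simp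
  show "(\<Xi> w \<longlongrightarrow> \<Xi> w s) (at_right s)" if "w \<in> space M" "0 \<le> s" for w s
    using measurable_space[OF assms that(1)] that(2) by (simp add: vector_paths_iff)
qed

subsection \<open>Displacements and running costs\<close>

lemma set_integrable_bounded:
  fixes f :: "real \<Rightarrow> 'b::{banach, second_countable_topology}"
  assumes m: "(\<lambda>s. f (max 0 s)) \<in> borel_measurable borel"
    and b: "\<And>s. a \<le> s \<Longrightarrow> s \<le> b \<Longrightarrow> norm (f s) \<le> B" and a: "0 \<le> a"
  shows "set_integrable lborel {a..b} f"
proof -
  have "integrable lborel (\<lambda>s. indicator {a..b} s *\<^sub>R f (max 0 s))"
    by (rule integrableI_bounded_set_indicator[where B=B])
      (use m b a in \<open>auto simp: emeasure_lborel_Icc_eq max_absorb2\<close>)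
  also have "(\<lambda>s. indicator {a..b} s *\<^sub>R f (max 0 s)) = (\<lambda>s. indicator {a..b} s *\<^sub>R f s)"
    using a by (auto simp: indicator_def max_def fun_eq_iff)
  finally show ?thesis unfolding set_integrable_def .
qed

lemma set_integral_norm_le:
  fixes f :: "real \<Rightarrow> 'b::{banach, second_countable_topology}"
  assumes b: "\<And>s. a \<le> s \<Longrightarrow> s \<le> b \<Longrightarrow> norm (f s) \<le> B" and ab: "a \<le> b" and B: "B \<ge> 0"
  shows "norm (LINT s:{a..b}|lborel. f s) \<le> B * (b - a)"
proof (cases "set_integrable lborel {a..b} f")
  case True
  have "norm (LINT s:{a..b}|lborel. f s) \<le> (LINT s:{a..b}|lborel. norm (f s))"
    by (rule set_integral_norm_bound[OF True])
  also have "\<dots> \<le> (LINT s:{a..b}|lborel. B)"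
    by (rule set_integral_mono) (use True b in \<open>auto intro: set_integrable_norm borel_integrable_atLeastAtMost'\<close>)
  also have "\<dots> = B * (b - a)"
    using ab by (simp add: set_lebesgue_integral_def)
  finally show ?thesis .
next
  case False
  \<comment> \<open>The Bochner integral of a function that is not integrable is 0, so the estimate
    survives.\<close>
  then have "(LINT s:{a..b}|lborel. f s) = 0"
    unfolding set_lebesgue_integral_def set_integrable_def by (rule not_integrable_integral_eq)
  then show ?thesis using B ab by simp
qed

lemma set_integral_split:
  fixes f :: "real \<Rightarrow> 'b::{banach, second_countable_topology}"
  assumes f: "set_integrable lborel {a..c} f" and "a \<le> b" "b \<le> c"
  shows "(LINT s:{a..c}|lborel. f s) = (LINT s:{a..b}|lborel. f s) + (LINT s:{b..c}|lborel. f s)"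
proof -
  have *: "set_integrable lborel {a..b} f" "set_integrable lborel {b..c} f"
    by (rule set_integrable_subset[OF f]; use assms in auto)+
  have "(LINT s:{a..b} \<union> {b..c}|lborel. f s) = (LINT s:{a..b}|lborel. f s) + (LINT s:{b..c}|lborel. f s)"
    by (rule set_integral_Un_AE) (use * AE_lborel_singleton[of b] in \<open>auto elim: eventually_mono\<close>)
  moreover have "{a..b} \<union> {b..c} = {a..c}" using assms by auto
  ultimately show ?thesis by simp
qed

lemma set_integral_shift:
  fixes f :: "real \<Rightarrow> 'b::{banach, second_countable_topology}"
  shows "(LINT s:{h..h + t}|lborel. f (s - h)) = (LINT s:{0..t}|lborel. f s)"
proof -
  have "(LINT s:{0..t}|lborel. f s) = (LINT s|lborel. indicator {0..t} (- h + 1 * s) *\<^sub>R f (- h + 1 * s))"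
    unfolding set_lebesgue_integral_def
    using lborel_integral_real_affine[of 1 "\<lambda>s. indicator {0..t} s *\<^sub>R f s" "-h"] by simp
  also have "\<dots> = (LINT s:{h..h + t}|lborel. f (s - h))"
    unfolding set_lebesgue_integral_def by (intro Bochner_Integration.integral_cong) (auto simp: indicator_def)
  finally show ?thesis by simp
qed

lemma set_integral_const: "a \<le> b \<Longrightarrow> (LINT s:{a..b}|lborel. (c :: 'b::{banach, second_countable_topology})) = (b - a) *\<^sub>R c"
  by (simp add: set_lebesgue_integral_def)

lemma set_integral_cong_Icc:
  fixes f :: "real \<Rightarrow> 'b::{banach, second_countable_topology}"
  assumes "\<And>s. a \<le> s \<Longrightarrow> s \<le> b \<Longrightarrow> f s = g s"
  shows "(LINT s:{a..b}|lborel. f s) = (LINT s:{a..b}|lborel. g s)"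
  unfolding set_lebesgue_integral_def
  by (intro Bochner_Integration.integral_cong) (use assms in \<open>auto simp: indicator_def\<close>)

definition displacement :: "(real \<Rightarrow> 'b::euclidean_space) \<Rightarrow> real \<Rightarrow> 'b" where
  "displacement \<xi> t = (LINT s:{0..t}|lborel. \<xi> s)"

lemma torus_primitive_eq: "torus_primitive \<xi> t = torus_proj (displacement \<xi> t)"
  by (simp add: torus_primitive_def displacement_def)

text \<open>A single path is a process over a one-point probability-free space, to which the joint
  measurability applies.\<close>

lemma vector_path_measurable:
  fixes \<xi> :: "real \<Rightarrow> 'b::metric_space"
  assumes "\<xi> \<in> vector_paths"
  shows "(\<lambda>s. \<xi> (max 0 s)) \<in> borel_measurable borel"
proof -
  have "(\<lambda>_. \<xi>) \<in> count_space {()} \<rightarrow>\<^sub>M eval_algebra euclidean {0..}"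
    using assms by simp
  from measurable_vector_path[OF this]
  have "(\<lambda>ws. \<xi> (max 0 (snd ws))) \<in> borel_measurable (count_space {()} \<Otimes>\<^sub>M borel)"
    by (simp add: case_prod_beta)
  from measurable_compose[OF measurable_Pair1'[of "()"] this] show ?thesis by simp
qed

lemma vector_path_set_integrable:
  fixes \<xi> :: "real \<Rightarrow> 'b::euclidean_space"
  assumes "\<xi> \<in> vector_paths" "0 \<le> a"
  shows "set_integrable lborel {a..b} \<xi>"
proof -
  obtain R where "\<And>s. 0 \<le> s \<Longrightarrow> s \<le> b \<Longrightarrow> norm (\<xi> s) \<le> R"
    using vector_path_bounded[OF assms(1), of b] by metis
  then show ?thesis
    by (intro set_integrable_bounded[where B=R] vector_path_measurable assms) (use assms in auto)
qed

lemma displacement_split: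
  assumes "\<xi> \<in> vector_paths" "0 \<le> s" "s \<le> t"
  shows "displacement \<xi> t = displacement \<xi> s + (LINT r:{s..t}|lborel. \<xi> r)"
  unfolding displacement_def by (intro set_integral_split vector_path_set_integrable assms) simp

lemma displacement_lipschitz:
  assumes "\<xi> \<in> vector_paths" "0 \<le> s" "s \<le> t" "\<And>r. s \<le> r \<Longrightarrow> r \<le> t \<Longrightarrow> norm (\<xi> r) \<le> R" "R \<ge> 0"
  shows "norm (displacement \<xi> t - displacement \<xi> s) \<le> R * (t - s)"
  using displacement_split[OF assms(1-3)] set_integral_norm_le[of s t \<xi> R] assms by simp

lemma displacement_tendsto:
  fixes \<xi> :: "real \<Rightarrow> 'b::euclidean_space"
  assumes x: "\<xi> \<in> vector_paths" and s: "0 \<le> s"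
  shows "(displacement \<xi> \<longlongrightarrow> displacement \<xi> s) (at_right s)"
proof -
  obtain R where R: "R > 0" "\<And>r. 0 \<le> r \<Longrightarrow> r \<le> s + 1 \<Longrightarrow> norm (\<xi> r) \<le> R"
    using vector_path_bounded[OF x, of "s + 1"] by metis
  have "((\<lambda>t. displacement \<xi> t - displacement \<xi> s) \<longlongrightarrow> 0) (at_right s)"
  proof (rule Lim_null_comparison)
    show "\<forall>\<^sub>F t in at_right s. norm (displacement \<xi> t - displacement \<xi> s) \<le> R * (t - s)"
      by (rule eventually_at_rightI[of s "s + 1"]) (use s R in \<open>auto intro!: displacement_lipschitz[OF x]\<close>)
    have "((\<lambda>t. R * (t - s)) \<longlongrightarrow> R * (s - s)) (at_right s)" by (intro tendsto_intros)
    then show "((\<lambda>t. R * (t - s)) \<longlongrightarrow> 0) (at_right s)" by simp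
  qed
  then show ?thesis using Lim_null by blast
qed

lemma measurable_displacement_at:
  fixes \<Xi> :: "'w \<Rightarrow> real \<Rightarrow> 'b::euclidean_space"
  assumes "\<Xi> \<in> M \<rightarrow>\<^sub>M eval_algebra euclidean {0..}"
  shows "(\<lambda>w. displacement (\<Xi> w) t) \<in> borel_measurable M"
proof -
  note [measurable] = measurable_vector_path[OF assms]
  have "(\<lambda>w. LINT s|lborel. indicator {0..t} s *\<^sub>R \<Xi> w (max 0 s)) \<in> borel_measurable M"
    by measurable
  moreover have "displacement (\<Xi> w) t = (LINT s|lborel. indicator {0..t} s *\<^sub>R \<Xi> w (max 0 s))" for w
    unfolding displacement_def set_lebesgue_integral_def
    by (intro Bochner_Integration.integral_cong) (auto simp: indicator_def max_def)
  ultimately show ?thesis by simp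
qed

lemma measurable_displacement:
  fixes \<Xi> :: "'w \<Rightarrow> real \<Rightarrow> 'b::euclidean_space"
  assumes "\<Xi> \<in> M \<rightarrow>\<^sub>M eval_algebra euclidean {0..}"
  shows "(\<lambda>(w, s). displacement (\<Xi> w) (max 0 s)) \<in> borel_measurable (M \<Otimes>\<^sub>M borel)"
proof (rule measurable_right_continuous)
  show "(\<lambda>w. displacement (\<Xi> w) s) \<in> borel_measurable M" for s
    by (rule measurable_displacement_at[OF assms])
  show "(displacement (\<Xi> w) \<longlongrightarrow> displacement (\<Xi> w) s) (at_right s)" if "w \<in> space M" "0 \<le> s" for w s
    using measurable_space[OF assms that(1)] that(2) by (intro displacement_tendsto) auto
qed

subsection \<open>The law of the switching process\<close>

text \<open>The law of the chain is prescribed along increasing tuples of times indexed from 1,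
  whereas cylinders are indexed by finite sets of times, which are easier to unite. This lemma
  translates between the two.\<close>

lemma finite_increasing_enumeration:
  fixes F :: "real set"
  assumes "finite F" "F \<noteq> {}"
  obtains k and t :: "nat \<Rightarrow> real" where "1 \<le> k" "strict_mono_on {1..k} t" "t ` {1..k} = F"
proof (rule that)
  let ?xs = "sorted_list_of_set F"
  show "1 \<le> card F" using assms by (simp add: Suc_le_eq card_gt_0_iff)
  show "strict_mono_on {1..card F} (\<lambda>l. ?xs ! (l - 1))"
    by (rule strict_mono_onI) (use assms in \<open>auto intro!: sorted_wrt_nth_less[OF sorted_list_of_set.strict_sorted_key_list_of_set]\<close>)
  have "(\<lambda>l. ?xs ! (l - 1)) ` {1..card F} = (\<lambda>l. ?xs ! l) ` {0..<card F}"
  proof -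
    have "{1..card F} = Suc ` {0..<card F}"
      by (simp add: image_Suc_atLeastLessThan atLeastLessThanSuc_atLeastAtMost)
    then show ?thesis by (simp only: image_image diff_Suc_1)
  qed
  also have "\<dots> = F"
    using assms nth_image[of "card F" ?xs] by (simp add: lessThan_atLeast0)
  finally show "(\<lambda>l. ?xs ! (l - 1)) ` {1..card F} = F" .
qed

definition cylinder :: "real set \<Rightarrow> (real \<Rightarrow> 'm) \<Rightarrow> (real \<Rightarrow> 'm) set" where
  "cylinder F g = {\<omega> \<in> index_paths. \<forall>s\<in>F. \<omega> s = g s}"

lemma cylinder_sets:
  fixes g :: "real \<Rightarrow> 'm::finite"
  assumes "finite F" "F \<subseteq> I"
  shows "cylinder F g \<in> sets (eval_algebra (discrete_topology UNIV) I)"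
proof -
  have "cylinder F g = {\<omega> \<in> space (eval_algebra (discrete_topology UNIV) I). \<forall>s\<in>F. \<omega> s \<in> {g s}}"
    by (auto simp: cylinder_def)
  also have "\<dots> \<in> sets (eval_algebra (discrete_topology UNIV) I)"
  proof (intro sets.sets_Collect_finite_All)
    show "{\<omega> \<in> space (eval_algebra (discrete_topology UNIV) I). \<omega> s \<in> {g s}} \<in> sets (eval_algebra (discrete_topology UNIV) I)"
      if "s \<in> F" for s
      using eval_algebra_sets[of s I "discrete_topology UNIV" "{g s}"] that assms by auto
  qed (rule assms)
  finally show ?thesis .
qed

text \<open>The base time \<open>s0\<close> belongs to every cylinder, so that conditioning on the state at time \<open>s0\<close>
  only affects cylinders that prescribe this state.\<close>

lemma eval_algebra_generated_by_cylinders: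
  fixes \<Omega> :: "(real \<Rightarrow> 'm::finite) set"
  assumes s0: "s0 \<in> I"
  defines "\<Omega> \<equiv> index_paths"
  shows "sets (eval_algebra (discrete_topology UNIV) I) =
    sigma_sets \<Omega> ({{}, \<Omega>} \<union> {cylinder F g | F g. finite F \<and> s0 \<in> F \<and> F \<subseteq> I})"
    (is "_ = sigma_sets \<Omega> ?E")
proof -
  let ?G = "{{\<omega> \<in> \<Omega>. \<omega> s \<in> U} |s U. s \<in> I \<and> openin (discrete_topology UNIV) U}"
  have G: "sets (eval_algebra (discrete_topology UNIV) I) = sigma_sets \<Omega> ?G"
    unfolding eval_algebra_def \<Omega>_def by (rule sets_measure_of) auto
  have "sigma_sets \<Omega> ?G = sigma_sets \<Omega> ?E"
  proof (rule sigma_sets_eqI)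
    fix A assume "A \<in> ?G"
    then obtain s U where A: "A = {\<omega> \<in> \<Omega>. \<omega> s \<in> U}" "s \<in> I" by blast
    \<comment> \<open>The state at \<open>s0\<close> is enumerated along with the one at
      \<open>s\<close>. If the two times coincide, the second component decides.\<close>
    define g where "g ij r = (if r = s then snd ij else fst ij)" for ij :: "'m \<times> 'm" and r
    have "A = (\<Union>ij\<in>UNIV \<times> U. cylinder {s0, s} (g ij))"
      unfolding A cylinder_def \<Omega>_def g_def by (auto split: if_splits)
    moreover have "cylinder {s0, s} (g ij) \<in> ?E" for ij using s0 A(2) by blast
    ultimately show "A \<in> sigma_sets \<Omega> ?E"
      by (auto intro!: sigma_sets_UNION countable_finite)
  next
    fix B assume "B \<in> ?E"
    then have "B \<in> sets (eval_algebra (discrete_topology UNIV) I)"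
      using cylinder_sets[of _ I] sets.top[of "eval_algebra (discrete_topology UNIV) I"] by (auto simp: \<Omega>_def)
    then show "B \<in> sigma_sets \<Omega> ?G" by (simp add: G)
  qed
  with G show ?thesis by simp
qed

text \<open>Two cylinders either prescribe different states at a common time, and are disjoint, or
  merge into one cylinder, so they form a generator stable under intersection. Total masses are
  compared separately: every cylinder here contains the base time, hence none of them is the whole
  space by its form. Finite masses are allowed because the measures compared below are laws
  restricted to an event.\<close>

lemma eval_measure_eqI:
  fixes M N :: "(real \<Rightarrow> 'm::finite) measure"
  assumes s0: "s0 \<in> I"
    and M: "sets M = sets (eval_algebra (discrete_topology UNIV) I)"
    and N: "sets N = sets (eval_algebra (discrete_topology UNIV) I)"
    and fin: "emeasure M index_paths \<noteq> \<infinity>"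
    and top: "emeasure M index_paths = emeasure N index_paths"
    and cyl: "\<And>F g. finite F \<Longrightarrow> s0 \<in> F \<Longrightarrow> F \<subseteq> I \<Longrightarrow> emeasure M (cylinder F g) = emeasure N (cylinder F g)"
  shows "M = N"
proof (rule measure_eqI_generator_eq)
  let ?E = "{{}, index_paths :: (real \<Rightarrow> 'm) set} \<union> {cylinder F g | F g. finite F \<and> s0 \<in> F \<and> F \<subseteq> I}"
  show "Int_stable ?E"
  proof (rule Int_stableI)
    fix A B assume AB: "A \<in> ?E" "B \<in> ?E"
    define isC where "isC Y \<longleftrightarrow> (\<exists>F g. Y = cylinder F g \<and> finite F \<and> s0 \<in> F \<and> F \<subseteq> I)" for Y :: "(real \<Rightarrow> 'm) set"
    have "A = {} \<or> A = index_paths \<or> isC A" "B = {} \<or> B = index_paths \<or> isC B"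
      using AB unfolding isC_def by simp_all
    then consider "A = {} \<or> B = {}" | "A = index_paths" | "B = index_paths" | "isC A" "isC B" by argo
    then show "A \<inter> B \<in> ?E"
    proof cases
      case 2
      then have "A \<inter> B = B" using AB by (auto simp: cylinder_def)
      then show ?thesis using AB by simp
    next
      case 3
      then have "A \<inter> B = A" using AB by (auto simp: cylinder_def)
      then show ?thesis using AB by simp
    next
      case 4
      then obtain F g F' g' where 4: "A = cylinder F g" "B = cylinder F' g'" "finite F" "finite F'" "s0 \<in> F" "F \<subseteq> I" "F' \<subseteq> I"
        unfolding isC_def by force
      show ?thesis
      proof (cases "A \<inter> B = {}")
        case False
        then have eq: "g s = g' s" if "s \<in> F" "s \<in> F'" for s using that 4 by (auto simp: cylinder_def)
        have "A \<inter> B = cylinder (F \<union> F') (\<lambda>s. if s \<in> F then g s else g' s)"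
          using 4 eq by (auto simp: cylinder_def)
        moreover have "finite (F \<union> F')" "s0 \<in> F \<union> F'" "F \<union> F' \<subseteq> I" using 4 by auto
        ultimately show ?thesis by blast
      qed simp
    qed auto
  qed
  show "?E \<subseteq> Pow index_paths" by (auto simp: cylinder_def)
  show "emeasure M X = emeasure N X" if "X \<in> ?E" for X using that top cyl by auto
  show "sets M = sigma_sets index_paths ?E" "sets N = sigma_sets index_paths ?E"
    unfolding M N by (rule eval_algebra_generated_by_cylinders[OF s0])+
  show "range (\<lambda>_::nat. index_paths) \<subseteq> ?E" by auto
qed (use fin in auto)

lemma axis_in_simplex [simp]: "axis i 1 \<in> (prob_simplex :: (real^'m::finite) set)"
  by (auto simp: prob_simplex_def axis_def)

lemma axis_vector_matrix_mult: "(axis i 1 v* (A :: real^'m::finite^'m)) $ j = A $ i $ j"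
  by (simp add: vector_matrix_mult_def axis_def if_distrib[of "\<lambda>x. x * _"] cong: if_cong)

section \<open>The matrix exponential at small times\<close>

lemma scaleR_matrix_power:
  fixes A :: "real^'m::finite^'m"
  shows "((**) (t *\<^sub>R A) ^^ k) (mat 1) = t ^ k *\<^sub>R ((**) A ^^ k) (mat 1)"
proof (induction k)
  case (Suc k)
  have "(t *\<^sub>R A) ** (t ^ k *\<^sub>R X) = t ^ Suc k *\<^sub>R (A ** X)" for X :: "real^'m^'m"
    by (simp add: matrix_matrix_mult_def vec_eq_iff sum_distrib_left mult_ac)
  with Suc show ?case by simp
qed simp

lemma matrix_power_entry_le:
  fixes A :: "real^'m::finite^'m"
  assumes "\<And>i. (\<Sum>l\<in>UNIV. \<bar>A $ i $ l\<bar>) \<le> B" "B \<ge> 0"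
  shows "\<bar>((**) A ^^ k) (mat 1) $ i $ j\<bar> \<le> B ^ k"
proof (induction k arbitrary: i)
  case 0
  then show ?case by (simp add: mat_def)
next
  case (Suc k)
  have "\<bar>((**) A ^^ Suc k) (mat 1) $ i $ j\<bar> = \<bar>\<Sum>l\<in>UNIV. A $ i $ l * ((**) A ^^ k) (mat 1) $ l $ j\<bar>"
    by (simp add: matrix_matrix_mult_def)
  also have "\<dots> \<le> (\<Sum>l\<in>UNIV. \<bar>A $ i $ l\<bar> * B ^ k)"
    by (rule order_trans[OF sum_abs]) (intro sum_mono, simp add: abs_mult mult_left_mono Suc.IH)
  also have "\<dots> \<le> B * B ^ k"
    unfolding sum_distrib_right[symmetric] by (intro mult_right_mono assms zero_le_power)
  finally show ?case by simp
qed

text \<open>Entry by entry the series is dominated by the scalar exponential series of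
  \<open>B\<close>, the sum of all absolute entries of \<open>A\<close>. For
  \<open>t \<le> 1\<close> a factor \<open>t\<^sup>2\<close> can be taken out of all terms from the
  second order on, which leaves at most \<open>exp B\<close>.\<close>

lemma matrix_exp_expansion:
  fixes A :: "real^'m::finite^'m"
  obtains C where "C \<ge> 0"
    "\<And>t i j. 0 \<le> t \<Longrightarrow> t \<le> 1 \<Longrightarrow> \<bar>matrix_exp (t *\<^sub>R A) $ i $ j - mat 1 $ i $ j - t * A $ i $ j\<bar> \<le> C * t\<^sup>2"
proof -
  define B where "B = (\<Sum>i\<in>UNIV. \<Sum>l\<in>UNIV. \<bar>A $ i $ l\<bar>)"
  have B: "B \<ge> 0" unfolding B_def by (intro sum_nonneg) auto
  have rows: "(\<Sum>l\<in>UNIV. \<bar>A $ i $ l\<bar>) \<le> B" for i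
    unfolding B_def by (rule member_le_sum[of i UNIV "\<lambda>i. \<Sum>l\<in>UNIV. \<bar>A $ i $ l\<bar>"]) (auto intro: sum_nonneg)
  define D where "D k = ((**) A ^^ k) (mat 1)" for k
  have D: "\<bar>D k $ i $ j\<bar> \<le> B ^ k" for k i j unfolding D_def by (rule matrix_power_entry_le[OF rows B])
  have "\<bar>matrix_exp (t *\<^sub>R A) $ i $ j - mat 1 $ i $ j - t * A $ i $ j\<bar> \<le> exp B * t\<^sup>2"
    if t: "0 \<le> t" "t \<le> 1" for t i j
  proof -
    define f where "f i j k = 1 / fact k * (t ^ k * D k $ i $ j)" for i j k
    have f: "\<bar>f i j k\<bar> \<le> t ^ k * (B ^ k / fact k)" for i j k
      using mult_left_mono[OF D[of k i j], of "t ^ k"] t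
      by (simp add: f_def abs_mult divide_simps)
    have f': "\<bar>f i j k\<bar> \<le> B ^ k / fact k" for i j k
      by (rule order_trans[OF f mult_left_le_one_le]) (use t B in \<open>auto intro: power_le_one\<close>)
    have sB: "(\<lambda>k. B ^ k / fact k) sums exp B"
      using exp_converges[of B] by (simp add: divide_inverse mult.commute)
    have sf: "summable (\<lambda>k. \<bar>f i j k\<bar>)" for i j
      by (rule summable_comparison_test'[OF sums_summable[OF sB], of 0]) (use f' in auto)
    then have sf': "summable (f i j)" for i j by (rule summable_rabs_cancel)
    \<comment> \<open>Convergence is checked in each entry, which suffices for a limit of matrices
      with finitely many entries.\<close>
    have "(\<lambda>k. (1 / fact k) *\<^sub>R ((**) (t *\<^sub>R A) ^^ k) (mat 1)) sums (\<chi> i j. \<Sum>k. f i j k)"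
      unfolding sums_def
    proof (intro vec_tendstoI)
      fix i j
      have "(\<lambda>n. \<Sum>k<n. f i j k) \<longlonglongrightarrow> (\<Sum>k. f i j k)" using summable_LIMSEQ[OF sf'] .
      then show "(\<lambda>n. (\<Sum>k<n. (1 / fact k) *\<^sub>R ((**) (t *\<^sub>R A) ^^ k) (mat 1)) $ i $ j) \<longlonglongrightarrow> (\<chi> i j. \<Sum>k. f i j k) $ i $ j"
        by (simp add: scaleR_matrix_power D_def[symmetric] f_def)
    qed
    then have "matrix_exp (t *\<^sub>R A) $ i $ j = (\<Sum>k. f i j k)"
      unfolding matrix_exp_def by (simp add: sums_unique[symmetric])
    also have "\<dots> = (\<Sum>k. f i j (k + 2)) + (\<Sum>k<2. f i j k)"
      by (rule suminf_split_initial_segment[OF sf'])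
    also have "(\<Sum>k<2. f i j k) = mat 1 $ i $ j + t * A $ i $ j"
      by (simp add: f_def D_def numeral_2_eq_2)
    finally have "\<bar>matrix_exp (t *\<^sub>R A) $ i $ j - mat 1 $ i $ j - t * A $ i $ j\<bar> = \<bar>\<Sum>k. f i j (k + 2)\<bar>"
      by simp
    also have "\<dots> \<le> (\<Sum>k. \<bar>f i j (k + 2)\<bar>)"
      by (rule summable_rabs) (rule summable_ignore_initial_segment[OF sf])
    also have "\<dots> \<le> (\<Sum>k. t\<^sup>2 * (B ^ (k + 2) / fact (k + 2)))"
    proof (rule suminf_le)
      show "\<bar>f i j (k + 2)\<bar> \<le> t\<^sup>2 * (B ^ (k + 2) / fact (k + 2))" for k
      proof (rule order_trans[OF f mult_right_mono])
        show "t ^ (k + 2) \<le> t\<^sup>2" by (rule power_decreasing) (use t in auto)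
      qed (use B in simp)
      show "summable (\<lambda>k. \<bar>f i j (k + 2)\<bar>)"
        by (rule summable_ignore_initial_segment[OF sf])
      show "summable (\<lambda>k. t\<^sup>2 * (B ^ (k + 2) / fact (k + 2)))"
        by (intro summable_mult summable_ignore_initial_segment[OF sums_summable[OF sB]])
    qed
    also have "\<dots> = t\<^sup>2 * (\<Sum>k. B ^ (k + 2) / fact (k + 2))"
      by (intro suminf_mult summable_ignore_initial_segment[OF sums_summable[OF sB]])
    also have "\<dots> \<le> t\<^sup>2 * exp B"
      using suminf_split_initial_segment[OF sums_summable[OF sB], of 2] B sums_unique[OF sB]
      by (intro mult_left_mono) (simp_all add: numeral_2_eq_2)
    finally show ?thesis by (simp add: mult.commute)
  qed
  then show ?thesis by (intro that[of "exp B"]) auto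
qed

section \<open>Transition probabilities and the Markov property\<close>

locale switching =
  fixes \<Lambda> :: "real^'m::finite^'m" and P :: "real^'m \<Rightarrow> (real \<Rightarrow> 'm) measure"
  assumes P: "\<And>a. a \<in> prob_simplex \<Longrightarrow> is_chain_law \<Lambda> a (P a)"
begin

text \<open>The transition semigroup, whose generator is \<open>- \<Lambda>\<close>.\<close>

definition Q :: "real \<Rightarrow> real^'m^'m" where "Q t = matrix_exp (- t *\<^sub>R \<Lambda>)"

abbreviation "PI j \<equiv> P (axis j 1)"

lemma Q_expansion:
  obtains C where "C \<ge> 0"
    "\<And>t i j. 0 \<le> t \<Longrightarrow> t \<le> 1 \<Longrightarrow> \<bar>Q t $ i $ j - mat 1 $ i $ j + t * \<Lambda> $ i $ j\<bar> \<le> C * t\<^sup>2"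
proof -
  obtain C where C: "C \<ge> 0" "\<And>t i j. 0 \<le> t \<Longrightarrow> t \<le> 1 \<Longrightarrow>
      \<bar>matrix_exp (t *\<^sub>R (- \<Lambda>)) $ i $ j - mat 1 $ i $ j - t * (- \<Lambda>) $ i $ j\<bar> \<le> C * t\<^sup>2"
    by (rule matrix_exp_expansion[of "- \<Lambda>"]) blast
  show thesis by (rule that[OF C(1)]) (use C(2) in \<open>simp add: Q_def\<close>)
qed

lemma Q_0: "Q 0 = mat 1"
proof -
  obtain C where "\<And>t i j. 0 \<le> t \<Longrightarrow> t \<le> 1 \<Longrightarrow> \<bar>Q t $ i $ j - mat 1 $ i $ j + t * \<Lambda> $ i $ j\<bar> \<le> C * t\<^sup>2"
    by (rule Q_expansion) blast
  from this[of 0] have "Q 0 $ i $ j = mat 1 $ i $ j" for i j by simp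
  then show ?thesis unfolding vec_eq_iff by blast
qed

context fixes a :: "real^'m" assumes a: "a \<in> prob_simplex"
begin

lemma prob_space_P: "prob_space (P a)"
  and space_P [simp]: "space (P a) = index_paths"
  and sets_P [simp, measurable_cong]: "sets (P a) = sets path_algebra"
  using P[OF a] by (auto simp: is_chain_law_def)

lemma measure_cylinder:
  fixes t :: "nat \<Rightarrow> real" and k :: nat
  assumes "1 \<le> k" "0 \<le> t 1" "strict_mono_on {1..k} t"
  shows "measure (P a) (cylinder (t ` {1..k}) g) =
    (a v* Q (t 1)) $ g (t 1) * (\<Prod>l = 2..k. Q (t l - t (l - 1)) $ g (t (l - 1)) $ g (t l))"
proof -
  have "cylinder (t ` {1..k}) g = {\<omega> \<in> index_paths. \<forall>l\<in>{1..k}. \<omega> (t l) = g (t l)}"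
    by (auto simp: cylinder_def)
  moreover have "measure (P a) {\<omega> \<in> index_paths. \<forall>l\<in>{1..k}. \<omega> (t l) = j l} =
    (a v* Q (t 1)) $ j 1 * (\<Prod>l = 2..k. Q (t l - t (l - 1)) $ j (l - 1) $ j l)" for j :: "nat \<Rightarrow> 'm"
    using P[OF a] unfolding is_chain_law_def Q_def
    using assms by blast
  ultimately show ?thesis by simp
qed

end

lemma measurable_P: "a \<in> prob_simplex \<Longrightarrow> f \<in> P a \<rightarrow>\<^sub>M N \<longleftrightarrow> f \<in> path_algebra \<rightarrow>\<^sub>M N"
  by (simp add: measurable_cong_sets[OF sets_P refl])

lemma measurable_eval_P [measurable]:
  "a \<in> prob_simplex \<Longrightarrow> 0 \<le> s \<Longrightarrow> (\<lambda>\<omega>. \<omega> s) \<in> P a \<rightarrow>\<^sub>M count_space UNIV"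
  by (simp add: measurable_P measurable_eval_discrete)

lemma measurable_shift_P: "a \<in> prob_simplex \<Longrightarrow> 0 \<le> h \<Longrightarrow> shift_path h \<in> P a \<rightarrow>\<^sub>M path_algebra"
  using measurable_shift_path[of h "{0..}" "{0..}"] by (simp add: measurable_P)

lemma sets_eval_eq [measurable]: "a \<in> prob_simplex \<Longrightarrow> 0 \<le> s \<Longrightarrow> {\<omega> \<in> index_paths. \<omega> s = j} \<in> sets (P a)"
  using eval_algebra_sets[of s "{0..}" "discrete_topology UNIV" "{j}"] by simp

lemma sets_eval_eq2:
  assumes "a \<in> prob_simplex" "0 \<le> s" "0 \<le> t"
  shows "{\<omega> \<in> index_paths. \<omega> s = i \<and> \<omega> t = j} \<in> sets (P a)"
proof -
  have "{\<omega> \<in> index_paths. \<omega> s = i} \<inter> {\<omega> \<in> index_paths. \<omega> t = j} \<in> sets (P a)"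
    using assms by (intro sets.Int sets_eval_eq)
  moreover have "{\<omega> \<in> index_paths. \<omega> s = i} \<inter> {\<omega> \<in> index_paths. \<omega> t = j} = {\<omega> \<in> index_paths. \<omega> s = i \<and> \<omega> t = j}"
    by auto
  ultimately show ?thesis by simp
qed

lemma measure_eval:
  assumes a: "a \<in> prob_simplex" and s: "0 \<le> s"
  shows "measure (P a) {\<omega> \<in> index_paths. \<omega> s = j} = (a v* Q s) $ j"
  using measure_cylinder[OF a, of 1 "\<lambda>_. s" "\<lambda>_. j"] s by (simp add: cylinder_def strict_mono_on_def)

lemma AE_initial_state: "AE \<omega> in PI i. \<omega> 0 = i"
proof -
  interpret prob_space "PI i" by (rule prob_space_P[OF axis_in_simplex])
  have "prob {\<omega> \<in> index_paths. \<omega> 0 = i} = 1"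
    by (simp add: measure_eval axis_vector_matrix_mult Q_0 mat_def)
  from AE_prob_1[OF this] show ?thesis by eventually_elim simp
qed

text \<open>An entry of the transition matrix is a probability under \<open>PI i\<close>, which
  replaces an argument with the exponential series.\<close>

lemma Q_nonneg: "0 \<le> t \<Longrightarrow> Q t $ i $ j \<ge> 0"
  using measure_eval[OF axis_in_simplex, of t i j, symmetric] by (simp add: axis_vector_matrix_mult)

lemma simplex_mult_nonneg:
  assumes a: "a \<in> prob_simplex" and h: "0 \<le> h"
  shows "(a v* Q h) $ j \<ge> 0"
  using measure_eval[OF a h, of j, symmetric] by simp

lemma sum_simplex_mult:
  assumes a: "a \<in> prob_simplex" and h: "0 \<le> h"
  shows "(\<Sum>j\<in>UNIV. (a v* Q h) $ j) = 1"
proof -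
  interpret prob_space "P a" by (rule prob_space_P[OF a])
  have "(\<Sum>j\<in>UNIV. (a v* Q h) $ j) = (\<Sum>j\<in>UNIV. prob {\<omega> \<in> index_paths. \<omega> h = j})"
    using measure_eval[OF a h] by simp
  also have "\<dots> = prob (\<Union>j\<in>UNIV. {\<omega> \<in> index_paths. \<omega> h = j})"
    by (rule finite_measure_finite_Union[symmetric]) (use sets_eval_eq[OF a h] in \<open>auto simp: disjoint_family_on_def\<close>)
  also have "(\<Union>j\<in>UNIV. {\<omega> \<in> index_paths. \<omega> h = j}) = space (P a)" using a by auto
  finally show ?thesis using prob_space by simp
qed

lemma sum_Q: "0 \<le> h \<Longrightarrow> (\<Sum>j\<in>UNIV. Q h $ i $ j) = 1"
  using sum_simplex_mult[OF axis_in_simplex, of h i] by (simp add: axis_vector_matrix_mult)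

text \<open>On a cylinder containing time 0 the finite-dimensional law is a product over time
  differences. Shifting the times by \<open>h\<close> changes only the first factor, into the
  probability of \<open>j\<close> at time \<open>h\<close>, and leaves the product that describes
  the chain started in \<open>j\<close>. Restricting to the state \<open>j\<close> instead of
  conditioning on it keeps the identity valid when this state has probability 0.\<close>

lemma Markov_property:
  assumes a: "a \<in> prob_simplex" and h: "0 \<le> h"
  shows "distr (density (P a) (indicator {\<omega> \<in> index_paths. \<omega> h = j})) path_algebra (shift_path h) =
    density (PI j) (\<lambda>_. ennreal ((a v* Q h) $ j))"
proof (rule eval_measure_eqI[of 0 "{0..}"])
  let ?S = "{\<omega> \<in> index_paths. \<omega> h = j}"
  interpret prob_space "P a" by (rule prob_space_P[OF a])
  interpret J: prob_space "PI j" by (rule prob_space_P[OF axis_in_simplex])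
  note c0 = simplex_mult_nonneg[OF a h, of j]
  have shift: "shift_path h \<in> density (P a) (indicator ?S) \<rightarrow>\<^sub>M path_algebra"
    using measurable_shift_P[OF a h] by simp
  have lhs: "emeasure (distr (density (P a) (indicator ?S)) path_algebra (shift_path h)) X =
      ennreal (prob {\<omega> \<in> ?S. shift_path h \<omega> \<in> X})" if X: "X \<in> sets path_algebra" for X
  proof -
    have "shift_path h -` X \<inter> space (P a) \<in> sets (P a)"
      using measurable_sets[OF shift X] by simp
    then have "emeasure (distr (density (P a) (indicator ?S)) path_algebra (shift_path h)) X =
      emeasure (P a) (?S \<inter> (shift_path h -` X \<inter> space (P a)))"
      using X sets_eval_eq[OF a h, of j] by (simp add: emeasure_distr[OF shift] emeasure_restricted)
    also have "?S \<inter> (shift_path h -` X \<inter> space (P a)) = {\<omega> \<in> ?S. shift_path h \<omega> \<in> X}" using a by auto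
    finally show ?thesis by (simp add: emeasure_eq_measure)
  qed
  have rhs: "emeasure (density (PI j) (\<lambda>_. ennreal ((a v* Q h) $ j))) X = ennreal ((a v* Q h) $ j * J.prob X)"
    if X: "X \<in> sets path_algebra" for X
    using X c0 by (simp add: emeasure_density_const axis_in_simplex J.emeasure_eq_measure ennreal_mult)
  have top: "index_paths \<in> sets path_algebra" using sets.top[of path_algebra] by simp
  have top': "{\<omega> \<in> index_paths. \<omega> h = j \<and> shift_path h \<omega> \<in> index_paths} = ?S" using shift_path_in[OF _ h] by auto
  show "emeasure (distr (density (P a) (indicator ?S)) path_algebra (shift_path h)) index_paths =
      emeasure (density (PI j) (\<lambda>_. ennreal ((a v* Q h) $ j))) index_paths"
    using J.prob_space axis_in_simplex[of j]
    by (simp add: lhs[OF top] rhs[OF top] top' measure_eval[OF a h])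
  show "emeasure (distr (density (P a) (indicator ?S)) path_algebra (shift_path h)) index_paths \<noteq> \<infinity>"
    by (simp add: lhs[OF top])
  fix F :: "real set" and g :: "real \<Rightarrow> 'm"
  assume F: "finite F" "0 \<in> F" "F \<subseteq> {0..}"
  obtain k and t :: "nat \<Rightarrow> real" where k: "1 \<le> k" and t: "strict_mono_on {1..k} t" and tF: "t ` {1..k} = F"
    using finite_increasing_enumeration[of F] F by blast
  have t1: "t 1 = 0"
  proof -
    obtain l where l: "l \<in> {1..k}" "t l = 0" using F(2) tF by (metis imageE)
    have "t 1 \<le> t l" using l(1) k strict_mono_on_leD[OF t, of 1 l] by auto
    moreover have "t 1 \<in> F" using tF k by auto
    ultimately show ?thesis using l F by force
  qed
  have X: "cylinder F g \<in> sets path_algebra" by (rule cylinder_sets) (use F in auto)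
  have "prob {\<omega> \<in> ?S. shift_path h \<omega> \<in> cylinder F g} = (a v* Q h) $ j * J.prob (cylinder F g)"
  proof (cases "g 0 = j")
    case True
    \<comment> \<open>The event is itself a cylinder at the shifted times; the state
      \<open>j\<close> at time \<open>h\<close> is enforced by the prescription at time 0.\<close>
    define g' where "g' s = g (s - h)" for s
    define t' where "t' l = h + t l" for l
    have "{\<omega> \<in> ?S. shift_path h \<omega> \<in> cylinder F g} = cylinder (t' ` {1..k}) g'"
    proof (intro set_eqI iffI)
      fix \<omega> assume w: "\<omega> \<in> {\<omega> \<in> ?S. shift_path h \<omega> \<in> cylinder F g}"
      have "\<omega> (h + s) = g s" if "s \<in> F" for s
        using w that F by (auto simp: cylinder_def shift_path_def split: if_splits dest!: bspec)
      then show "\<omega> \<in> cylinder (t' ` {1..k}) g'"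
        using w by (auto simp: cylinder_def g'_def t'_def tF[symmetric])
    next
      fix \<omega> assume w: "\<omega> \<in> cylinder (t' ` {1..k}) g'"
      have *: "\<omega> (h + s) = g s" if "s \<in> F" for s
        using w that by (auto simp: cylinder_def g'_def t'_def tF[symmetric])
      have "\<omega> h = j" using *[of 0] F True by simp
      moreover have "\<omega> \<in> index_paths" using w by (simp add: cylinder_def)
      ultimately show "\<omega> \<in> {\<omega> \<in> ?S. shift_path h \<omega> \<in> cylinder F g}"
        using * F shift_path_in[OF _ h] by (auto simp: cylinder_def shift_path_def)
    qed
    then have "prob {\<omega> \<in> ?S. shift_path h \<omega> \<in> cylinder F g} = (a v* Q (t' 1)) $ g' (t' 1) *
      (\<Prod>l = 2..k. Q (t' l - t' (l - 1)) $ g' (t' (l - 1)) $ g' (t' l))"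
      using measure_cylinder[OF a k, of t' g'] t h t1 by (simp add: t'_def strict_mono_on_def)
    also have "\<dots> = (a v* Q h) $ j * (\<Prod>l = 2..k. Q (t l - t (l - 1)) $ g (t (l - 1)) $ g (t l))"
      using t1 True by (simp add: t'_def g'_def)
    also have "(\<Prod>l = 2..k. Q (t l - t (l - 1)) $ g (t (l - 1)) $ g (t l)) = J.prob (cylinder F g)"
      using measure_cylinder[OF axis_in_simplex k _ t, of j g] t1 True
      unfolding tF by (simp add: axis_vector_matrix_mult Q_0 mat_def)
    finally show ?thesis .
  next
    case False
    have "{\<omega> \<in> ?S. shift_path h \<omega> \<in> cylinder F g} = {}"
      using False F by (auto simp: cylinder_def shift_path_def intro!: bexI[of _ 0])
    moreover have "J.prob (cylinder F g) = 0"
      using measure_cylinder[OF axis_in_simplex k _ t, of j g] t1 False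
      unfolding tF by (simp add: axis_vector_matrix_mult Q_0 mat_def)
    ultimately show ?thesis by (simp only: measure_empty mult_zero_right)
  qed
  then show "emeasure (distr (density (P a) (indicator ?S)) path_algebra (shift_path h)) (cylinder F g) =
      emeasure (density (PI j) (\<lambda>_. ennreal ((a v* Q h) $ j))) (cylinder F g)"
    by (simp add: lhs[OF X] rhs[OF X])
qed (use a axis_in_simplex in auto)

lemma integral_shift:
  fixes g :: "(real \<Rightarrow> 'm) \<Rightarrow> real"
  assumes a: "a \<in> prob_simplex" and h: "0 \<le> h" and g: "g \<in> borel_measurable path_algebra"
  shows "(LINT \<omega>|P a. indicator {\<omega> \<in> index_paths. \<omega> h = j} \<omega> * g (shift_path h \<omega>)) =
    (a v* Q h) $ j * (LINT \<omega>|PI j. g \<omega>)"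
proof -
  let ?S = "{\<omega> \<in> index_paths. \<omega> h = j}"
  have ind: "(\<lambda>\<omega>. indicator ?S \<omega> :: ennreal) = (\<lambda>\<omega>. ennreal (indicator ?S \<omega>))" by (auto simp: indicator_def)
  note shift = measurable_shift_P[OF a h]
  have gs: "(\<lambda>\<omega>. g (shift_path h \<omega>)) \<in> borel_measurable (P a)" by (rule measurable_compose[OF shift g])
  have "(LINT \<omega>|P a. indicator ?S \<omega> * g (shift_path h \<omega>)) = (LINT \<omega>|density (P a) (indicator ?S). g (shift_path h \<omega>))"
    unfolding ind by (subst integral_density) (use gs sets_eval_eq[OF a h, of j] in auto)
  also have "\<dots> = integral\<^sup>L (distr (density (P a) (indicator ?S)) path_algebra (shift_path h)) g"
    by (rule integral_distr[symmetric]) (use shift g in auto)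
  also have "\<dots> = (LINT \<omega>|PI j. (a v* Q h) $ j * g \<omega>)"
    unfolding Markov_property[OF a h]
    by (subst integral_density) (use g simplex_mult_nonneg[OF a h, of j] axis_in_simplex[of j] in \<open>auto simp: measurable_P\<close>)
  finally show ?thesis by simp
qed

text \<open>The property may depend on the state at time \<open>h\<close>, since a different
  strategy is started in each state.\<close>

lemma AE_shift:
  assumes a: "a \<in> prob_simplex" and h: "0 \<le> h" and ae: "\<And>j. AE \<omega> in PI j. R j \<omega>"
  shows "AE \<omega> in P a. R (\<omega> h) (shift_path h \<omega>)"
proof -
  \<comment> \<open>The property need not define a measurable set, so the argument runs on
    measurable null sets that contain the exceptional ones.\<close>
  have "\<forall>j. \<exists>N\<in>null_sets (PI j). {\<omega> \<in> index_paths. \<not> R j \<omega>} \<subseteq> N"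
    using ae by (simp add: eventually_ae_filter space_P[OF axis_in_simplex])
  then obtain N where N: "\<And>j. N j \<in> null_sets (PI j)" "\<And>j. {\<omega> \<in> index_paths. \<not> R j \<omega>} \<subseteq> N j"
    using bchoice[of UNIV] by meson
  have Ns: "N j \<in> sets path_algebra" for j using N(1)[of j] axis_in_simplex[of j] by auto
  interpret prob_space "P a" by (rule prob_space_P[OF a])
  note shift = measurable_shift_P[OF a h]
  define B where "B j = {\<omega> \<in> index_paths. \<omega> h = j} \<inter> (shift_path h -` N j \<inter> space (P a))" for j
  have B: "B j \<in> sets (P a)" for j
    unfolding B_def by (intro sets.Int sets_eval_eq[OF a h] measurable_sets[OF shift] Ns)
  have "B j \<in> null_sets (P a)" for j
  proof -
    have "prob (B j) = (LINT \<omega>|P a. indicator (B j) \<omega>)" using B by simp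
    also have "\<dots> = (LINT \<omega>|P a. indicator {\<omega> \<in> index_paths. \<omega> h = j} \<omega> * indicator (N j) (shift_path h \<omega>))"
      by (intro Bochner_Integration.integral_cong) (use a in \<open>auto simp: B_def indicator_def\<close>)
    also have "\<dots> = (a v* Q h) $ j * (LINT \<omega>|PI j. indicator (N j) \<omega>)"
      by (rule integral_shift[OF a h]) (use Ns in auto)
    also have "\<dots> = 0"
      using N(1)[of j] sets.sets_into_space[OF Ns, of j] by (auto simp: null_sets_def measure_def Int_absorb2)
    finally show ?thesis using B by (auto simp: null_sets_def emeasure_eq_measure)
  qed
  then have "(\<Union>j\<in>UNIV. B j) \<in> null_sets (P a)" by (intro null_sets_UN') auto
  moreover have "{\<omega> \<in> space (P a). \<not> R (\<omega> h) (shift_path h \<omega>)} \<subseteq> (\<Union>j\<in>UNIV. B j)"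
    using subsetD[OF N(2)] a shift_path_in[OF _ h] by (fastforce simp: B_def)
  ultimately show ?thesis by (rule AE_I'[of _ _ "\<lambda>\<omega>. R (\<omega> h) (shift_path h \<omega>)"])
qed

definition uniform_vec :: "real^'m" where "uniform_vec = (\<chi> i. 1 / real CARD('m))"

lemma uniform_vec: "uniform_vec \<in> prob_simplex" "0 < uniform_vec $ i"
  by (auto simp: uniform_vec_def prob_simplex_def)

text \<open>One initial law with positive weights dominates every chain started in a fixed state,
  and conversely such a law is a mixture of these chains. Both directions are the Markov property at
  time 0. From here on, almost sure statements are used under each \<open>PI j\<close>.\<close>

lemma almost_surely_iff: "almost_surely P R \<longleftrightarrow> (\<forall>j. AE \<omega> in PI j. R \<omega>)"
proof
  assume "almost_surely P R"
  then obtain a where a: "a \<in> prob_simplex" "\<And>i. 0 < a $ i" and ae: "AE \<omega> in P a. R \<omega>"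
    unfolding almost_surely_def by blast
  obtain N where N: "N \<in> null_sets (P a)" "{\<omega> \<in> index_paths. \<not> R \<omega>} \<subseteq> N"
    using ae a(1) by (auto simp: eventually_ae_filter)
  have Ns: "N \<in> sets path_algebra" using N(1) a(1) by auto
  show "\<forall>j. AE \<omega> in PI j. R \<omega>"
  proof
    fix j
    interpret prob_space "P a" by (rule prob_space_P[OF a(1)])
    interpret J: prob_space "PI j" by (rule prob_space_P[OF axis_in_simplex])
    \<comment> \<open>At time 0 the restriction to the initial state \<open>j\<close> has mass
      \<open>a $ j\<close>, so a null set of \<open>P a\<close> has mass 0 under \<open>PI j\<close>
      after division by this weight.\<close>
    have "a $ j * J.prob N = (a v* Q 0) $ j * (LINT \<omega>|PI j. indicator N \<omega>)"
      using Ns axis_in_simplex[of j] sets.sets_into_space[OF Ns] by (simp add: Q_0 vector_matrix_mul_rid Int_absorb2)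
    also have "\<dots> = (LINT \<omega>|P a. indicator {\<omega> \<in> index_paths. \<omega> 0 = j} \<omega> * indicator N (shift_path 0 \<omega>))"
      by (rule integral_shift[symmetric, OF a(1)]) (use Ns in auto)
    also have "\<dots> \<le> (LINT \<omega>|P a. indicator N \<omega>)"
    proof (rule integral_mono')
      show "integrable (P a) (\<lambda>\<omega>. indicator N \<omega> :: real)"
        using Ns a(1) by (intro integrable_real_indicator) (auto simp: emeasure_eq_measure)
      show "indicator {\<omega> \<in> index_paths. \<omega> 0 = j} \<omega> * indicator N (shift_path 0 \<omega>) \<le> (indicator N \<omega> :: real)"
        if "\<omega> \<in> space (P a)" for \<omega> using that a(1) by (auto simp: indicator_def shift_path_0)
    qed simp
    also have "\<dots> = 0" using N(1) by (auto simp: null_sets_def measure_def)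
    finally have "J.prob N \<le> 0" using a(2)[of j] by (simp add: mult_le_0_iff)
    then have "N \<in> null_sets (PI j)"
      using Ns axis_in_simplex[of j] by (auto simp: null_sets_def J.emeasure_eq_measure measure_le_0_iff)
    then show "AE \<omega> in PI j. R \<omega>"
      by (rule AE_I') (use N(2) axis_in_simplex in auto)
  qed
next
  assume "\<forall>j. AE \<omega> in PI j. R \<omega>"
  then have "AE \<omega> in P uniform_vec. R (shift_path 0 \<omega>)"
    using AE_shift[OF uniform_vec(1), of 0 "\<lambda>_. R"] by simp
  then have "AE \<omega> in P uniform_vec. R \<omega>"
    by (rule AE_mp) (use uniform_vec(1) in \<open>auto intro!: AE_I2 simp: shift_path_0\<close>)
  then show "almost_surely P R" unfolding almost_surely_def using uniform_vec by blast
qed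

text \<open>The counterpart of the Markov property seen from the past: appending the time
  \<open>s + h\<close> to a cylinder up to time \<open>s\<close> multiplies its probability by one
  entry of the transition matrix. The base time is \<open>s\<close>, so every cylinder fixes the
  state from which this entry is read.\<close>

lemma transition_property:
  assumes a: "a \<in> prob_simplex" and s: "0 \<le> s" and h: "0 < h"
  shows "distr (density (P a) (indicator {\<omega> \<in> index_paths. \<omega> s = i \<and> \<omega> (s + h) = j})) (path_filtration s) (\<lambda>\<omega>. \<omega>) =
    density (distr (density (P a) (indicator {\<omega> \<in> index_paths. \<omega> s = i})) (path_filtration s) (\<lambda>\<omega>. \<omega>))
      (\<lambda>_. ennreal (Q h $ i $ j))"
    (is "?M = density ?N _")
proof (rule eval_measure_eqI[of s "{0..s}"])
  interpret prob_space "P a" by (rule prob_space_P[OF a])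
  have sub: "sets (path_filtration s) \<subseteq> sets path_algebra" by (rule sets_eval_algebra_mono) (use s in auto)
  have idm: "(\<lambda>\<omega>. \<omega>) \<in> density (P a) f \<rightarrow>\<^sub>M path_filtration s" for f
    using measurable_eval_algebra_mono[OF measurable_ident, of "{0..s}" "{0..}"] s a
    by (simp add: measurable_P id_def)
  have S1: "{\<omega> \<in> index_paths. \<omega> s = i} \<in> sets (P a)" by (rule sets_eval_eq[OF a s])
  have S2: "{\<omega> \<in> index_paths. \<omega> s = i \<and> \<omega> (s + h) = j} \<in> sets (P a)"
    using s h by (intro sets_eval_eq2[OF a]) simp_all
  have lhs: "emeasure ?M X = ennreal (prob {\<omega> \<in> X. \<omega> s = i \<and> \<omega> (s + h) = j})"
    if X: "X \<in> sets (path_filtration s)" for X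
  proof -
    have "X \<inter> index_paths = X" using sets.sets_into_space[OF X] by auto
    moreover have "{\<omega> \<in> index_paths. \<omega> s = i \<and> \<omega> (s + h) = j} \<inter> X = {\<omega> \<in> X. \<omega> s = i \<and> \<omega> (s + h) = j}"
      using sets.sets_into_space[OF X] by auto
    ultimately show ?thesis
      using X sub a S2 by (auto simp: emeasure_distr[OF idm] emeasure_restricted emeasure_eq_measure)
  qed
  have rhs': "emeasure ?N X = ennreal (prob {\<omega> \<in> X. \<omega> s = i})"
    if X: "X \<in> sets (path_filtration s)" for X
  proof -
    have "X \<inter> index_paths = X" using sets.sets_into_space[OF X] by auto
    moreover have "{\<omega> \<in> index_paths. \<omega> s = i} \<inter> X = {\<omega> \<in> X. \<omega> s = i}"
      using sets.sets_into_space[OF X] by auto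
    ultimately show ?thesis
      using X sub a S1 by (auto simp: emeasure_distr[OF idm] emeasure_restricted emeasure_eq_measure)
  qed
  have rhs: "emeasure (density ?N (\<lambda>_. ennreal (Q h $ i $ j))) X = ennreal (Q h $ i $ j * prob {\<omega> \<in> X. \<omega> s = i})"
    if X: "X \<in> sets (path_filtration s)" for X
    using X Q_nonneg[of h i j] h by (simp add: emeasure_density_const rhs' ennreal_mult)
  have key: "prob {\<omega> \<in> cylinder F g. \<omega> s = i \<and> \<omega> (s + h) = j} = Q h $ i $ j * prob {\<omega> \<in> cylinder F g. \<omega> s = i}"
    if F: "finite F" "s \<in> F" "F \<subseteq> {0..s}" for F g
  proof (cases "g s = i")
    case True
    obtain k and t :: "nat \<Rightarrow> real" where k: "1 \<le> k" and t: "strict_mono_on {1..k} t" and tF: "t ` {1..k} = F"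
      using finite_increasing_enumeration[of F] F by blast
    have tk: "t k = s"
    proof -
      obtain l where l: "l \<in> {1..k}" "t l = s" using F(2) tF by (metis imageE)
      have "t l \<le> t k" using l(1) k strict_mono_on_leD[OF t, of l k] by auto
      moreover have "t k \<in> F" using tF k by auto
      ultimately show ?thesis using l F by force
    qed
    have "t 1 \<in> F" using tF k by auto
    then have t1: "0 \<le> t 1" using F(3) by auto
    \<comment> \<open>The new time exceeds all earlier ones because the last of them is
      \<open>s\<close>; the enumeration is extended by one index.\<close>
    define t' where "t' = t(Suc k := s + h)"
    define g' where "g' = g(s + h := j)"
    have mono: "strict_mono_on {1..Suc k} t'"
    proof (rule strict_mono_onI)
      fix r l assume rl: "r \<in> {1..Suc k}" "l \<in> {1..Suc k}" "r < l"
      show "t' r < t' l"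
      proof (cases "l = Suc k")
        case True
        have "t r \<le> t k" using rl k strict_mono_on_leD[OF t, of r k] by auto
        then show ?thesis using True rl h tk by (simp add: t'_def)
      next
        case False
        then show ?thesis using rl strict_mono_onD[OF t, of r l] by (simp add: t'_def)
      qed
    qed
    have im: "t' ` {1..Suc k} = insert (s + h) F"
    proof -
      have "{1..Suc k} = insert (Suc k) {1..k}" by auto
      moreover have "t' ` {1..k} = t ` {1..k}" by (auto simp: t'_def)
      ultimately have "t' ` {1..Suc k} = insert (t' (Suc k)) F" by (simp only: image_insert tF)
      then show ?thesis by (simp add: t'_def)
    qed
    have sh: "s + h \<notin> F" using F h by auto
    have gF: "g' r = g r" if "r \<in> F" for r using that sh by (auto simp: g'_def)
    have tF': "t l \<in> F" if "1 \<le> l" "l \<le> k" for l using that tF by auto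
    have "{\<omega> \<in> cylinder F g. \<omega> s = i \<and> \<omega> (s + h) = j} = cylinder (t' ` {1..Suc k}) g'"
      unfolding im using True F gF by (auto simp: cylinder_def g'_def)
    then have "prob {\<omega> \<in> cylinder F g. \<omega> s = i \<and> \<omega> (s + h) = j} =
      (a v* Q (t' 1)) $ g' (t' 1) * (\<Prod>l = 2..Suc k. Q (t' l - t' (l - 1)) $ g' (t' (l - 1)) $ g' (t' l))"
      using measure_cylinder[OF a _ _ mono, of g'] t1 k by (simp add: t'_def)
    also have "(\<Prod>l = 2..Suc k. Q (t' l - t' (l - 1)) $ g' (t' (l - 1)) $ g' (t' l)) =
      (\<Prod>l = 2..k. Q (t' l - t' (l - 1)) $ g' (t' (l - 1)) $ g' (t' l)) * Q h $ i $ j"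
    proof -
      have "t' (Suc k) - t' (Suc k - 1) = h" "g' (t' (Suc k - 1)) = i" "g' (t' (Suc k)) = j"
        using k tk True h by (auto simp: t'_def g'_def)
      then show ?thesis using k by (subst prod.nat_ivl_Suc') (auto simp: mult.commute)
    qed
    also have "(\<Prod>l = 2..k. Q (t' l - t' (l - 1)) $ g' (t' (l - 1)) $ g' (t' l)) =
      (\<Prod>l = 2..k. Q (t l - t (l - 1)) $ g (t (l - 1)) $ g (t l))"
    proof (rule prod.cong)
      fix l assume "l \<in> {2..k}"
      then have "t' l = t l" "t' (l - 1) = t (l - 1)" "t l \<in> F" "t (l - 1) \<in> F"
        using tF' by (auto simp: t'_def)
      then show "Q (t' l - t' (l - 1)) $ g' (t' (l - 1)) $ g' (t' l) = Q (t l - t (l - 1)) $ g (t (l - 1)) $ g (t l)"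
        using gF by simp
    qed simp
    also have "(a v* Q (t' 1)) $ g' (t' 1) = (a v* Q (t 1)) $ g (t 1)"
      using k tF'[of 1] gF by (simp add: t'_def)
    also have "(a v* Q (t 1)) $ g (t 1) * ((\<Prod>l = 2..k. Q (t l - t (l - 1)) $ g (t (l - 1)) $ g (t l)) * Q h $ i $ j)
       = Q h $ i $ j * prob (cylinder F g)"
      using measure_cylinder[OF a k t1 t, of g] unfolding tF by simp
    finally have "prob {\<omega> \<in> cylinder F g. \<omega> s = i \<and> \<omega> (s + h) = j} = Q h $ i $ j * prob (cylinder F g)" .
    moreover have "{\<omega> \<in> cylinder F g. \<omega> s = i} = cylinder F g" using F True by (auto simp: cylinder_def)
    ultimately show ?thesis by simp
  next
    case False
    then have "{\<omega> \<in> cylinder F g. \<omega> s = i} = {}" "{\<omega> \<in> cylinder F g. \<omega> s = i \<and> \<omega> (s + h) = j} = {}"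
      using F by (auto simp: cylinder_def)
    then show ?thesis by (simp only: measure_empty mult_zero_right)
  qed
  show "emeasure ?M (cylinder F g) = emeasure (density ?N (\<lambda>_. ennreal (Q h $ i $ j))) (cylinder F g)"
    if F: "finite F" "s \<in> F" "F \<subseteq> {0..s}" for F g
  proof -
    note c = cylinder_sets[OF F(1,3), of g]
    show ?thesis by (simp only: lhs[OF c] rhs[OF c] key[OF F])
  qed
  have top: "index_paths \<in> sets (path_filtration s)" using sets.top[of "path_filtration s"] by simp
  have "prob {\<omega> \<in> index_paths. \<omega> s = i \<and> \<omega> (s + h) = j} = Q h $ i $ j * prob {\<omega> \<in> index_paths. \<omega> s = i}"
    using key[of "{s}" "\<lambda>_. i"] s by (simp add: cylinder_def conj_ac cong: conj_cong)
  then show "emeasure ?M index_paths = emeasure (density ?N (\<lambda>_. ennreal (Q h $ i $ j))) index_paths"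
    by (simp add: lhs[OF top] rhs[OF top])
  show "emeasure ?M index_paths \<noteq> \<infinity>" by (simp add: lhs[OF top])
qed (use s in auto)

lemma integral_transition:
  fixes f :: "(real \<Rightarrow> 'm) \<Rightarrow> real"
  assumes a: "a \<in> prob_simplex" and s: "0 \<le> s" and h: "0 < h" and f: "f \<in> borel_measurable (path_filtration s)"
  shows "(LINT \<omega>|P a. indicator {\<omega> \<in> index_paths. \<omega> s = i \<and> \<omega> (s + h) = j} \<omega> * f \<omega>) =
    Q h $ i $ j * (LINT \<omega>|P a. indicator {\<omega> \<in> index_paths. \<omega> s = i} \<omega> * f \<omega>)"
proof -
  have fm: "f \<in> borel_measurable path_algebra" by (rule measurable_eval_algebra_mono[OF f]) (use s in auto)
  then have fP: "f \<in> borel_measurable (P a)" using a by (simp add: measurable_P)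
  have idm: "(\<lambda>\<omega>. \<omega>) \<in> density (P a) g \<rightarrow>\<^sub>M path_filtration s" for g
    using measurable_eval_algebra_mono[OF measurable_ident, of "{0..s}" "{0..}"] s a
    by (simp add: measurable_P id_def)
  have *: "(LINT \<omega>|P a. indicator S \<omega> * f \<omega>) = integral\<^sup>L (distr (density (P a) (indicator S)) (path_filtration s) (\<lambda>\<omega>. \<omega>)) f"
    if S: "S \<in> sets (P a)" for S
  proof -
    have ind: "(\<lambda>\<omega>. indicator S \<omega> :: ennreal) = (\<lambda>\<omega>. ennreal (indicator S \<omega>))" by (auto simp: indicator_def)
    have "integral\<^sup>L (distr (density (P a) (indicator S)) (path_filtration s) (\<lambda>\<omega>. \<omega>)) f =
        integral\<^sup>L (density (P a) (indicator S)) f"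
      by (rule integral_distr[OF idm f])
    also have "\<dots> = (LINT \<omega>|P a. indicator S \<omega> * f \<omega>)"
      unfolding ind by (subst integral_density) (use fP S in auto)
    finally show ?thesis by simp
  qed
  have S1: "{\<omega> \<in> index_paths. \<omega> s = i} \<in> sets (P a)" by (rule sets_eval_eq[OF a s])
  have S2: "{\<omega> \<in> index_paths. \<omega> s = i \<and> \<omega> (s + h) = j} \<in> sets (P a)"
    using s h by (intro sets_eval_eq2[OF a]) simp_all
  show ?thesis
    unfolding *[OF S2] *[OF S1] transition_property[OF a s h]
    by (subst integral_density) (use f Q_nonneg[of h i j] h in auto)
qed

end

text \<open>A concatenated path already has its new value at the switching time, so it agrees with
  the constant path only before the right endpoint.\<close>

lemma set_integral_cong_Ico:
  fixes f :: "real \<Rightarrow> 'b::{banach, second_countable_topology}"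
  assumes "set_integrable lborel {a..b} f" "set_integrable lborel {a..b} g" "\<And>s. a \<le> s \<Longrightarrow> s < b \<Longrightarrow> f s = g s"
  shows "(LINT s:{a..b}|lborel. f s) = (LINT s:{a..b}|lborel. g s)"
  unfolding set_lebesgue_integral_def
proof (rule integral_cong_AE)
  show "AE s in lborel. indicator {a..b} s *\<^sub>R f s = indicator {a..b} s *\<^sub>R g s"
    using AE_lborel_singleton[of b] by eventually_elim (use assms(3) in \<open>auto simp: indicator_def\<close>)
qed (use assms(1,2) in \<open>auto simp: set_integrable_def\<close>)

section \<open>Running cost, controls and stopping times\<close>

locale controlled_system = hamiltonian H + switching \<Lambda> P
  for H :: "'m::finite \<Rightarrow> 'n::finite torus \<Rightarrow> real^'n \<Rightarrow> real" and \<Lambda> :: "real^'m^'m" and P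
begin

text \<open>The starting point is a lift to the Euclidean space. Displacements can then be added and
  estimated there, and the projection to the torus occurs only inside \<open>L\<close>.\<close>

definition rate :: "real \<Rightarrow> real^'n \<Rightarrow> (real \<Rightarrow> 'm) \<Rightarrow> (real \<Rightarrow> real^'n) \<Rightarrow> real \<Rightarrow> real" where
  "rate \<alpha> z \<omega> \<xi> s = L (\<omega> s) (torus_proj (z + displacement \<xi> s)) (- \<xi> s) + \<alpha>"

definition running_cost :: "real \<Rightarrow> real^'n \<Rightarrow> (real \<Rightarrow> 'm) \<Rightarrow> (real \<Rightarrow> real^'n) \<Rightarrow> real \<Rightarrow> real" where
  "running_cost \<alpha> z \<omega> \<xi> t = (LINT s:{0..t}|lborel. rate \<alpha> z \<omega> \<xi> s)"

lemma cost_eq: "cost P L \<alpha> b i (torus_proj z) \<tau> \<Xi> =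
    (LINT \<omega>|PI i. running_cost \<alpha> z \<omega> (\<Xi> \<omega>) (\<tau> \<omega>) + b $ \<omega> (\<tau> \<omega>))"
  by (simp add: cost_def running_cost_def rate_def torus_primitive_eq torus_proj_add)

text \<open>For a fixed index this is a continuous function of measurable ones; the random index is
  then inserted by composing over the finitely many states.\<close>

lemma measurable_rate:
  assumes W: "W \<in> M \<rightarrow>\<^sub>M path_algebra" and X: "\<Xi> \<in> M \<rightarrow>\<^sub>M eval_algebra euclidean {0..}"
  shows "(\<lambda>(w, s). rate \<alpha> z (W w) (\<Xi> w) (max 0 s)) \<in> borel_measurable (M \<Otimes>\<^sub>M borel)"
proof -
  note [measurable] = W
  have Lm: "(\<lambda>zq. L i (torus_proj (fst zq)) (snd zq)) \<in> borel_measurable (borel \<Otimes>\<^sub>M borel)" for i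
    unfolding borel_prod using continuous_on_L[of UNIV i]
    by (intro borel_measurable_continuous_onI) (simp add: case_prod_beta)
  have *: "(\<lambda>ws. L i (torus_proj (z + displacement (\<Xi> (fst ws)) (max 0 (snd ws)))) (- \<Xi> (fst ws) (max 0 (snd ws)))) \<in> borel_measurable (M \<Otimes>\<^sub>M borel)" for i
  proof -
    have "(\<lambda>ws. (z + displacement (\<Xi> (fst ws)) (max 0 (snd ws)), - \<Xi> (fst ws) (max 0 (snd ws)))) \<in> M \<Otimes>\<^sub>M borel \<rightarrow>\<^sub>M borel \<Otimes>\<^sub>M borel"
      using measurable_displacement[OF X] measurable_vector_path[OF X] unfolding case_prod_beta
      by (intro measurable_Pair borel_measurable_add borel_measurable_uminus borel_measurable_const)
    from measurable_compose[OF this Lm] show ?thesis unfolding fst_conv snd_conv .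
  qed
  have "(\<lambda>ws. (W (fst ws), snd ws)) \<in> M \<Otimes>\<^sub>M borel \<rightarrow>\<^sub>M path_algebra \<Otimes>\<^sub>M borel" by measurable
  from measurable_compose[OF this measurable_index_path]
  have "(\<lambda>ws. W (fst ws) (max 0 (snd ws))) \<in> M \<Otimes>\<^sub>M borel \<rightarrow>\<^sub>M count_space UNIV" by simp
  from measurable_compose_countable'[where f="\<lambda>i ws. L i (torus_proj (z + displacement (\<Xi> (fst ws)) (max 0 (snd ws)))) (- \<Xi> (fst ws) (max 0 (snd ws)))", OF * this countable_finite]
  show ?thesis unfolding rate_def case_prod_beta by simp
qed

lemma rate_bounded:
  obtains C where "C \<ge> 0" "\<And>z \<omega> \<xi> s. norm (\<xi> s) \<le> R \<Longrightarrow> \<bar>rate \<alpha> z \<omega> \<xi> s\<bar> \<le> C"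
proof -
  obtain C where C: "C \<ge> 0" "\<And>i x q. norm q \<le> R \<Longrightarrow> \<bar>L i x q\<bar> \<le> C" by (rule L_bounded[of R]) blast
  show ?thesis
  proof (rule that[of "C + \<bar>\<alpha>\<bar>"])
    fix z \<omega> and \<xi> :: "real \<Rightarrow> real^'n" and s assume "norm (\<xi> s) \<le> R"
    then have "\<bar>L (\<omega> s) (torus_proj (z + displacement \<xi> s)) (- \<xi> s)\<bar> \<le> C" by (intro C(2)) simp
    then show "\<bar>rate \<alpha> z \<omega> \<xi> s\<bar> \<le> C + \<bar>\<alpha>\<bar>" unfolding rate_def by linarith
  qed (use C in simp)
qed

lemma rate_measurable_path:
  assumes "\<omega> \<in> index_paths" "\<xi> \<in> vector_paths"
  shows "(\<lambda>s. rate \<alpha> z \<omega> \<xi> (max 0 s)) \<in> borel_measurable borel"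
proof -
  have "(\<lambda>_. \<omega>) \<in> count_space {()} \<rightarrow>\<^sub>M path_algebra" "(\<lambda>_. \<xi>) \<in> count_space {()} \<rightarrow>\<^sub>M eval_algebra euclidean {0..}"
    using assms by simp_all
  from measurable_rate[OF this, of \<alpha> z]
  have "(\<lambda>ws. rate \<alpha> z \<omega> \<xi> (max 0 (snd ws))) \<in> borel_measurable (count_space {()} \<Otimes>\<^sub>M borel)"
    by (simp add: case_prod_beta)
  from measurable_compose[OF measurable_Pair1'[of "()"] this] show ?thesis by simp
qed

lemma rate_set_integrable:
  assumes "\<omega> \<in> index_paths" "\<xi> \<in> vector_paths" "0 \<le> a"
  shows "set_integrable lborel {a..b} (rate \<alpha> z \<omega> \<xi>)"
proof -
  obtain R where R: "\<And>s. 0 \<le> s \<Longrightarrow> s \<le> b \<Longrightarrow> norm (\<xi> s) \<le> R"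
    using vector_path_bounded[OF assms(2), of b] by metis
  obtain C where "\<And>z \<omega> \<xi> s. norm (\<xi> s) \<le> R \<Longrightarrow> \<bar>rate \<alpha> z \<omega> \<xi> s\<bar> \<le> C"
    by (rule rate_bounded[where R=R and \<alpha>=\<alpha>]) blast
  then show ?thesis
    by (intro set_integrable_bounded[where B=C] rate_measurable_path) (use assms R in auto)
qed

lemma running_cost_split:
  assumes "\<omega> \<in> index_paths" "\<xi> \<in> vector_paths" "0 \<le> s" "s \<le> t"
  shows "running_cost \<alpha> z \<omega> \<xi> t = running_cost \<alpha> z \<omega> \<xi> s + (LINT r:{s..t}|lborel. rate \<alpha> z \<omega> \<xi> r)"
  unfolding running_cost_def by (intro set_integral_split rate_set_integrable assms) simp

lemma running_cost_tendsto:
  assumes w: "\<omega> \<in> index_paths" and x: "\<xi> \<in> vector_paths" and s: "0 \<le> s"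
  shows "(running_cost \<alpha> z \<omega> \<xi> \<longlongrightarrow> running_cost \<alpha> z \<omega> \<xi> s) (at_right s)"
proof -
  obtain R where R: "R > 0" "\<And>r. 0 \<le> r \<Longrightarrow> r \<le> s + 1 \<Longrightarrow> norm (\<xi> r) \<le> R"
    using vector_path_bounded[OF x, of "s + 1"] by metis
  obtain C where C: "C \<ge> 0" "\<And>z \<omega> \<xi> s. norm (\<xi> s) \<le> R \<Longrightarrow> \<bar>rate \<alpha> z \<omega> \<xi> s\<bar> \<le> C"
    by (rule rate_bounded[where R=R and \<alpha>=\<alpha>]) blast
  have "((\<lambda>t. running_cost \<alpha> z \<omega> \<xi> t - running_cost \<alpha> z \<omega> \<xi> s) \<longlongrightarrow> 0) (at_right s)"
  proof (rule Lim_null_comparison)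
    show "\<forall>\<^sub>F t in at_right s. norm (running_cost \<alpha> z \<omega> \<xi> t - running_cost \<alpha> z \<omega> \<xi> s) \<le> C * (t - s)"
    proof (rule eventually_at_rightI[of s "s + 1"])
      fix t assume t: "t \<in> {s<..<s + 1}"
      have "norm (LINT r:{s..t}|lborel. rate \<alpha> z \<omega> \<xi> r) \<le> C * (t - s)"
        by (rule set_integral_norm_le) (use t s R C in auto)
      then show "norm (running_cost \<alpha> z \<omega> \<xi> t - running_cost \<alpha> z \<omega> \<xi> s) \<le> C * (t - s)"
        using running_cost_split[OF w x s, of t \<alpha> z] t by simp
    qed simp
    have "((\<lambda>t. C * (t - s)) \<longlongrightarrow> C * (s - s)) (at_right s)" by (intro tendsto_intros)
    then show "((\<lambda>t. C * (t - s)) \<longlongrightarrow> 0) (at_right s)" by simp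
  qed
  then show ?thesis using Lim_null by blast
qed

lemma measurable_running_cost:
  assumes W: "W \<in> M \<rightarrow>\<^sub>M path_algebra" and X: "\<Xi> \<in> M \<rightarrow>\<^sub>M eval_algebra euclidean {0..}"
    and T: "T \<in> borel_measurable M" "\<And>w. w \<in> space M \<Longrightarrow> 0 \<le> T w"
  shows "(\<lambda>w. running_cost \<alpha> z (W w) (\<Xi> w) (T w)) \<in> borel_measurable M"
proof -
  have joint: "(\<lambda>(w, s). running_cost \<alpha> z (W w) (\<Xi> w) (max 0 s)) \<in> borel_measurable (M \<Otimes>\<^sub>M borel)"
  proof (rule measurable_right_continuous)
    fix t
    note [measurable] = measurable_rate[OF W X, of \<alpha> z]
    have "(\<lambda>w. LINT s|lborel. indicator {0..t} s *\<^sub>R rate \<alpha> z (W w) (\<Xi> w) (max 0 s)) \<in> borel_measurable M"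
      by measurable
    moreover have "running_cost \<alpha> z (W w) (\<Xi> w) t = (LINT s|lborel. indicator {0..t} s *\<^sub>R rate \<alpha> z (W w) (\<Xi> w) (max 0 s))" for w
      unfolding running_cost_def set_lebesgue_integral_def
      by (intro Bochner_Integration.integral_cong) (auto simp: indicator_def max_def)
    ultimately show "(\<lambda>w. running_cost \<alpha> z (W w) (\<Xi> w) t) \<in> borel_measurable M" by simp
  next
    show "(running_cost \<alpha> z (W w) (\<Xi> w) \<longlongrightarrow> running_cost \<alpha> z (W w) (\<Xi> w) s) (at_right s)"
      if "w \<in> space M" "0 \<le> s" for w s
      using running_cost_tendsto measurable_space[OF W that(1)] measurable_space[OF X that(1)] that(2) by auto
  qed
  have "(\<lambda>w. (w, T w)) \<in> M \<rightarrow>\<^sub>M M \<Otimes>\<^sub>M borel" using T by measurable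
  from measurable_compose[OF this joint]
  have "(\<lambda>w. running_cost \<alpha> z (W w) (\<Xi> w) (max 0 (T w))) \<in> borel_measurable M" by simp
  then show ?thesis
    by (rule measurable_cong[THEN iffD1, rotated]) (use T(2) in \<open>auto simp: max_absorb2\<close>)
qed

lemma running_cost_bound:
  assumes "\<And>s. 0 \<le> s \<Longrightarrow> s \<le> t \<Longrightarrow> norm (\<xi> s) \<le> R" "0 \<le> t"
    and "C \<ge> 0" "\<And>z \<omega> \<xi> s. norm (\<xi> s) \<le> R \<Longrightarrow> \<bar>rate \<alpha> z \<omega> \<xi> s\<bar> \<le> C"
  shows "\<bar>running_cost \<alpha> z \<omega> \<xi> t\<bar> \<le> C * t"
  using set_integral_norm_le[of 0 t "rate \<alpha> z \<omega> \<xi>" C] assms unfolding running_cost_def by simp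

lemma measurable_eval_at:
  assumes W: "W \<in> M \<rightarrow>\<^sub>M path_algebra" and T: "T \<in> borel_measurable M" "\<And>w. w \<in> space M \<Longrightarrow> 0 \<le> T w"
  shows "(\<lambda>w. W w (T w)) \<in> M \<rightarrow>\<^sub>M (count_space UNIV :: 'm measure)"
proof -
  have "(\<lambda>w. (W w, T w)) \<in> M \<rightarrow>\<^sub>M path_algebra \<Otimes>\<^sub>M borel" using W T by measurable
  from measurable_compose[OF this measurable_index_path]
  have "(\<lambda>w. W w (max 0 (T w))) \<in> M \<rightarrow>\<^sub>M (count_space UNIV :: 'm measure)" by simp
  then show ?thesis
    by (rule measurable_cong[THEN iffD1, rotated]) (use T(2) in \<open>auto simp: max_absorb2\<close>)
qed

lemma control_measurable: "control P \<Xi> \<Longrightarrow> \<Xi> \<in> path_algebra \<rightarrow>\<^sub>M eval_algebra euclidean {0..}"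
  by (simp add: control_def)

lemma control_in: "control P \<Xi> \<Longrightarrow> \<omega> \<in> index_paths \<Longrightarrow> \<Xi> \<omega> \<in> vector_paths"
  using measurable_space[OF control_measurable] by fastforce

text \<open>One bound for all initial states, in pointwise form.\<close>

lemma control_bounded:
  assumes "control P (\<Xi> :: (real \<Rightarrow> 'm) \<Rightarrow> real \<Rightarrow> real^'n)"
  obtains R where "R > 0" "\<And>j. AE \<omega> in PI j. \<forall>s. 0 \<le> s \<longrightarrow> s \<le> t \<longrightarrow> norm (\<Xi> \<omega> s) \<le> R"
proof -
  \<comment> \<open>The definition of a control speaks of positive times only.\<close>
  define t' where "t' = max t 1"
  have "t' > 0" "t \<le> t'" by (auto simp: t'_def)
  then obtain R where R: "R > 0" "\<And>j. AE \<omega> in PI j. (SUP s\<in>{0..t'}. norm (\<Xi> \<omega> s)) < R"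
    using assms unfolding control_def almost_surely_iff by meson
  show ?thesis
  proof (rule that[OF R(1)])
    fix j
    show "AE \<omega> in PI j. \<forall>s. 0 \<le> s \<longrightarrow> s \<le> t \<longrightarrow> norm (\<Xi> \<omega> s) \<le> R"
      using R(2)[of j] AE_space
    proof eventually_elim
      fix \<omega> assume *: "(SUP s\<in>{0..t'}. norm (\<Xi> \<omega> s)) < R" "\<omega> \<in> space (PI j)"
      then have "\<Xi> \<omega> \<in> vector_paths" by (intro control_in[OF assms]) simp
      then obtain K where "\<And>s. 0 \<le> s \<Longrightarrow> s \<le> t' \<Longrightarrow> norm (\<Xi> \<omega> s) \<le> K"
        using vector_path_bounded by metis
      \<comment> \<open>Without this the real supremum would not dominate the values; cadlag paths
        are bounded on compact intervals.\<close>
      then have "bdd_above ((\<lambda>s. norm (\<Xi> \<omega> s)) ` {0..t'})" by (intro bdd_aboveI2[of _ _ K]) auto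
      then have "norm (\<Xi> \<omega> s) \<le> (SUP s\<in>{0..t'}. norm (\<Xi> \<omega> s))" if "0 \<le> s" "s \<le> t'" for s
        using that by (intro cSUP_upper) auto
      with * \<open>t \<le> t'\<close> show "\<forall>s. 0 \<le> s \<longrightarrow> s \<le> t \<longrightarrow> norm (\<Xi> \<omega> s) \<le> R" by force
    qed
  qed
qed

text \<open>Nonanticipation on an interval follows from nonanticipation at the endpoint of each
  shorter interval. Time 0 is separate because the intervals in the definition have positive
  length.\<close>

lemma controlI:
  fixes \<Xi> :: "(real \<Rightarrow> 'm) \<Rightarrow> real \<Rightarrow> real^'n"
  assumes "\<Xi> \<in> path_algebra \<rightarrow>\<^sub>M eval_algebra euclidean {0..}"
    and R: "\<And>t. t > 0 \<Longrightarrow> \<exists>R. \<forall>j. AE \<omega> in PI j. \<forall>s. 0 \<le> s \<longrightarrow> s \<le> t \<longrightarrow> norm (\<Xi> \<omega> s) \<le> R"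
    and "\<And>t \<omega> \<omega>'. t > 0 \<Longrightarrow> \<omega> \<in> index_paths \<Longrightarrow> \<omega>' \<in> index_paths \<Longrightarrow>
        (\<And>s. 0 \<le> s \<Longrightarrow> s \<le> t \<Longrightarrow> \<omega> s = \<omega>' s) \<Longrightarrow> \<Xi> \<omega> t = \<Xi> \<omega>' t"
    and "\<And>\<omega> \<omega>'. \<omega> \<in> index_paths \<Longrightarrow> \<omega>' \<in> index_paths \<Longrightarrow> \<omega> 0 = \<omega>' 0 \<Longrightarrow> \<Xi> \<omega> 0 = \<Xi> \<omega>' 0"
  shows "control P \<Xi>"
  unfolding control_def
proof (intro conjI allI impI ballI)
  fix t :: real assume "t > 0"
  then obtain R where R: "\<And>j. AE \<omega> in PI j. \<forall>s. 0 \<le> s \<longrightarrow> s \<le> t \<longrightarrow> norm (\<Xi> \<omega> s) \<le> R"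
    using R by blast
  have "AE \<omega> in PI j. (SUP s\<in>{0..t}. norm (\<Xi> \<omega> s)) < \<bar>R\<bar> + 1" for j
    using R[of j]
  proof eventually_elim
    fix \<omega> :: "real \<Rightarrow> 'm" assume "\<forall>s. 0 \<le> s \<longrightarrow> s \<le> t \<longrightarrow> norm (\<Xi> \<omega> s) \<le> R"
    then have "norm (\<Xi> \<omega> s) \<le> \<bar>R\<bar>" if "s \<in> {0..t}" for s
      using that by (meson abs_ge_self atLeastAtMost_iff order_trans)
    then have "(SUP s\<in>{0..t}. norm (\<Xi> \<omega> s)) \<le> \<bar>R\<bar>"
      using \<open>t > 0\<close> by (intro cSUP_least) simp_all
    then show "(SUP s\<in>{0..t}. norm (\<Xi> \<omega> s)) < \<bar>R\<bar> + 1" by simp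
  qed
  then show "\<exists>R>0. almost_surely P (\<lambda>\<omega>. (SUP s\<in>{0..t}. norm (\<Xi> \<omega> s)) < R)"
    unfolding almost_surely_iff by (intro exI[of _ "\<bar>R\<bar> + 1"]) auto
next
  fix t s :: real and \<omega> \<omega>' :: "real \<Rightarrow> 'm" assume *: "\<omega> \<in> index_paths" "\<omega>' \<in> index_paths" "\<forall>s\<in>{0..t}. \<omega> s = \<omega>' s" "s \<in> {0..t}"
  show "\<Xi> \<omega> s = \<Xi> \<omega>' s"
    using assms(3)[of s \<omega> \<omega>'] assms(4)[of \<omega> \<omega>'] * by (cases "s = 0") auto
qed (use assms in auto)

lemma control_nonanticipating:
  assumes "control P \<Xi>" "0 \<le> s" "s \<le> t" "t > 0" "\<omega> \<in> index_paths" "\<omega>' \<in> index_paths"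
    "\<And>s. 0 \<le> s \<Longrightarrow> s \<le> t \<Longrightarrow> \<omega> s = \<omega>' s"
  shows "\<Xi> \<omega> s = \<Xi> \<omega>' s"
proof -
  from assms(1) have "\<forall>s\<in>{0..t}. \<Xi> \<omega> s = \<Xi> \<omega>' s"
    unfolding control_def using assms(4-7) by (meson atLeastAtMost_iff)
  with assms(2,3) show ?thesis by simp
qed

lemma bounded_stopping_time_measurable:
  assumes "bounded_stopping_time (\<tau> :: (real \<Rightarrow> 'm) \<Rightarrow> real)"
  shows "\<tau> \<in> borel_measurable path_algebra"
  unfolding borel_measurable_iff_le
proof
  fix t
  have "{\<omega> \<in> index_paths. \<tau> \<omega> \<le> t} \<in> sets (path_filtration t)"
    using assms by (auto simp: bounded_stopping_time_def stopping_time_def pred_def)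
  then show "{\<omega> \<in> space path_algebra. \<tau> \<omega> \<le> t} \<in> sets path_algebra"
    using sets_eval_algebra_mono[of "{0..t}" "{0..}"] by auto
qed

lemma bounded_stopping_time_bounds:
  assumes "bounded_stopping_time (\<tau> :: (real \<Rightarrow> 'm) \<Rightarrow> real)"
  obtains T where "T > 0" "\<And>\<omega>. \<omega> \<in> index_paths \<Longrightarrow> 0 \<le> \<tau> \<omega> \<and> \<tau> \<omega> \<le> T"
proof -
  obtain T where "\<And>\<omega>. \<omega> \<in> index_paths \<Longrightarrow> 0 \<le> \<tau> \<omega> \<and> \<tau> \<omega> \<le> T"
    using assms unfolding bounded_stopping_time_def by blast
  then show ?thesis by (intro that[of "max T 1"]) (auto simp: le_max_iff_disj)
qed

definition total_cost :: "real \<Rightarrow> real^'m \<Rightarrow> real^'n \<Rightarrow> ((real \<Rightarrow> 'm) \<Rightarrow> real) \<Rightarrow> ((real \<Rightarrow> 'm) \<Rightarrow> real \<Rightarrow> real^'n) \<Rightarrow> (real \<Rightarrow> 'm) \<Rightarrow> real" where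
  "total_cost \<alpha> b z \<tau> \<Xi> \<omega> = running_cost \<alpha> z \<omega> (\<Xi> \<omega>) (\<tau> \<omega>) + b $ \<omega> (\<tau> \<omega>)"

lemma measurable_total_cost:
  assumes "bounded_stopping_time \<tau>" "control P \<Xi>"
  shows "total_cost \<alpha> b z \<tau> \<Xi> \<in> borel_measurable path_algebra"
proof -
  obtain T where T: "\<And>\<omega>. \<omega> \<in> index_paths \<Longrightarrow> 0 \<le> \<tau> \<omega> \<and> \<tau> \<omega> \<le> T"
    using bounded_stopping_time_bounds[OF assms(1)] by metis
  note t = bounded_stopping_time_measurable[OF assms(1)]
  have "(\<lambda>\<omega>. running_cost \<alpha> z \<omega> (\<Xi> \<omega>) (\<tau> \<omega>)) \<in> borel_measurable path_algebra"
    by (rule measurable_running_cost[OF measurable_ident_sets control_measurable[OF assms(2)] t]) (use T in auto)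
  moreover have "(\<lambda>\<omega>. \<omega> (\<tau> \<omega>)) \<in> path_algebra \<rightarrow>\<^sub>M (count_space UNIV :: 'm measure)"
    by (rule measurable_eval_at[OF measurable_ident_sets t]) (use T in auto)
  then have "(\<lambda>\<omega>. b $ \<omega> (\<tau> \<omega>)) \<in> borel_measurable path_algebra"
    by (rule measurable_compose) simp
  ultimately show ?thesis unfolding total_cost_def by measurable
qed

lemma integrable_total_cost:
  assumes "bounded_stopping_time \<tau>" "control P \<Xi>"
  shows "integrable (PI i) (total_cost \<alpha> b z \<tau> \<Xi>)"
proof -
  interpret prob_space "PI i" by (rule prob_space_P[OF axis_in_simplex])
  obtain T where T: "\<And>\<omega>. \<omega> \<in> index_paths \<Longrightarrow> 0 \<le> \<tau> \<omega> \<and> \<tau> \<omega> \<le> T"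
    using bounded_stopping_time_bounds[OF assms(1)] by metis
  obtain R where R: "AE \<omega> in PI i. \<forall>s. 0 \<le> s \<longrightarrow> s \<le> T \<longrightarrow> norm (\<Xi> \<omega> s) \<le> R"
    by (rule control_bounded[OF assms(2), of T]) blast
  obtain C where C: "C \<ge> 0" "\<And>z \<omega> \<xi> s. norm (\<xi> s) \<le> R \<Longrightarrow> \<bar>rate \<alpha> z \<omega> \<xi> s\<bar> \<le> C"
    by (rule rate_bounded[where R=R and \<alpha>=\<alpha>]) blast
  have "AE \<omega> in PI i. norm (total_cost \<alpha> b z \<tau> \<Xi> \<omega>) \<le> C * T + norm b"
    using R AE_space
  proof eventually_elim
    fix \<omega> assume w: "\<forall>s. 0 \<le> s \<longrightarrow> s \<le> T \<longrightarrow> norm (\<Xi> \<omega> s) \<le> R" "\<omega> \<in> space (PI i)"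
    then have t: "0 \<le> \<tau> \<omega>" "\<tau> \<omega> \<le> T" using T[of \<omega>] by auto
    have "\<bar>running_cost \<alpha> z \<omega> (\<Xi> \<omega>) (\<tau> \<omega>)\<bar> \<le> C * \<tau> \<omega>"
      by (rule running_cost_bound[OF _ t(1) C]) (use w t in auto)
    also have "\<dots> \<le> C * T" using t C by (intro mult_left_mono) auto
    finally show "norm (total_cost \<alpha> b z \<tau> \<Xi> \<omega>) \<le> C * T + norm b"
      unfolding total_cost_def using component_le_norm_cart[of b "\<omega> (\<tau> \<omega>)"] by (simp add: abs_le_iff)
  qed
  moreover have "total_cost \<alpha> b z \<tau> \<Xi> \<in> borel_measurable (PI i)"
    using measurable_total_cost[OF assms] by (simp add: measurable_P)
  ultimately show ?thesis by (intro integrable_const_bound)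
qed

lemma cost_total: "cost P L \<alpha> b i (torus_proj z) \<tau> \<Xi> = (LINT \<omega>|PI i. total_cost \<alpha> b z \<tau> \<Xi> \<omega>)"
  unfolding cost_eq total_cost_def ..

end

section \<open>Short-time estimates for the chain\<close>

context switching begin

lemma matrix_row_bound:
  fixes A :: "real^'m^'m" and w :: "'m \<Rightarrow> real"
  assumes w: "\<And>j. \<bar>w j\<bar> \<le> B"
  shows "\<bar>\<Sum>j\<in>UNIV. A $ i $ j * w j\<bar> \<le> (\<Sum>i\<in>UNIV. \<Sum>j\<in>UNIV. \<bar>A $ i $ j\<bar>) * B"
proof -
  have B: "B \<ge> 0" using w[of undefined] by linarith
  have "\<bar>\<Sum>j\<in>UNIV. A $ i $ j * w j\<bar> \<le> (\<Sum>j\<in>UNIV. \<bar>A $ i $ j\<bar> * B)"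
    by (rule order_trans[OF sum_abs]) (intro sum_mono, simp add: abs_mult mult_left_mono w)
  also have "\<dots> = (\<Sum>j\<in>UNIV. \<bar>A $ i $ j\<bar>) * B" by (simp add: sum_distrib_right)
  also have "\<dots> \<le> (\<Sum>i\<in>UNIV. \<Sum>j\<in>UNIV. \<bar>A $ i $ j\<bar>) * B"
    by (intro mult_right_mono B member_le_sum[of i UNIV "\<lambda>i. \<Sum>j\<in>UNIV. \<bar>A $ i $ j\<bar>"]) (auto intro: sum_nonneg)
  finally show ?thesis .
qed

text \<open>The error is linear in the bound on the vector \<open>w\<close>, with a constant that
  does not depend on \<open>w\<close>. This uniformity allows \<open>w\<close> to be the values of a
  function at a moving point.\<close>

lemma Q_sum_expansion:
  obtains C where "C \<ge> 0" "\<And>h B w i. 0 \<le> h \<Longrightarrow> h \<le> 1 \<Longrightarrow> (\<And>j. \<bar>w j\<bar> \<le> B) \<Longrightarrow>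
      \<bar>(\<Sum>j\<in>UNIV. Q h $ i $ j * w j) - (w i - h * (\<Sum>j\<in>UNIV. \<Lambda> $ i $ j * w j))\<bar> \<le> C * B * h\<^sup>2"
proof -
  obtain C where C: "C \<ge> 0" "\<And>t i j. 0 \<le> t \<Longrightarrow> t \<le> 1 \<Longrightarrow> \<bar>Q t $ i $ j - mat 1 $ i $ j + t * \<Lambda> $ i $ j\<bar> \<le> C * t\<^sup>2"
    by (rule Q_expansion) blast
  have "\<bar>(\<Sum>j\<in>UNIV. Q h $ i $ j * w j) - (w i - h * (\<Sum>j\<in>UNIV. \<Lambda> $ i $ j * w j))\<bar> \<le> real CARD('m) * C * B * h\<^sup>2"
    if h: "0 \<le> h" "h \<le> 1" and w: "\<And>j. \<bar>w j\<bar> \<le> B" for h B i and w :: "'m \<Rightarrow> real"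
  proof -
    have "(\<Sum>j\<in>UNIV. Q h $ i $ j * w j) - (w i - h * (\<Sum>j\<in>UNIV. \<Lambda> $ i $ j * w j)) =
        (\<Sum>j\<in>UNIV. (Q h $ i $ j - mat 1 $ i $ j + h * \<Lambda> $ i $ j) * w j)"
      by (simp add: algebra_simps sum.distrib sum_subtractf sum_distrib_left mat_def if_distrib[of "\<lambda>x. _ * x"] cong: if_cong)
    also have "\<bar>\<dots>\<bar> \<le> (\<Sum>j\<in>(UNIV :: 'm set). C * h\<^sup>2 * B)"
      by (rule order_trans[OF sum_abs]) (intro sum_mono, unfold abs_mult, intro mult_mono C h w, use C(1) in auto)
    also have "\<dots> = real CARD('m) * C * B * h\<^sup>2" by simp
    finally show ?thesis .
  qed
  moreover have "real CARD('m) * C \<ge> 0" using C(1) by simp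
  ultimately show ?thesis using that by blast
qed

lemma transition_indicator:
  assumes a: "a \<in> prob_simplex" and s: "0 \<le> s" and h: "0 < h"
  shows "measure (P a) {\<omega> \<in> index_paths. \<omega> s = i \<and> \<omega> (s + h) = j} = Q h $ i $ j * measure (P a) {\<omega> \<in> index_paths. \<omega> s = i}"
proof -
  have *: "{\<omega> \<in> index_paths. R \<omega>} \<inter> index_paths = {\<omega> \<in> index_paths. R \<omega>}" for R :: "(real \<Rightarrow> 'm) \<Rightarrow> bool" by auto
  have "{\<omega> \<in> index_paths. \<omega> s = i \<and> \<omega> (s + h) = j} \<in> sets (P a)"
    using s h by (intro sets_eval_eq2[OF a]) simp_all
  with integral_transition[OF a s h, of "\<lambda>_. 1" i j] sets_eval_eq[OF a s, of i] a show ?thesis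
    by (simp add: *)
qed

text \<open>The probability of having left a state after time \<open>h\<close> is 1 minus a diagonal
  entry of the transition matrix, hence of order \<open>h\<close>; it is then averaged over the
  state at time \<open>s\<close>.\<close>

lemma jump_probability:
  obtains C where "C \<ge> 0" "\<And>a s t. a \<in> prob_simplex \<Longrightarrow> 0 \<le> s \<Longrightarrow> s \<le> t \<Longrightarrow> t \<le> s + 1 \<Longrightarrow>
    measure (P a) {\<omega> \<in> index_paths. \<omega> s \<noteq> \<omega> t} \<le> C * (t - s)"
proof -
  obtain C where C: "C \<ge> 0" "\<And>t i j. 0 \<le> t \<Longrightarrow> t \<le> 1 \<Longrightarrow> \<bar>Q t $ i $ j - mat 1 $ i $ j + t * \<Lambda> $ i $ j\<bar> \<le> C * t\<^sup>2"
    by (rule Q_expansion) blast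
  \<comment> \<open>The diagonal of \<open>\<Lambda>\<close> bounds the linear term, and
    \<open>C\<close> bounds the remainder, since \<open>h\<^sup>2 \<le> h\<close> for steps of
    length at most 1.\<close>
  define K where "K = C + (\<Sum>i\<in>UNIV. \<bar>\<Lambda> $ i $ i\<bar>)"
  have K: "K \<ge> 0" unfolding K_def using C by (intro add_nonneg_nonneg sum_nonneg) auto
  have leave: "1 - Q h $ i $ i \<le> K * h" if h: "0 < h" "h \<le> 1" for h i
  proof -
    have "1 - Q h $ i $ i \<le> h * \<Lambda> $ i $ i + C * h\<^sup>2"
      using C(2)[of h i i] h by (simp add: mat_def abs_le_iff)
    also have "\<dots> \<le> h * (\<Sum>i\<in>UNIV. \<bar>\<Lambda> $ i $ i\<bar>) + C * h"
    proof (rule add_mono)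
      have "\<Lambda> $ i $ i \<le> \<bar>\<Lambda> $ i $ i\<bar>" by simp
      also have "\<dots> \<le> (\<Sum>i\<in>UNIV. \<bar>\<Lambda> $ i $ i\<bar>)" by (rule member_le_sum) auto
      finally show "h * \<Lambda> $ i $ i \<le> h * (\<Sum>i\<in>UNIV. \<bar>\<Lambda> $ i $ i\<bar>)" using h by simp
      have "h\<^sup>2 \<le> h" using h by (simp add: power2_eq_square mult_left_le)
      then show "C * h\<^sup>2 \<le> C * h" using C(1) by (rule mult_left_mono)
    qed
    finally show ?thesis by (simp add: K_def algebra_simps)
  qed
  have "measure (P a) {\<omega> \<in> index_paths. \<omega> s \<noteq> \<omega> t} \<le> K * (t - s)"
    if a: "a \<in> prob_simplex" and s: "0 \<le> s" and st: "s \<le> t" "t \<le> s + 1" for a s t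
  proof (cases "s = t")
    case True
    then show ?thesis by simp
  next
    case False
    define h where "h = t - s"
    have h: "0 < h" "h \<le> 1" "t = s + h" using False st by (auto simp: h_def)
    interpret prob_space "P a" by (rule prob_space_P[OF a])
    let ?A = "\<lambda>i. {\<omega> \<in> index_paths. \<omega> s = i}" and ?B = "\<lambda>i. {\<omega> \<in> index_paths. \<omega> s = i \<and> \<omega> (s + h) = i}"
    have A: "?A i \<in> events" for i by (rule sets_eval_eq[OF a s])
    have B: "?B i \<in> events" for i
      using s h by (intro sets_eval_eq2[OF a]) simp_all
    have eq: "{\<omega> \<in> index_paths. \<omega> s \<noteq> \<omega> t} = (\<Union>i\<in>UNIV. ?A i - ?B i)" by (auto simp: h)
    have "prob {\<omega> \<in> index_paths. \<omega> s \<noteq> \<omega> t} \<le> (\<Sum>i\<in>UNIV. prob (?A i - ?B i))"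
      unfolding eq by (rule finite_measure_subadditive_finite) (use A B in auto)
    also have "\<dots> = (\<Sum>i\<in>UNIV. (1 - Q h $ i $ i) * prob (?A i))"
    proof (rule sum.cong)
      fix i
      have "prob (?A i - ?B i) = prob (?A i) - prob (?B i)"
        by (rule finite_measure_Diff) (use A B in auto)
      then show "prob (?A i - ?B i) = (1 - Q h $ i $ i) * prob (?A i)"
        using transition_indicator[OF a s h(1), of i i] by (simp add: algebra_simps)
    qed simp
    also have "\<dots> \<le> (\<Sum>i\<in>UNIV. K * h * prob (?A i))"
      by (intro sum_mono mult_right_mono leave h) simp
    also have "\<dots> = K * h"
      using sum_simplex_mult[OF a s] by (simp add: sum_distrib_left[symmetric] measure_eval[OF a s])
    finally show ?thesis by (simp add: h_def)
  qed
  then show ?thesis using that K by blast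
qed

lemma measurable_jump:
  assumes a: "a \<in> prob_simplex" and r0: "0 \<le> r0"
  shows "(\<lambda>(\<omega>, r). of_bool (\<omega> (max 0 r) \<noteq> \<omega> r0) :: real) \<in> borel_measurable (P a \<Otimes>\<^sub>M borel)"
proof -
  have 1: "(\<lambda>\<omega>r. fst \<omega>r (max 0 (snd \<omega>r))) \<in> P a \<Otimes>\<^sub>M borel \<rightarrow>\<^sub>M (count_space UNIV :: 'm measure)"
    using measurable_index_path a by (simp add: case_prod_beta cong: measurable_cong_sets sets_pair_measure_cong)
  have 2: "(\<lambda>\<omega>r. fst \<omega>r r0) \<in> P a \<Otimes>\<^sub>M borel \<rightarrow>\<^sub>M (count_space UNIV :: 'm measure)"
    by (rule measurable_compose[OF measurable_fst measurable_eval_P[OF a r0]])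
  have "(\<lambda>\<omega>r. of_bool (fst \<omega>r (max 0 (snd \<omega>r)) \<noteq> j) :: real) \<in> borel_measurable (P a \<Otimes>\<^sub>M borel)" for j
    by (rule measurable_compose[OF 1]) simp
  from measurable_compose_countable'[where f="\<lambda>j \<omega>r. of_bool (fst \<omega>r (max 0 (snd \<omega>r)) \<noteq> j) :: real", OF this 2 countable_finite]
  show ?thesis by (simp add: case_prod_beta)
qed

text \<open>By Fubini, each instant contributes a probability of order \<open>h\<close>, and there
  is a time span \<open>h\<close> of them. The reference time \<open>r0\<close> may be either end:
  the initial time when the subsolution inequality is derived, the final time in the
  verification.\<close>

lemma jump_time:
  obtains C where "C \<ge> 0" "\<And>a s r0 h. a \<in> prob_simplex \<Longrightarrow> 0 \<le> s \<Longrightarrow> s \<le> r0 \<Longrightarrow> r0 \<le> s + h \<Longrightarrow> h \<le> 1 \<Longrightarrow>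
      integrable (P a) (\<lambda>\<omega>. LINT r:{s..s + h}|lborel. of_bool (\<omega> r \<noteq> \<omega> r0) :: real) \<and>
      (LINT \<omega>|P a. (LINT r:{s..s + h}|lborel. of_bool (\<omega> r \<noteq> \<omega> r0))) \<le> C * h\<^sup>2"
proof -
  obtain C where C: "C \<ge> 0" "\<And>a s t. a \<in> prob_simplex \<Longrightarrow> 0 \<le> s \<Longrightarrow> s \<le> t \<Longrightarrow> t \<le> s + 1 \<Longrightarrow>
    measure (P a) {\<omega> \<in> index_paths. \<omega> s \<noteq> \<omega> t} \<le> C * (t - s)"
    by (rule jump_probability) blast
  have *: "integrable (P a) (\<lambda>\<omega>. LINT r:{s..s + h}|lborel. of_bool (\<omega> r \<noteq> \<omega> r0) :: real) \<and>
      (LINT \<omega>|P a. (LINT r:{s..s + h}|lborel. of_bool (\<omega> r \<noteq> \<omega> r0))) \<le> C * h\<^sup>2"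
    if a: "a \<in> prob_simplex" and s: "0 \<le> s" and r0: "s \<le> r0" "r0 \<le> s + h" and h: "h \<le> 1" for a s r0 h
  proof -
    interpret prob_space "P a" by (rule prob_space_P[OF a])
    interpret pair_sigma_finite "P a" "lborel :: real measure" ..
    define f where "f \<omega> r = indicator {s..s + h} r * (of_bool (\<omega> (max 0 r) \<noteq> \<omega> r0) :: real)" for \<omega> :: "real \<Rightarrow> 'm" and r
    have r00: "0 \<le> r0" and h0: "0 \<le> h" using s r0 by auto
    have fm: "case_prod f \<in> borel_measurable (P a \<Otimes>\<^sub>M lborel)"
    proof -
      have "(\<lambda>\<omega>r. indicator {s..s + h} (snd \<omega>r) * of_bool (fst \<omega>r (max 0 (snd \<omega>r)) \<noteq> fst \<omega>r r0) :: real) \<in> borel_measurable (P a \<Otimes>\<^sub>M borel)"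
        using measurable_jump[OF a r00] unfolding case_prod_beta
        by (intro borel_measurable_times measurable_compose[OF measurable_snd borel_measurable_indicator]) auto
      then show ?thesis
        unfolding f_def case_prod_beta by (simp cong: measurable_cong_sets sets_pair_measure_cong)
    qed
    have fi: "integrable (P a \<Otimes>\<^sub>M lborel) (case_prod f)"
    proof (rule integrableI_bounded_set[where A="index_paths \<times> {s..s + h}" and B=1])
      have "index_paths \<in> sets (P a)" using sets.top[of "P a"] a by simp
      then show "index_paths \<times> {s..s + h} \<in> sets (P a \<Otimes>\<^sub>M lborel)" by auto
      show "emeasure (P a \<Otimes>\<^sub>M lborel) (index_paths \<times> {s..s + h}) < \<infinity>"
        using \<open>index_paths \<in> sets (P a)\<close> h0
        by (subst lborel.emeasure_pair_measure_Times) (auto simp: emeasure_eq_measure ennreal_mult[symmetric] simp del: ennreal_mult')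
      show "case_prod f \<in> borel_measurable (P a \<Otimes>\<^sub>M lborel)" by (rule fm)
    qed (auto simp: f_def indicator_def space_pair_measure a split: if_splits)
    have fs: "(LINT r:{s..s + h}|lborel. of_bool (\<omega> r \<noteq> \<omega> r0)) = (LINT r|lborel. f \<omega> r)" for \<omega> :: "real \<Rightarrow> 'm"
      unfolding set_lebesgue_integral_def f_def
      by (intro Bochner_Integration.integral_cong) (use s in \<open>auto simp: indicator_def max_def\<close>)
    have "(LINT \<omega>|P a. (LINT r|lborel. f \<omega> r)) = (LINT r|lborel. (LINT \<omega>|P a. f \<omega> r))"
      using Fubini_integral[OF fi] by simp
    also have "\<dots> \<le> (LINT r|lborel. indicator {s..s + h} r * (C * h))"
    proof (rule integral_mono)
      show "integrable lborel (\<lambda>r. LINT \<omega>|P a. f \<omega> r)"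
        using integrable_snd[OF fi] .
      show "integrable lborel (\<lambda>r. indicator {s..s + h} r * (C * h))"
        using h0 by (intro integrable_mult_left integrable_real_indicator) auto
      fix r :: real
      show "(LINT \<omega>|P a. f \<omega> r) \<le> indicator {s..s + h} r * (C * h)"
      proof (cases "r \<in> {s..s + h}")
        case True
        have "(LINT \<omega>|P a. f \<omega> r) = (LINT \<omega>|P a. indicator {\<omega> \<in> index_paths. \<omega> r \<noteq> \<omega> r0} \<omega>)"
          by (intro Bochner_Integration.integral_cong) (use True a s in \<open>auto simp: f_def indicator_def max_def\<close>)
        also have "\<dots> = prob {\<omega> \<in> index_paths. \<omega> r \<noteq> \<omega> r0}"
          by (simp add: a Collect_conj_eq Int_commute)
        also have "\<dots> \<le> C * \<bar>r - r0\<bar>"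
        proof (cases "r \<le> r0")
          case le: True
          then show ?thesis using C(2)[OF a, of r r0] True s r0 h by auto
        next
          case False
          have eq: "{\<omega> \<in> index_paths. \<omega> r \<noteq> \<omega> r0} = {\<omega> \<in> index_paths. \<omega> r0 \<noteq> \<omega> r}" by auto
          have "prob {\<omega> \<in> index_paths. \<omega> r0 \<noteq> \<omega> r} \<le> C * (r - r0)"
            by (rule C(2)[OF a]) (use True s r0 h False in auto)
          then show ?thesis unfolding eq using False by simp
        qed
        also have "\<dots> \<le> C * h" using True r0 C(1) by (intro mult_left_mono) auto
        finally show ?thesis using True by simp
      qed (simp add: f_def)
    qed
    also have "\<dots> = C * h\<^sup>2" using h0 by (simp add: power2_eq_square)
    finally show ?thesis using integrable_fst[OF fi] unfolding fs by auto
  qed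
  show ?thesis by (rule that[OF C(1)]) (rule *)
qed

end

subsection \<open>Dynamic programming\<close>

definition const_path :: "'a \<Rightarrow> real \<Rightarrow> 'a" where
  "const_path c = (\<lambda>s. if 0 \<le> s then c else undefined)"

lemma const_path_in: "const_path c \<in> vector_paths"
  unfolding vector_paths_iff
proof (intro conjI allI impI)
  fix t :: real assume t: "t \<ge> 0"
  have "\<forall>\<^sub>F s in at_right t. const_path c s = const_path c t"
    using eventually_at_right_ge0[OF t] by eventually_elim (use t in \<open>simp add: const_path_def\<close>)
  then show "(const_path c \<longlongrightarrow> const_path c t) (at_right t)" by (rule tendsto_eventually)
next
  fix t :: real assume t: "t > 0"
  have "\<forall>\<^sub>F s in at_left t. const_path c s = c"
    using eventually_at_left_ge0[OF t] by eventually_elim (simp add: const_path_def)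
  then show "\<exists>l. (const_path c \<longlongrightarrow> l) (at_left t)" using tendsto_eventually by blast
qed (auto simp: const_path_def extensional_def)

lemma displacement_const_path: "0 \<le> t \<Longrightarrow> displacement (const_path c) t = t *\<^sub>R c"
proof -
  assume t: "0 \<le> t"
  have "displacement (const_path c) t = (LINT s:{0..t}|lborel. c)"
    unfolding displacement_def by (rule set_integral_cong_Icc) (simp add: const_path_def)
  then show ?thesis using set_integral_const[OF t, of c] by simp
qed

lemma displacement_concat_before:
  assumes "\<xi> \<in> vector_paths" "0 \<le> h" "0 \<le> s" "s \<le> h"
  shows "displacement (concat_path h q \<xi>) s = s *\<^sub>R q"
proof -
  have "displacement (concat_path h q \<xi>) s = displacement (const_path q) s"
    unfolding displacement_def
  proof (rule set_integral_cong_Ico)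
    show "concat_path h q \<xi> r = const_path q r" if "0 \<le> r" "r < s" for r
      using that assms by (simp add: concat_path_def const_path_def)
  qed (intro vector_path_set_integrable concat_path_in const_path_in assms order_refl)+
  then show ?thesis using assms by (simp add: displacement_const_path)
qed

lemma displacement_concat_after:
  assumes x: "\<xi> \<in> vector_paths" and h: "0 \<le> h" and s: "0 \<le> s"
  shows "displacement (concat_path h q \<xi>) (h + s) = h *\<^sub>R q + displacement \<xi> s"
proof -
  have "displacement (concat_path h q \<xi>) (h + s) = h *\<^sub>R q + (LINT r:{h..h + s}|lborel. concat_path h q \<xi> r)"
    using displacement_split[OF concat_path_in[OF x h], of h "h + s"] displacement_concat_before[OF x h h, of q] h s by simp
  also have "(LINT r:{h..h + s}|lborel. concat_path h q \<xi> r) = (LINT r:{h..h + s}|lborel. \<xi> (r - h))"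
    by (rule set_integral_cong_Icc) (use h in \<open>simp add: concat_path_def\<close>)
  also have "\<dots> = displacement \<xi> s" unfolding displacement_def by (rule set_integral_shift)
  finally show ?thesis .
qed

context controlled_system begin

text \<open>After time \<open>h\<close> the cost is that of a fresh start with moved base point and
  shifted index path, which is the form required by the Markov property.\<close>

lemma running_cost_concat:
  assumes w: "\<omega> \<in> index_paths" and x: "\<xi> \<in> vector_paths" and h: "0 \<le> h" and t: "0 \<le> t"
  shows "running_cost \<alpha> z \<omega> (concat_path h q \<xi>) (h + t) =
    running_cost \<alpha> z \<omega> (const_path q) h + running_cost \<alpha> (z + h *\<^sub>R q) (shift_path h \<omega>) \<xi> t"
proof -
  have "running_cost \<alpha> z \<omega> (concat_path h q \<xi>) (h + t) = running_cost \<alpha> z \<omega> (concat_path h q \<xi>) h +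
      (LINT r:{h..h + t}|lborel. rate \<alpha> z \<omega> (concat_path h q \<xi>) r)"
    by (rule running_cost_split[OF w concat_path_in[OF x h] h]) (use t in simp)
  also have "running_cost \<alpha> z \<omega> (concat_path h q \<xi>) h = running_cost \<alpha> z \<omega> (const_path q) h"
    unfolding running_cost_def
  proof (rule set_integral_cong_Ico)
    fix s assume "0 \<le> s" "s < h"
    then show "rate \<alpha> z \<omega> (concat_path h q \<xi>) s = rate \<alpha> z \<omega> (const_path q) s"
      using displacement_concat_before[OF x h, of s q]
      by (simp add: rate_def displacement_const_path) (simp add: concat_path_def const_path_def)
  qed (intro rate_set_integrable w concat_path_in const_path_in x h order_refl)+
  also have "(LINT r:{h..h + t}|lborel. rate \<alpha> z \<omega> (concat_path h q \<xi>) r) =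
      (LINT r:{h..h + t}|lborel. rate \<alpha> (z + h *\<^sub>R q) (shift_path h \<omega>) \<xi> (r - h))"
  proof (rule set_integral_cong_Icc)
    fix r assume "h \<le> r" "r \<le> h + t"
    then show "rate \<alpha> z \<omega> (concat_path h q \<xi>) r = rate \<alpha> (z + h *\<^sub>R q) (shift_path h \<omega>) \<xi> (r - h)"
      using displacement_concat_after[OF x h, of "r - h" q] h
      by (simp add: rate_def add.assoc) (simp add: concat_path_def shift_path_def)
  qed
  also have "\<dots> = running_cost \<alpha> (z + h *\<^sub>R q) (shift_path h \<omega>) \<xi> t"
    unfolding running_cost_def by (rule set_integral_shift)
  finally show ?thesis .
qed

text \<open>The definition of a control does not cover \<open>t = 0\<close>; there, right continuity makes two paths
  with the same initial state agree on a short interval.\<close>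

lemma control_nonanticipating':
  assumes c: "control P \<Xi>" and t: "0 \<le> t" and w: "\<omega> \<in> index_paths" "\<omega>' \<in> index_paths"
    and eq: "\<And>s. 0 \<le> s \<Longrightarrow> s \<le> t \<Longrightarrow> \<omega> s = \<omega>' s"
  shows "\<Xi> \<omega> t = \<Xi> \<omega>' t"
proof (cases "t = 0")
  case True
  have "\<forall>\<^sub>F s in at_right 0. \<omega> s = \<omega> 0" "\<forall>\<^sub>F s in at_right 0. \<omega>' s = \<omega>' 0"
    using w unfolding index_paths_iff by auto
  then have "\<forall>\<^sub>F s in at_right 0. \<omega> s = \<omega>' s"
    by eventually_elim (use eq[of 0] t in simp)
  then obtain d where d: "d > 0" "\<And>s. 0 < s \<Longrightarrow> s < d \<Longrightarrow> \<omega> s = \<omega>' s"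
    unfolding eventually_at_right_field by blast
  have eq': "\<omega> s = \<omega>' s" if "0 \<le> s" "s \<le> d / 2" for s
    using eq[of 0] d that t by (cases "s = 0") auto
  show ?thesis unfolding True
    by (rule control_nonanticipating[OF c order_refl _ _ w, of "d / 2"]) (use d(1) eq' in auto)
next
  case False
  with t show ?thesis by (intro control_nonanticipating[OF c t order_refl _ w] eq) auto
qed

lemma bounded_stopping_time_const: "0 \<le> h \<Longrightarrow> bounded_stopping_time (\<lambda>_ :: real \<Rightarrow> 'm. h)"
  unfolding bounded_stopping_time_def stopping_time_def by auto

lemma control_const: "control P (\<lambda>_. const_path (q :: real^'n))"
proof (rule controlI)
  show "(\<lambda>_. const_path q) \<in> path_algebra \<rightarrow>\<^sub>M eval_algebra euclidean {0..}"
    by (simp add: const_path_in)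
  show "\<exists>R. \<forall>j. AE \<omega> in PI j. \<forall>s. 0 \<le> s \<longrightarrow> s \<le> t \<longrightarrow> norm (const_path q s) \<le> R" for t
    by (intro exI[of _ "norm q"]) (simp add: const_path_def)
qed simp_all

lemma integrable_const_cost:
  assumes "0 \<le> h" shows "integrable (PI i) (\<lambda>\<omega>. running_cost \<alpha> z \<omega> (const_path q) h)"
proof -
  have "total_cost \<alpha> 0 z (\<lambda>_. h) (\<lambda>_. const_path q) = (\<lambda>\<omega>. running_cost \<alpha> z \<omega> (const_path q) h)"
    by (rule ext) (simp add: total_cost_def)
  with integrable_total_cost[OF bounded_stopping_time_const[OF assms] control_const] show ?thesis by metis
qed

lemma const_path_controls_to:
  fixes z q :: "real^'n"
  shows "0 \<le> h \<Longrightarrow> (\<lambda>_. const_path q) \<in> controls_to P (\<lambda>_. h) (torus_proj (z + h *\<^sub>R q) - torus_proj z)"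
  by (simp add: controls_to_def control_const almost_surely_iff torus_primitive_eq displacement_const_path torus_proj_add)

text \<open>The strategy keeps the velocity \<open>q\<close> until \<open>h\<close>, then reads the
  state \<open>\<omega> h\<close> and applies the strategy prepared for that state to the shifted
  path. The cost formula is an equality; inequalities enter only when near-optimal strategies are
  inserted.\<close>

lemma dynamic_programming:
  fixes \<tau> :: "'m \<Rightarrow> (real \<Rightarrow> 'm) \<Rightarrow> real" and \<Xi> :: "'m \<Rightarrow> (real \<Rightarrow> 'm) \<Rightarrow> real \<Rightarrow> real^'n"
  assumes h: "h > 0" and \<tau>: "\<And>j. bounded_stopping_time (\<tau> j)"
    and \<Xi>: "\<And>j. \<Xi> j \<in> controls_to P (\<tau> j) (y - torus_proj (z + h *\<^sub>R q))"
  obtains \<tau>' \<Xi>' where "bounded_stopping_time \<tau>'" "\<Xi>' \<in> controls_to P \<tau>' (y - torus_proj z)"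
    "\<And>i \<alpha> b. cost P L \<alpha> b i (torus_proj z) \<tau>' \<Xi>' = (LINT \<omega>|PI i. running_cost \<alpha> z \<omega> (const_path q) h) +
       (\<Sum>j\<in>UNIV. Q h $ i $ j * cost P L \<alpha> b j (torus_proj (z + h *\<^sub>R q)) (\<tau> j) (\<Xi> j))"
proof -
  have h0: "0 \<le> h" using h by simp
  define \<tau>' where "\<tau>' \<omega> = h + \<tau> (\<omega> h) (shift_path h \<omega>)" for \<omega>
  define \<Xi>' where "\<Xi>' \<omega> = concat_path h q (\<Xi> (\<omega> h) (shift_path h \<omega>))" for \<omega>
  have c: "control P (\<Xi> j)" for j using \<Xi> by (simp add: controls_to_def)
  have "\<exists>T. \<forall>\<omega>\<in>index_paths. 0 \<le> \<tau> j \<omega> \<and> \<tau> j \<omega> \<le> T" for j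
    using \<tau>[of j] by (auto simp: bounded_stopping_time_def)
  then obtain T where T: "\<And>j \<omega>. \<omega> \<in> index_paths \<Longrightarrow> 0 \<le> \<tau> j \<omega> \<and> \<tau> j \<omega> \<le> T j" by metis
  have st: "stopping_time path_filtration \<tau>'"
  proof
    fix t :: real
    show "Measurable.pred (path_filtration t) (\<lambda>\<omega>. \<tau>' \<omega> \<le> t)"
    proof (cases "h \<le> t")
      case True
      \<comment> \<open>The shift by \<open>h\<close> carries information up to time
        \<open>t\<close> to information up to time \<open>t - h\<close>, so the events for the
        shifted stopping times are decided at time \<open>t\<close>. For \<open>t < h\<close> the
        event is empty.\<close>
      have sh: "shift_path h \<in> path_filtration t \<rightarrow>\<^sub>M path_filtration (t - h)"
        by (rule measurable_shift_path[OF h0]) (use h in auto)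
      have "Measurable.pred (path_filtration t) (\<lambda>\<omega>. \<tau> j (shift_path h \<omega>) \<le> t - h)" for j
      proof -
        have "Measurable.pred (path_filtration (t - h)) (\<lambda>\<omega>. \<tau> j \<omega> \<le> t - h)"
          using \<tau>[of j] unfolding bounded_stopping_time_def by (intro stopping_timeD) blast
        from measurable_compose[OF sh this] show ?thesis .
      qed
      moreover have "(\<lambda>\<omega>. \<omega> h) \<in> path_filtration t \<rightarrow>\<^sub>M (count_space UNIV :: 'm measure)"
        by (rule measurable_eval_discrete) (use True h in auto)
      ultimately have "Measurable.pred (path_filtration t) (\<lambda>\<omega>. \<tau> (\<omega> h) (shift_path h \<omega>) \<le> t - h)"
        by (rule measurable_compose_countable'[where f="\<lambda>j \<omega>. \<tau> j (shift_path h \<omega>) \<le> t - h", OF _ _ countable_finite[OF finite]])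
      then show ?thesis by (simp add: \<tau>'_def algebra_simps)
    next
      case False
      have "\<not> \<tau>' \<omega> \<le> t" if "\<omega> \<in> space (path_filtration t)" for \<omega>
        using T[OF shift_path_in[OF _ h0], of \<omega> "\<omega> h"] that False by (auto simp: \<tau>'_def)
      then have "Measurable.pred (path_filtration t) (\<lambda>\<omega>. \<tau>' \<omega> \<le> t) \<longleftrightarrow> Measurable.pred (path_filtration t) (\<lambda>\<omega>. False)"
        by (subst measurable_cong[of _ _ "\<lambda>_. False"]) auto
      then show ?thesis by simp
    qed
  qed
  have bst: "bounded_stopping_time \<tau>'"
    unfolding bounded_stopping_time_def
  proof (intro conjI st exI ballI)
    fix \<omega> :: "real \<Rightarrow> 'm" assume "\<omega> \<in> index_paths"
    then have *: "0 \<le> \<tau> (\<omega> h) (shift_path h \<omega>) \<and> \<tau> (\<omega> h) (shift_path h \<omega>) \<le> T (\<omega> h)"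
      by (intro T shift_path_in h0)
    then show "0 \<le> \<tau>' \<omega>" using h by (simp add: \<tau>'_def)
    have "T (\<omega> h) \<le> Max (range T)" by simp
    with * show "\<tau>' \<omega> \<le> h + Max (range T)" unfolding \<tau>'_def by linarith
  qed
  have shm: "shift_path h \<in> path_algebra \<rightarrow>\<^sub>M path_algebra"
    by (rule measurable_shift_path[OF h0]) (use h in auto)
  have ctl: "control P \<Xi>'"
  proof (rule controlI)
    show "\<Xi>' \<in> path_algebra \<rightarrow>\<^sub>M eval_algebra euclidean {0..}"
    proof (rule measurable_vector_pathsI)
      show "\<Xi>' \<omega> \<in> vector_paths" if "\<omega> \<in> space path_algebra" for \<omega>
        using that unfolding \<Xi>'_def by (intro concat_path_in control_in[OF c] shift_path_in h0) simp
      fix s :: real assume s: "s \<in> {0..}"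
      show "(\<lambda>\<omega>. \<Xi>' \<omega> s) \<in> borel_measurable path_algebra"
      proof (cases "s < h")
        case True
        then show ?thesis using s by (simp add: \<Xi>'_def concat_path_def)
      next
        case False
        have f: "(\<lambda>\<omega>. \<Xi> j (shift_path h \<omega>) (s - h)) \<in> borel_measurable path_algebra" for j
          by (rule measurable_compose[OF measurable_compose[OF shm control_measurable[OF c]] measurable_eval_vector])
            (use False in simp)
        have "(\<lambda>\<omega>. \<omega> h) \<in> path_algebra \<rightarrow>\<^sub>M (count_space UNIV :: 'm measure)"
          by (rule measurable_eval_discrete) (use h in auto)
        from measurable_compose_countable'[where f="\<lambda>j \<omega>. \<Xi> j (shift_path h \<omega>) (s - h)", OF f this countable_finite]
        show ?thesis using False s by (simp add: \<Xi>'_def concat_path_def)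
      qed
    qed
  next
    fix t :: real assume t: "t > 0"
    have "\<exists>R. \<forall>i. AE \<omega> in PI i. \<forall>s. 0 \<le> s \<longrightarrow> s \<le> t \<longrightarrow> norm (\<Xi> j \<omega> s) \<le> R" for j
      by (rule control_bounded[OF c[of j], of t]) (rule exI, rule allI)
    then have "\<forall>j. \<exists>R. \<forall>i. AE \<omega> in PI i. \<forall>s. 0 \<le> s \<longrightarrow> s \<le> t \<longrightarrow> norm (\<Xi> j \<omega> s) \<le> R" ..
    from choice[OF this] obtain R where
      R': "\<forall>j. \<forall>i. AE \<omega> in PI i. \<forall>s. 0 \<le> s \<longrightarrow> s \<le> t \<longrightarrow> norm (\<Xi> j \<omega> s) \<le> R j" ..
    then have R: "AE \<omega> in PI i. \<forall>s. 0 \<le> s \<longrightarrow> s \<le> t \<longrightarrow> norm (\<Xi> j \<omega> s) \<le> R j" for i j by simp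
    \<comment> \<open>Finitely many strategies are combined, so the largest of their bounds works
      for all.\<close>
    define R' where "R' = max (norm q) (Max (range R))"
    have RR: "R j \<le> R'" "norm q \<le> R'" for j by (auto simp: R'_def le_max_iff_disj)
    have "AE \<omega> in PI i. \<forall>s. 0 \<le> s \<longrightarrow> s \<le> t \<longrightarrow> norm (\<Xi>' \<omega> s) \<le> R'" for i
      using AE_shift[where R="\<lambda>j \<omega>. \<forall>s. 0 \<le> s \<longrightarrow> s \<le> t \<longrightarrow> norm (\<Xi> j \<omega> s) \<le> R j", OF axis_in_simplex h0 R]
    proof eventually_elim
      fix \<omega> assume *: "\<forall>s. 0 \<le> s \<longrightarrow> s \<le> t \<longrightarrow> norm (\<Xi> (\<omega> h) (shift_path h \<omega>) s) \<le> R (\<omega> h)"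
      show "\<forall>s. 0 \<le> s \<longrightarrow> s \<le> t \<longrightarrow> norm (\<Xi>' \<omega> s) \<le> R'"
      proof (intro allI impI)
        fix s assume s: "0 \<le> s" "s \<le> t"
        show "norm (\<Xi>' \<omega> s) \<le> R'"
          using *[rule_format, of "s - h"] s RR(1)[of "\<omega> h"] RR(2) h by (cases "s < h") (auto simp: \<Xi>'_def concat_path_def)
      qed
    qed
    then show "\<exists>R. \<forall>j. AE \<omega> in PI j. \<forall>s. 0 \<le> s \<longrightarrow> s \<le> t \<longrightarrow> norm (\<Xi>' \<omega> s) \<le> R" by blast
  next
    fix t :: real and \<omega> \<omega>' :: "real \<Rightarrow> 'm"
    assume t: "t > 0" and w: "\<omega> \<in> index_paths" "\<omega>' \<in> index_paths" and eq: "\<And>s. 0 \<le> s \<Longrightarrow> s \<le> t \<Longrightarrow> \<omega> s = \<omega>' s"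
    show "\<Xi>' \<omega> t = \<Xi>' \<omega>' t"
    proof (cases "t < h")
      case True
      then show ?thesis by (simp add: \<Xi>'_def concat_path_def)
    next
      case False
      have "\<Xi> (\<omega>' h) (shift_path h \<omega>) (t - h) = \<Xi> (\<omega>' h) (shift_path h \<omega>') (t - h)"
      proof (rule control_nonanticipating'[OF c])
        show "shift_path h \<omega> s = shift_path h \<omega>' s" if "0 \<le> s" "s \<le> t - h" for s
          using that eq[of "h + s"] h0 by (simp add: shift_path_def)
      qed (use False in \<open>auto intro!: shift_path_in w h0\<close>)
      moreover have "\<omega> h = \<omega>' h" using eq[of h] False h by simp
      ultimately show ?thesis using False by (simp add: \<Xi>'_def concat_path_def)
    qed
  next
    fix \<omega> \<omega>' :: "real \<Rightarrow> 'm"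
    show "\<Xi>' \<omega> 0 = \<Xi>' \<omega>' 0" using h by (simp add: \<Xi>'_def concat_path_def)
  qed
  have vp: "\<Xi> j (shift_path h \<omega>) \<in> vector_paths" if "\<omega> \<in> index_paths" for j \<omega>
    using that by (intro control_in[OF c] shift_path_in h0)
  have "AE \<omega> in PI i. torus_primitive (\<Xi>' \<omega>) (\<tau>' \<omega>) = y - torus_proj z" for i
  proof -
    have "AE \<omega> in PI k. torus_primitive (\<Xi> j \<omega>) (\<tau> j \<omega>) = y - torus_proj (z + h *\<^sub>R q)" for j k
      using \<Xi>[of j] by (simp add: controls_to_def almost_surely_iff)
    from AE_shift[where R="\<lambda>j \<omega>. torus_primitive (\<Xi> j \<omega>) (\<tau> j \<omega>) = y - torus_proj (z + h *\<^sub>R q)", OF axis_in_simplex h0 this]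
    show ?thesis using AE_space[of "PI i"]
    proof eventually_elim
      fix \<omega> assume *: "torus_primitive (\<Xi> (\<omega> h) (shift_path h \<omega>)) (\<tau> (\<omega> h) (shift_path h \<omega>)) = y - torus_proj (z + h *\<^sub>R q)"
        and "\<omega> \<in> space (PI i)"
      then have w: "\<omega> \<in> index_paths" by simp
      have "torus_primitive (\<Xi>' \<omega>) (\<tau>' \<omega>) = torus_proj (h *\<^sub>R q) + torus_primitive (\<Xi> (\<omega> h) (shift_path h \<omega>)) (\<tau> (\<omega> h) (shift_path h \<omega>))"
        using T[OF shift_path_in[OF w h0], of "\<omega> h"]
        unfolding torus_primitive_eq \<Xi>'_def \<tau>'_def
        by (simp add: displacement_concat_after[OF vp[OF w] h0] torus_proj_add)
      then show "torus_primitive (\<Xi>' \<omega>) (\<tau>' \<omega>) = y - torus_proj z"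
        unfolding * by (simp add: torus_proj_add)
    qed
  qed
  then have ct: "\<Xi>' \<in> controls_to P \<tau>' (y - torus_proj z)"
    using ctl by (simp add: controls_to_def almost_surely_iff)
  have "cost P L \<alpha> b i (torus_proj z) \<tau>' \<Xi>' = (LINT \<omega>|PI i. running_cost \<alpha> z \<omega> (const_path q) h) +
       (\<Sum>j\<in>UNIV. Q h $ i $ j * cost P L \<alpha> b j (torus_proj (z + h *\<^sub>R q)) (\<tau> j) (\<Xi> j))" for i \<alpha> b
  proof -
    interpret prob_space "PI i" by (rule prob_space_P[OF axis_in_simplex])
    define rc where "rc \<omega> = running_cost \<alpha> z \<omega> (const_path q) h" for \<omega>
    define G where "G j = total_cost \<alpha> b (z + h *\<^sub>R q) (\<tau> j) (\<Xi> j)" for j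
    have tot: "total_cost \<alpha> b z \<tau>' \<Xi>' \<omega> = rc \<omega> + G (\<omega> h) (shift_path h \<omega>)" if w: "\<omega> \<in> index_paths" for \<omega>
      using T[OF shift_path_in[OF w h0], of "\<omega> h"] h
      unfolding total_cost_def rc_def G_def \<Xi>'_def \<tau>'_def
      by (simp add: running_cost_concat[OF w vp[OF w] h0]) (simp add: shift_path_def)
    have it: "integrable (PI i) (total_cost \<alpha> b z \<tau>' \<Xi>')" by (rule integrable_total_cost[OF bst ctl])
    have irc: "integrable (PI i) rc" unfolding rc_def by (rule integrable_const_cost[OF h0])
    \<comment> \<open>On index paths this difference depends only on the state at \<open>h\<close>
      and the shifted path. As a difference of integrable functions it is integrable, which
      justifies splitting its expectation over the states.\<close>
    define D where "D \<omega> = total_cost \<alpha> b z \<tau>' \<Xi>' \<omega> - rc \<omega>" for \<omega>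
    have iD: "integrable (PI i) D" unfolding D_def by (intro Bochner_Integration.integrable_diff it irc)
    let ?A = "\<lambda>j. {\<omega> \<in> index_paths. \<omega> h = j}"
    have "(LINT \<omega>|PI i. D \<omega>) = (LINT \<omega>|PI i. (\<Sum>j\<in>UNIV. indicator (?A j) \<omega> * D \<omega>))"
    proof (intro Bochner_Integration.integral_cong)
      fix \<omega> assume "\<omega> \<in> space (PI i)"
      then have "(\<Sum>j\<in>UNIV. indicator (?A j) \<omega> * D \<omega>) = (\<Sum>j\<in>UNIV. (if \<omega> h = j then 1 else 0) * D \<omega>)"
        by (intro sum.cong) (auto simp: indicator_def)
      then show "D \<omega> = (\<Sum>j\<in>UNIV. indicator (?A j) \<omega> * D \<omega>)" by (simp add: sum_distrib_right[symmetric])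
    qed simp
    also have "\<dots> = (\<Sum>j\<in>UNIV. LINT \<omega>|PI i. indicator (?A j) \<omega> * D \<omega>)"
    proof (rule Bochner_Integration.integral_sum)
      show "integrable (PI i) (\<lambda>\<omega>. indicator (?A j) \<omega> * D \<omega>)" for j
        using integrable_mult_indicator[OF sets_eval_eq[OF axis_in_simplex h0] iD] by simp
    qed
    also have "\<dots> = (\<Sum>j\<in>UNIV. Q h $ i $ j * cost P L \<alpha> b j (torus_proj (z + h *\<^sub>R q)) (\<tau> j) (\<Xi> j))"
    proof (rule sum.cong)
      fix j
      have "(LINT \<omega>|PI i. indicator (?A j) \<omega> * D \<omega>) = (LINT \<omega>|PI i. indicator (?A j) \<omega> * G j (shift_path h \<omega>))"
        by (intro Bochner_Integration.integral_cong) (auto simp: indicator_def D_def tot)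
      also have "\<dots> = Q h $ i $ j * (LINT \<omega>|PI j. G j \<omega>)"
        using integral_shift[OF axis_in_simplex h0 measurable_total_cost[OF \<tau> c], of i j]
        unfolding G_def axis_vector_matrix_mult by simp
      finally show "(LINT \<omega>|PI i. indicator (?A j) \<omega> * D \<omega>) = Q h $ i $ j * cost P L \<alpha> b j (torus_proj (z + h *\<^sub>R q)) (\<tau> j) (\<Xi> j)"
        unfolding cost_total G_def .
    qed simp
    finally have "(LINT \<omega>|PI i. D \<omega>) = (\<Sum>j\<in>UNIV. Q h $ i $ j * cost P L \<alpha> b j (torus_proj (z + h *\<^sub>R q)) (\<tau> j) (\<Xi> j))" .
    then show ?thesis
      unfolding cost_total D_def rc_def[symmetric] using Bochner_Integration.integral_diff[OF it irc] by simp
  qed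
  from that[OF bst ct this] show ?thesis .
qed

subsection \<open>The subsolution property\<close>

text \<open>As long as the index is still \<open>i\<close> the bound \<open>c\<close> applies.
  Elsewhere the cost is off by at most \<open>2 * C\<close>, and the expected time spent elsewhere
  is of order \<open>h\<^sup>2\<close>.\<close>

lemma expected_const_cost_le:
  obtains K where "K \<ge> 0" "\<And>h i z. 0 < h \<Longrightarrow> h \<le> 1 \<Longrightarrow>
    (\<And>s. 0 \<le> s \<Longrightarrow> s \<le> h \<Longrightarrow> L i (torus_proj (z + s *\<^sub>R q)) (- q) \<le> c) \<Longrightarrow>
    (LINT \<omega>|PI i. running_cost \<alpha> z \<omega> (const_path q) h) \<le> h * (c + \<alpha>) + K * h\<^sup>2"
proof -
  obtain C where C: "C \<ge> 0" "\<And>i x p. norm p \<le> norm q \<Longrightarrow> \<bar>L i x p\<bar> \<le> C" by (rule L_bounded[of "norm q"]) blast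
  obtain J where J: "J \<ge> 0" "\<And>a s r0 h. a \<in> prob_simplex \<Longrightarrow> 0 \<le> s \<Longrightarrow> s \<le> r0 \<Longrightarrow> r0 \<le> s + h \<Longrightarrow> h \<le> 1 \<Longrightarrow>
      integrable (P a) (\<lambda>\<omega>. LINT r:{s..s + h}|lborel. of_bool (\<omega> r \<noteq> \<omega> r0) :: real) \<and>
      (LINT \<omega>|P a. (LINT r:{s..s + h}|lborel. of_bool (\<omega> r \<noteq> \<omega> r0))) \<le> J * h\<^sup>2"
    by (rule jump_time) blast
  have "(LINT \<omega>|PI i. running_cost \<alpha> z \<omega> (const_path q) h) \<le> h * (c + \<alpha>) + 2 * C * J * h\<^sup>2"
    if h: "0 < h" "h \<le> 1" and c: "\<And>s. 0 \<le> s \<Longrightarrow> s \<le> h \<Longrightarrow> L i (torus_proj (z + s *\<^sub>R q)) (- q) \<le> c" for h i z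
  proof -
    interpret prob_space "PI i" by (rule prob_space_P[OF axis_in_simplex])
    define S where "S \<omega> = (LINT r:{0..0 + h}|lborel. of_bool (\<omega> r \<noteq> \<omega> 0) :: real)" for \<omega> :: "real \<Rightarrow> 'm"
    have S: "integrable (PI i) S" "(LINT \<omega>|PI i. S \<omega>) \<le> J * h\<^sup>2"
      unfolding S_def using J(2)[OF axis_in_simplex, of 0 0 h i] h by auto
    \<comment> \<open>Consequently \<open>C \<le> c + 2 * C\<close>, which covers the instants at
      which the index has changed.\<close>
    have c0: "- C \<le> c" using c[of 0] C(2)[of "-q" i "torus_proj z"] h by (simp add: abs_le_iff)
    have ir: "integrable (PI i) (\<lambda>\<omega>. running_cost \<alpha> z \<omega> (const_path q) h)"
      using h by (intro integrable_const_cost) simp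
    have "(LINT \<omega>|PI i. running_cost \<alpha> z \<omega> (const_path q) h) \<le> (LINT \<omega>|PI i. h * (c + \<alpha>) + 2 * C * S \<omega>)"
    proof (rule integral_mono_AE)
      show "AE \<omega> in PI i. running_cost \<alpha> z \<omega> (const_path q) h \<le> h * (c + \<alpha>) + 2 * C * S \<omega>"
        using AE_initial_state[of i] AE_space
      proof eventually_elim
        fix \<omega> assume w0: "\<omega> 0 = i" and "\<omega> \<in> space (PI i)"
        then have w: "\<omega> \<in> index_paths" by simp
        have si: "set_integrable lborel {0..h} (\<lambda>r. of_bool (\<omega> r \<noteq> \<omega> 0) :: real)"
        proof (rule set_integrable_bounded[where B=1])
          have "(\<lambda>r. (\<omega>, r)) \<in> borel \<rightarrow>\<^sub>M PI i \<Otimes>\<^sub>M borel" using w by (intro measurable_Pair1') simp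
          from measurable_compose[OF this measurable_jump[OF axis_in_simplex order_refl]]
          show "(\<lambda>s. of_bool (\<omega> (max 0 s) \<noteq> \<omega> 0) :: real) \<in> borel_measurable borel" by simp
        qed auto
        have si1: "set_integrable lborel {0..h} (\<lambda>r. c + \<alpha>)" by (intro borel_integrable_atLeastAtMost' continuous_on_const)
        have si2: "set_integrable lborel {0..h} (\<lambda>r. 2 * C * of_bool (\<omega> r \<noteq> \<omega> 0))"
          by (intro set_integrable_mult_right) (rule si)
        have "running_cost \<alpha> z \<omega> (const_path q) h \<le> (LINT r:{0..h}|lborel. (c + \<alpha>) + 2 * C * of_bool (\<omega> r \<noteq> \<omega> 0))"
          unfolding running_cost_def
        proof (rule set_integral_mono)
          show "set_integrable lborel {0..h} (rate \<alpha> z \<omega> (const_path q))"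
            by (intro rate_set_integrable w const_path_in order_refl)
          show "set_integrable lborel {0..h} (\<lambda>r. (c + \<alpha>) + 2 * C * of_bool (\<omega> r \<noteq> \<omega> 0))"
            by (rule set_integral_add(1)[OF si1 si2])
          fix r assume r: "r \<in> {0..h}"
          show "rate \<alpha> z \<omega> (const_path q) r \<le> (c + \<alpha>) + 2 * C * of_bool (\<omega> r \<noteq> \<omega> 0)"
          proof (cases "\<omega> r = \<omega> 0")
            case True
            then show ?thesis using c[of r] r w0
              by (simp add: rate_def displacement_const_path) (simp add: const_path_def)
          next
            case False
            have "\<bar>L (\<omega> r) (torus_proj (z + displacement (const_path q) r)) (- const_path q r)\<bar> \<le> C"
              using r by (intro C(2)) (simp add: const_path_def)
            with False c0 show ?thesis by (simp add: rate_def abs_le_iff)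
          qed
        qed
        also have "\<dots> = h * (c + \<alpha>) + 2 * C * S \<omega>"
          using h unfolding S_def
          by (subst set_integral_add(2)[OF si1 si2]) (simp add: set_integral_const)
        finally show "running_cost \<alpha> z \<omega> (const_path q) h \<le> h * (c + \<alpha>) + 2 * C * S \<omega>" .
      qed
    qed (use ir S(1) in auto)
    also have "\<dots> = h * (c + \<alpha>) + 2 * C * (LINT \<omega>|PI i. S \<omega>)"
      using S(1) prob_space by (subst Bochner_Integration.integral_add) auto
    also have "\<dots> \<le> h * (c + \<alpha>) + 2 * C * (J * h\<^sup>2)"
      using S(2) C(1) by (intro add_left_mono mult_left_mono) auto
    finally show ?thesis by (simp add: mult.assoc)
  qed
  moreover have "2 * C * J \<ge> 0" using C J by simp
  ultimately show ?thesis using that by blast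
qed

text \<open>Only boundedness and the dynamic programming inequality enter, so continuity has to be
  produced here as well. Unit speeds give a Lipschitz estimate; the viscosity inequality then comes
  from dividing by \<open>h\<close> at a point of maximum.\<close>

lemma dpi_subsolution:
  fixes v :: "'n torus \<Rightarrow> real^'m"
  assumes B: "\<And>x i. \<bar>v x $ i\<bar> \<le> B"
    and dpi: "\<And>z q h i. 0 < h \<Longrightarrow> h \<le> 1 \<Longrightarrow> v (torus_proj z) $ i \<le>
      (LINT \<omega>|PI i. running_cost \<alpha> z \<omega> (const_path q) h) + (\<Sum>j\<in>UNIV. Q h $ i $ j * v (torus_proj (z + h *\<^sub>R q)) $ j)"
  shows "subsolution H \<Lambda> \<alpha> v"
proof -
  have B0: "B \<ge> 0" using B[of undefined undefined] by (simp add: order_trans[OF abs_ge_zero])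
  obtain C where C: "C \<ge> 0" "\<And>h B w i. 0 \<le> h \<Longrightarrow> h \<le> 1 \<Longrightarrow> (\<And>j. \<bar>w j\<bar> \<le> B) \<Longrightarrow>
      \<bar>(\<Sum>j\<in>UNIV. Q h $ i $ j * w j) - (w i - h * (\<Sum>j\<in>UNIV. \<Lambda> $ i $ j * w j))\<bar> \<le> C * B * h\<^sup>2"
    by (rule Q_sum_expansion) blast
  define M where "M = C * B"
  have M: "M \<ge> 0" using B0 C by (simp add: M_def)
  have expand: "(\<Sum>j\<in>UNIV. Q h $ i $ j * w $ j) \<le> w $ i - h * (\<Sum>j\<in>UNIV. \<Lambda> $ i $ j * w $ j) + M * h\<^sup>2"
    if h: "0 < h" "h \<le> 1" and w: "\<And>j. \<bar>w $ j\<bar> \<le> B" for h i w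
    using C(2)[of h "\<lambda>j. w $ j" B i] h w by (simp add: M_def abs_le_iff)
  define K where "K = (\<Sum>i\<in>UNIV. \<Sum>j\<in>UNIV. \<bar>\<Lambda> $ i $ j\<bar>) * B"
  have rowsB: "\<bar>\<Sum>j\<in>UNIV. \<Lambda> $ i $ j * w $ j\<bar> \<le> K" if w: "\<And>j. \<bar>w $ j\<bar> \<le> B" for i w
    unfolding K_def by (rule matrix_row_bound[OF w])
  obtain C1 where C1: "C1 \<ge> 0" "\<And>z \<omega> \<xi> s. norm (\<xi> s) \<le> 1 \<Longrightarrow> \<bar>rate \<alpha> z \<omega> \<xi> s\<bar> \<le> C1"
    by (rule rate_bounded[where R=1 and \<alpha>=\<alpha>]) blast
  define D where "D = C1 + K + M"
  have lip1: "v (torus_proj z) $ i \<le> v (torus_proj (z + w)) $ i + D * norm w"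
    if w: "norm w \<le> 1" for z w i
  proof (cases "w = 0")
    case False
    \<comment> \<open>Unit speed makes the duration equal to the distance, so every error of order
      \<open>h\<close> becomes a Lipschitz error.\<close>
    define h q where "h = norm w" and "q = w /\<^sub>R norm w"
    have h: "0 < h" "h \<le> 1" and q: "norm q = 1" and w_eq: "h *\<^sub>R q = w"
      using False w by (auto simp: h_def q_def)
    interpret prob_space "PI i" by (rule prob_space_P[OF axis_in_simplex])
    have rc: "\<bar>running_cost \<alpha> z \<omega> (const_path q) h\<bar> \<le> C1 * h" for \<omega>
      by (rule running_cost_bound[OF _ _ C1]) (use h q in \<open>auto simp: const_path_def\<close>)
    have "(LINT \<omega>|PI i. running_cost \<alpha> z \<omega> (const_path q) h) \<le> (LINT \<omega>|PI i. C1 * h)"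
      using rc h C1(1) by (intro integral_mono') (auto simp: abs_le_iff)
    then have "(LINT \<omega>|PI i. running_cost \<alpha> z \<omega> (const_path q) h) \<le> C1 * h" using prob_space by simp
    moreover have "(\<Sum>j\<in>UNIV. Q h $ i $ j * v (torus_proj (z + w)) $ j) \<le> v (torus_proj (z + w)) $ i + K * h + M * h"
    proof -
      have "h * (\<Sum>j\<in>UNIV. \<Lambda> $ i $ j * v (torus_proj (z + w)) $ j) \<ge> h * (- K)"
        using rowsB[of "v (torus_proj (z + w))" i] B h by (intro mult_left_mono) (auto simp: abs_le_iff)
      moreover have "M * h\<^sup>2 \<le> M * h" using h M by (intro mult_left_mono) (auto simp: power2_eq_square mult_left_le)
      ultimately show ?thesis using expand[OF h, of "v (torus_proj (z + w))" i] B by (simp add: algebra_simps)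
    qed
    ultimately show ?thesis
      using dpi[OF h, of z i q] unfolding w_eq D_def h_def[symmetric] by (simp add: algebra_simps)
  qed (simp add: D_def)
  \<comment> \<open>The reverse inequality is the same one started at \<open>z + w\<close> with
    displacement \<open>- w\<close>.\<close>
  have lip: "\<bar>v (torus_proj (z + w)) $ i - v (torus_proj z) $ i\<bar> \<le> D * norm w" if "norm w \<le> 1" for z w i
    using lip1[OF that, of z i] lip1[of "-w" "z + w" i] that by (simp add: abs_le_iff)
  have D0: "D \<ge> 0"
  proof -
    have "K \<ge> 0" unfolding K_def using B0 by (intro mult_nonneg_nonneg sum_nonneg) auto
    then show ?thesis using C1(1) M by (simp add: D_def)
  qed
  have cont: "(\<lambda>w. v (torus_proj (z + w))) \<midarrow>0\<rightarrow> v (torus_proj z)" for z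
  proof (rule vec_tendstoI)
    fix i
    have "(\<lambda>w. v (torus_proj (z + w)) $ i - v (torus_proj z) $ i) \<midarrow>0\<rightarrow> 0"
    proof (rule Lim_null_comparison)
      show "\<forall>\<^sub>F w in at 0. norm (v (torus_proj (z + w)) $ i - v (torus_proj z) $ i) \<le> D * norm w"
        unfolding eventually_at by (intro exI[of _ 1]) (use lip in auto)
      have "(\<lambda>w::real^'n. D * norm w) \<midarrow>0\<rightarrow> D * norm (0::real^'n)" by (intro tendsto_intros)
      then show "(\<lambda>w::real^'n. D * norm w) \<midarrow>0\<rightarrow> 0" by simp
    qed
    then show "(\<lambda>w. v (torus_proj (z + w)) $ i) \<midarrow>0\<rightarrow> v (torus_proj z) $ i" using Lim_null by blast
  qed
  have "continuous_on UNIV v"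
  proof (rule continuous_on_torusI)
    show "continuous_on UNIV (\<lambda>z. v (torus_proj z))"
      unfolding continuous_on_def using cont by (simp add: LIM_offset_zero_iff)
  qed
  moreover have "H i x (g x) + \<Lambda> $ i \<bullet> v x \<le> \<alpha>"
    if g: "C1_gradient \<psi> g" and mx: "\<And>z. v z $ i - \<psi> z \<le> v x $ i - \<psi> x" for x i \<psi> g
  proof (rule field_le_epsilon)
    fix e :: real assume e: "e > 0"
    obtain z where z: "x = torus_proj z" using torus_surj by blast
    define p where "p = g x"
    have "e / 2 > 0" using e by simp
    then obtain q0 where q0: "H i x p + L i x q0 \<le> p \<bullet> q0 + e / 2" by (rule approximate_subgradient)
    \<comment> \<open>The cost evaluates the Lagrangian at minus the velocity.\<close>
    define q where "q = - q0"
    define c where "c = L i x q0 + e / 2"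
    obtain d where d: "d > 0"
      "\<And>i z z' p. dist z z' < d \<Longrightarrow> norm p \<le> norm q0 \<Longrightarrow> \<bar>L i (torus_proj z) p - L i (torus_proj z') p\<bar> < e / 2"
      using L_uniformly_continuous[OF \<open>e / 2 > 0\<close>, of "norm q0"] by blast
    obtain K' where K': "K' \<ge> 0" "\<And>h i z. 0 < h \<Longrightarrow> h \<le> 1 \<Longrightarrow>
      (\<And>s. 0 \<le> s \<Longrightarrow> s \<le> h \<Longrightarrow> L i (torus_proj (z + s *\<^sub>R q)) (- q) \<le> c) \<Longrightarrow>
      (LINT \<omega>|PI i. running_cost \<alpha> z \<omega> (const_path q) h) \<le> h * (c + \<alpha>) + K' * h\<^sup>2"
      by (rule expected_const_cost_le[where q=q and c=c and \<alpha>=\<alpha>]) blast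
    \<comment> \<open>The dynamic programming inequality, with increments of \<open>v\<close> in the
      component \<open>i\<close> replaced by those of \<open>\<psi>\<close> at the maximum, divided
      by \<open>h\<close>. Its limit at 0 is the viscosity inequality up to the error in the
      subgradient.\<close>
    define F where "F h = (c + \<alpha>) + K' * h + ((\<psi> (torus_proj (z + h *\<^sub>R q)) - \<psi> (torus_proj z)) / h)
      - (\<Sum>j\<in>UNIV. \<Lambda> $ i $ j * v (torus_proj (z + h *\<^sub>R q)) $ j) + M * h" for h
    \<comment> \<open>Within this time the straight motion stays in the ball where the Lagrangian
      varies by less than \<open>e / 2\<close>; adding 1 to the speed covers
      \<open>q = 0\<close>.\<close>
    define d' where "d' = min 1 (d / (norm q + 1))"
    have d': "d' > 0" using d(1) by (simp add: d'_def add_nonneg_pos)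
    have F: "0 \<le> F h" if h: "0 < h" "h < d'" for h
    proof -
      have h1: "0 < h" "h \<le> 1" using h by (auto simp: d'_def)
      have "L i (torus_proj (z + s *\<^sub>R q)) (- q) \<le> c" if s: "0 \<le> s" "s \<le> h" for s
      proof -
        have "s * norm q \<le> h * (norm q + 1)" using s by (intro mult_mono) auto
        also have "\<dots> < d" using h(2) by (simp add: d'_def pos_less_divide_eq add_nonneg_pos)
        finally have "dist (z + s *\<^sub>R q) z < d" using s by (simp add: dist_norm)
        from d(2)[OF this order_refl, of i] show ?thesis unfolding q_def c_def z minus_minus by linarith
      qed
      then have 1: "(LINT \<omega>|PI i. running_cost \<alpha> z \<omega> (const_path q) h) \<le> h * (c + \<alpha>) + K' * h\<^sup>2"
        by (rule K'(2)[OF h1])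
      let ?w = "v (torus_proj (z + h *\<^sub>R q))"
      have "?w $ i \<le> v x $ i + (\<psi> (torus_proj (z + h *\<^sub>R q)) - \<psi> (torus_proj z))"
        using mx[of "torus_proj (z + h *\<^sub>R q)"] by (simp add: z)
      then have "0 \<le> h * (c + \<alpha>) + K' * h\<^sup>2 + (\<psi> (torus_proj (z + h *\<^sub>R q)) - \<psi> (torus_proj z))
          - h * (\<Sum>j\<in>UNIV. \<Lambda> $ i $ j * ?w $ j) + M * h\<^sup>2"
        using dpi[OF h1, of z i q] 1 expand[OF h1, of ?w i] B unfolding z by simp
      also have "\<dots> = h * F h" using h1 by (simp add: F_def power2_eq_square field_simps)
      finally show ?thesis using h1 by (simp add: zero_le_mult_iff)
    qed
    have lim0: "((\<lambda>h. h) \<longlongrightarrow> 0) (at_right (0::real))" by (rule tendsto_ident_at)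
    have "((\<lambda>w. \<psi> (torus_proj w)) has_derivative (\<lambda>w. w \<bullet> p)) (at z)"
      using g unfolding C1_gradient_def gderiv_def p_def z by blast
    then have "((\<lambda>w. \<psi> (torus_proj w)) has_derivative (\<lambda>w. w \<bullet> p)) (at (z + 0 *\<^sub>R q))" by simp
    moreover have "((\<lambda>h. z + h *\<^sub>R q) has_derivative (\<lambda>h. h *\<^sub>R q)) (at 0)"
      by (auto intro!: derivative_eq_intros)
    ultimately have "((\<lambda>h. \<psi> (torus_proj (z + h *\<^sub>R q))) has_derivative (\<lambda>h. (h *\<^sub>R q) \<bullet> p)) (at 0)"
      by (rule has_derivative_compose[rotated])
    then have "((\<lambda>h. \<psi> (torus_proj (z + h *\<^sub>R q))) has_field_derivative q \<bullet> p) (at 0)"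
      unfolding has_field_derivative_def by (simp add: mult.commute[of _ "q \<bullet> p"] mult_commute_abs)
    then have "((\<lambda>h. (\<psi> (torus_proj (z + h *\<^sub>R q)) - \<psi> (torus_proj z)) / h) \<longlongrightarrow> q \<bullet> p) (at 0)"
      unfolding DERIV_def by simp
    then have l1: "((\<lambda>h. (\<psi> (torus_proj (z + h *\<^sub>R q)) - \<psi> (torus_proj z)) / h) \<longlongrightarrow> q \<bullet> p) (at_right 0)"
      by (rule filterlim_mono) (auto intro: at_le)
    have l2: "((\<lambda>h. v (torus_proj (z + h *\<^sub>R q))) \<longlongrightarrow> v x) (at_right 0)"
    proof -
      have lim': "((\<lambda>h. h *\<^sub>R q) \<longlongrightarrow> 0) (at_right 0)"
        using tendsto_scaleR[OF lim0 tendsto_const, of q] by simp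
      have "isCont (\<lambda>w. v (torus_proj (z + w))) 0" unfolding isCont_def using cont[of z] by simp
      from isCont_tendsto_compose[OF this lim'] show ?thesis by (simp add: z)
    qed
    have "(F \<longlongrightarrow> (c + \<alpha>) + K' * 0 + q \<bullet> p - (\<Sum>j\<in>UNIV. \<Lambda> $ i $ j * v x $ j) + M * 0) (at_right 0)"
      unfolding F_def by (intro tendsto_intros lim0 l1 l2)
    moreover have "\<forall>\<^sub>F h in at_right 0. 0 \<le> F h"
      by (rule eventually_at_rightI[of 0 d']) (use F d' in auto)
    ultimately have "0 \<le> (c + \<alpha>) + K' * 0 + q \<bullet> p - (\<Sum>j\<in>UNIV. \<Lambda> $ i $ j * v x $ j) + M * 0"
      by (rule tendsto_lowerbound) simp
    moreover have "(\<Sum>j\<in>UNIV. \<Lambda> $ i $ j * v x $ j) = \<Lambda> $ i \<bullet> v x" by (simp add: inner_vec_def)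
    ultimately show "H i x (g x) + \<Lambda> $ i \<bullet> v x \<le> \<alpha> + e"
      using q0 unfolding c_def q_def p_def[symmetric] by (simp add: inner_commute)
  qed
  ultimately show ?thesis unfolding subsolution_def by blast
qed

text \<open>The assumed lower bound and an explicit constant motion put the infimum between two
  uniform bounds. It is then a real number with near-optimal strategies for each index, which are
  fed into dynamic programming; their excess \<open>e\<close> survives averaging because the
  transition weights add up to 1.\<close>

lemma value_fun_subsolution:
  assumes lower: "\<And>i z \<tau> \<Xi>. bounded_stopping_time \<tau> \<Longrightarrow> \<Xi> \<in> controls_to P \<tau> (torus_proj y - torus_proj z) \<Longrightarrow>
      - B \<le> cost P L \<alpha> b i (torus_proj z) \<tau> \<Xi>"
  shows "\<exists>v. (\<forall>i x. value_fun P L \<alpha> b y i x = ereal (v x $ i)) \<and> subsolution H \<Lambda> \<alpha> v"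
proof -
  define S where "S i x = {cost P L \<alpha> b i x \<tau> \<Xi> | \<tau> \<Xi>. bounded_stopping_time \<tau> \<and> \<Xi> \<in> controls_to P \<tau> (torus_proj y - x)}" for i x
  have low: "- B \<le> c" if "c \<in> S i x" for c i x
  proof -
    obtain z where "x = torus_proj z" using torus_surj by blast
    with that lower show ?thesis by (auto simp: S_def)
  qed
  then have bdd: "bdd_below (S i x)" for i x by (intro bdd_belowI) blast
  define R where "R = norm y + real CARD('n)"
  obtain C where C: "C \<ge> 0" "\<And>z \<omega> \<xi> s. norm (\<xi> s) \<le> R \<Longrightarrow> \<bar>rate \<alpha> z \<omega> \<xi> s\<bar> \<le> C"
    by (rule rate_bounded[where R=R and \<alpha>=\<alpha>]) blast
  have up: "\<exists>c\<in>S i x. c \<le> C + norm b" for i x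
  proof -
    interpret prob_space "PI i" by (rule prob_space_P[OF axis_in_simplex])
    obtain z0 where "x = torus_proj z0" using torus_surj by blast
    \<comment> \<open>A representative in the unit cube keeps the velocity \<open>y - z\<close> of
      the motion reaching the target at time 1 bounded uniformly in the starting point.\<close>
    then obtain z where z: "x = torus_proj z" "norm z \<le> real CARD('n)"
      using norm_cbox01[OF frac_vec_in_cbox, of z0] by (metis torus_proj_frac_vec)
    let ?\<Xi> = "\<lambda>_ :: real \<Rightarrow> 'm. const_path (y - z)"
    have nq: "norm (y - z) \<le> R" using norm_triangle_ineq4[of y z] z(2) by (simp add: R_def)
    have b1: "bounded_stopping_time (\<lambda>_ :: real \<Rightarrow> 'm. 1)" by (rule bounded_stopping_time_const) simp
    have "?\<Xi> \<in> controls_to P (\<lambda>_. 1) (torus_proj y - x)"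
      using const_path_controls_to[of 1 "y - z" z] by (simp add: z)
    with b1 have "cost P L \<alpha> b i x (\<lambda>_. 1) ?\<Xi> \<in> S i x" unfolding S_def by blast
    moreover have "cost P L \<alpha> b i x (\<lambda>_. 1) ?\<Xi> \<le> C + norm b"
    proof -
      have "cost P L \<alpha> b i x (\<lambda>_. 1) ?\<Xi> \<le> (LINT \<omega>|PI i. C + norm b)"
        unfolding z(1) cost_total
      proof (rule integral_mono')
        fix \<omega>
        have "\<bar>running_cost \<alpha> z \<omega> (const_path (y - z)) 1\<bar> \<le> C * 1"
          by (rule running_cost_bound[OF _ _ C]) (use nq in \<open>auto simp: const_path_def\<close>)
        then show "total_cost \<alpha> b z (\<lambda>_. 1) ?\<Xi> \<omega> \<le> C + norm b"
          unfolding total_cost_def using component_le_norm_cart[of b "\<omega> 1"] by (simp add: abs_le_iff)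
      qed (use C(1) in auto)
      then show ?thesis using prob_space by simp
    qed
    ultimately show ?thesis by blast
  qed
  define v where "v x = (\<chi> i. Inf (S i x))" for x
  have vle: "v x $ i \<le> c" if "c \<in> S i x" for x i c
    unfolding v_def using that bdd by (simp add: cInf_lower)
  have vnear: "\<exists>c\<in>S i x. c < v x $ i + e" if "e > 0" for x i e
    using cInf_lessD[of "S i x" "v x $ i + e"] up[of i x] that by (auto simp: v_def)
  have val: "value_fun P L \<alpha> b y i x = ereal (v x $ i)" for i x
  proof -
    have "value_fun P L \<alpha> b y i x = Inf (ereal ` S i x)"
      unfolding value_fun_def S_def by (rule arg_cong[where f=Inf]) auto
    also have "\<dots> = ereal (Inf (S i x))"
    proof (rule antisym)
      show "Inf (ereal ` S i x) \<le> ereal (Inf (S i x))"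
      proof (rule ereal_le_epsilon2)
        fix e :: real assume "e > 0"
        then obtain c where "c \<in> S i x" "c < v x $ i + e" using vnear by blast
        then show "Inf (ereal ` S i x) \<le> ereal (Inf (S i x)) + ereal e"
          by (intro order_trans[OF Inf_lower[of "ereal c"]]) (auto simp: v_def)
      qed
      show "ereal (Inf (S i x)) \<le> Inf (ereal ` S i x)"
        using vle[of _ i x] by (intro Inf_greatest) (auto simp: v_def)
    qed
    finally show ?thesis by (simp add: v_def)
  qed
  have "\<bar>v x $ i\<bar> \<le> \<bar>B\<bar> + \<bar>C + norm b\<bar>" for x i
  proof -
    obtain c where c: "c \<in> S i x" "c \<le> C + norm b" using up by blast
    have "- B \<le> v x $ i" unfolding v_def using low c(1) by (auto intro!: cInf_greatest)
    moreover have "v x $ i \<le> C + norm b" using vle[OF c(1)] c(2) by simp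
    ultimately show ?thesis by linarith
  qed
  moreover have "v (torus_proj z) $ i \<le>
      (LINT \<omega>|PI i. running_cost \<alpha> z \<omega> (const_path q) h) + (\<Sum>j\<in>UNIV. Q h $ i $ j * v (torus_proj (z + h *\<^sub>R q)) $ j)"
    if h: "0 < h" for z q h i
  proof (rule field_le_epsilon)
    fix e :: real assume e: "e > 0"
    let ?x = "torus_proj (z + h *\<^sub>R q)"
    have "\<exists>\<tau> \<Xi>. bounded_stopping_time \<tau> \<and> \<Xi> \<in> controls_to P \<tau> (torus_proj y - ?x) \<and> cost P L \<alpha> b j ?x \<tau> \<Xi> < v ?x $ j + e" for j
      using vnear[OF e, of j ?x] by (auto simp: S_def)
    then obtain \<tau> \<Xi> where t: "\<And>j. bounded_stopping_time (\<tau> j)" "\<And>j. \<Xi> j \<in> controls_to P (\<tau> j) (torus_proj y - ?x)"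
        "\<And>j. cost P L \<alpha> b j ?x (\<tau> j) (\<Xi> j) < v ?x $ j + e"
      by metis
    obtain \<tau>' \<Xi>' where t': "bounded_stopping_time \<tau>'" "\<Xi>' \<in> controls_to P \<tau>' (torus_proj y - torus_proj z)"
      "\<And>i \<alpha> b. cost P L \<alpha> b i (torus_proj z) \<tau>' \<Xi>' = (LINT \<omega>|PI i. running_cost \<alpha> z \<omega> (const_path q) h) +
         (\<Sum>j\<in>UNIV. Q h $ i $ j * cost P L \<alpha> b j ?x (\<tau> j) (\<Xi> j))"
      by (rule dynamic_programming[OF h t(1,2)]) (rule that)
    have "v (torus_proj z) $ i \<le> cost P L \<alpha> b i (torus_proj z) \<tau>' \<Xi>'"
      by (rule vle) (use t'(1,2) in \<open>unfold S_def, blast\<close>)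
    also have "\<dots> \<le> (LINT \<omega>|PI i. running_cost \<alpha> z \<omega> (const_path q) h) + (\<Sum>j\<in>UNIV. Q h $ i $ j * (v ?x $ j + e))"
      unfolding t'(3) using t(3) h by (intro add_left_mono sum_mono mult_left_mono Q_nonneg) (auto intro: less_imp_le)
    also have "(\<Sum>j\<in>UNIV. Q h $ i $ j * (v ?x $ j + e)) = (\<Sum>j\<in>UNIV. Q h $ i $ j * v ?x $ j) + e"
      using sum_Q[of h i] h by (simp add: algebra_simps sum.distrib sum_distrib_left[symmetric])
    finally show "v (torus_proj z) $ i \<le> (LINT \<omega>|PI i. running_cost \<alpha> z \<omega> (const_path q) h) +
        (\<Sum>j\<in>UNIV. Q h $ i $ j * v ?x $ j) + e" by simp
  qed
  ultimately have "subsolution H \<Lambda> \<alpha> v" by (rule dpi_subsolution)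
  with val show ?thesis by blast
qed

end

subsection \<open>Regularisation by periodic sup-convolution\<close>

text \<open>Taylor's estimate with second derivative at least -1. For nonnegative \<open>d\<close>
  the difference of both sides is nondecreasing because the sine is 1-Lipschitz; negative
  \<open>d\<close> follows by reflection.\<close>

lemma cos_lower_quadratic: "cos x + d * sin x - d\<^sup>2 / 2 \<le> cos (x - d)" for x d :: real
proof -
  have *: "cos x + d * sin x - d\<^sup>2 / 2 \<le> cos (x - d)" if d: "0 \<le> d" for x d :: real
  proof -
    define f where "f t = cos (x - t) - cos x - t * sin x + t\<^sup>2 / 2" for t
    have "f 0 \<le> f d"
    proof (rule DERIV_nonneg_imp_nondecreasing[OF d])
      fix t assume t: "0 \<le> t" "t \<le> d"
      have "\<bar>sin x - sin (x - t)\<bar> = 2 * \<bar>sin (t / 2)\<bar> * \<bar>cos ((x + (x - t)) / 2)\<bar>"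
        by (simp add: sin_diff_sin abs_mult)
      also have "\<dots> \<le> 2 * \<bar>t / 2\<bar> * 1" by (intro mult_mono abs_sin_x_le_abs_x abs_cos_le_one) auto
      finally have "sin (x - t) - sin x + t \<ge> 0" using t by (simp add: abs_le_iff)
      moreover have "(f has_real_derivative sin (x - t) - sin x + t) (at t)"
        unfolding f_def by (auto intro!: derivative_eq_intros)
      ultimately show "\<exists>y. (f has_real_derivative y) (at t) \<and> 0 \<le> y" by blast
    qed
    then show ?thesis by (simp add: f_def)
  qed
  show ?thesis
  proof (cases "0 \<le> d")
    case False
    have "cos (- x - (- d)) = cos (x - d)" by (metis cos_minus minus_diff_minus)
    with *[of "- d" "- x"] False show ?thesis by simp
  qed (rule *)
qed

text \<open>The test functions live on the torus and the maxima are global, hence a periodic substitute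
  for \<open>\<bar>r\<bar>\<^sup>2\<close>.\<close>

definition penalty :: "real^'n \<Rightarrow> real" where
  "penalty r = (\<Sum>k\<in>UNIV. 1 - cos (2 * pi * r $ k))"

definition penalty_grad :: "real^'n \<Rightarrow> real^'n" where
  "penalty_grad r = (\<chi> k. 2 * pi * sin (2 * pi * r $ k))"

lemma trig_int_shift:
  assumes "s - r \<in> \<int>"
  shows "cos (2 * pi * s) = cos (2 * pi * r)" "sin (2 * pi * s) = sin (2 * pi * r)"
proof -
  obtain n where "s = r + of_int n" using assms by (metis Ints_cases add.commute diff_add_cancel)
  then have "2 * pi * s = 2 * pi * r + 2 * pi * of_int n" by (simp add: algebra_simps)
  then show "cos (2 * pi * s) = cos (2 * pi * r)" "sin (2 * pi * s) = sin (2 * pi * r)"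
    by (simp_all only: cos_add sin_add cos_int_2pin sin_int_2pin mult_1_right mult_zero_right diff_zero add.right_neutral add_0_right)
qed

lemma penalty_cong: "int_equiv r s \<Longrightarrow> penalty (r - a) = penalty (s - a)"
  unfolding penalty_def by (intro sum.cong) (auto simp: int_equiv_def intro!: trig_int_shift)

lemma penalty_grad_cong: "int_equiv r s \<Longrightarrow> penalty_grad (r - a) = penalty_grad (s - a)"
  unfolding penalty_grad_def vec_eq_iff by (auto simp: int_equiv_def intro!: trig_int_shift)

lemma penalty_nonneg: "0 \<le> penalty r"
  unfolding penalty_def by (intro sum_nonneg) simp

lemma penalty_0 [simp]: "penalty 0 = 0"
  by (simp add: penalty_def)

lemma continuous_on_penalty: "continuous_on S penalty"
  unfolding penalty_def by (intro continuous_intros)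

lemma continuous_on_penalty_grad: "continuous_on S penalty_grad"
  unfolding penalty_grad_def by (intro continuous_intros)

text \<open>The second derivatives are at most \<open>(2 * pi)\<^sup>2\<close>. This one-sided bound
  becomes the fixed opening of the paraboloids below the sup-convolution.\<close>

lemma penalty_upper_quadratic:
  "penalty (r - w) \<le> penalty r - penalty_grad r \<bullet> w + 2 * pi\<^sup>2 * (norm w)\<^sup>2"
proof -
  have "penalty (r - w) \<le> (\<Sum>k\<in>UNIV. (1 - cos (2 * pi * r $ k)) - (2 * pi * sin (2 * pi * r $ k)) * w $ k + 2 * pi\<^sup>2 * (w $ k)\<^sup>2)"
    unfolding penalty_def
  proof (rule sum_mono)
    fix k
    show "1 - cos (2 * pi * (r - w) $ k) \<le> (1 - cos (2 * pi * r $ k)) - (2 * pi * sin (2 * pi * r $ k)) * w $ k + 2 * pi\<^sup>2 * (w $ k)\<^sup>2"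
      using cos_lower_quadratic[of "2 * pi * r $ k" "2 * pi * w $ k"]
      by (simp add: algebra_simps power2_eq_square)
  qed
  also have "\<dots> = penalty r - penalty_grad r \<bullet> w + 2 * pi\<^sup>2 * (norm w)\<^sup>2"
    by (simp add: penalty_def penalty_grad_def inner_vec_def sum.distrib sum_subtractf sum_distrib_left
        power2_norm_eq_inner power2_eq_square[symmetric])
  finally show ?thesis .
qed

lemma penalty_has_derivative: "(penalty has_derivative (\<lambda>h. h \<bullet> penalty_grad z)) (at z)"
proof -
  have "((\<lambda>z. \<Sum>k\<in>UNIV. 1 - cos (2 * pi * z $ k)) has_derivative (\<lambda>h. \<Sum>k\<in>UNIV. 2 * pi * h $ k * sin (2 * pi * z $ k))) (at z)"
    by (auto intro!: derivative_eq_intros has_derivative_sum bounded_linear.has_derivative[OF bounded_linear_vec_nth])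
  moreover have "(\<lambda>h. \<Sum>k\<in>UNIV. 2 * pi * h $ k * sin (2 * pi * z $ k)) = (\<lambda>h. h \<bullet> penalty_grad z)"
    by (auto simp: inner_vec_def penalty_grad_def fun_eq_iff mult_ac)
  ultimately show ?thesis unfolding penalty_def[abs_def] by simp
qed

lemma norm_penalty_grad: "norm (penalty_grad (r :: real^'n)) \<le> 2 * pi * real CARD('n)"
proof -
  have "norm (penalty_grad r) \<le> (\<Sum>k\<in>UNIV. \<bar>penalty_grad r $ k\<bar>)" by (rule norm_le_l1_cart)
  also have "\<dots> \<le> (\<Sum>k\<in>(UNIV :: 'n set). 2 * pi)"
  proof (rule sum_mono)
    fix k
    have "\<bar>penalty_grad r $ k\<bar> = 2 * pi * \<bar>sin (2 * pi * r $ k)\<bar>" by (simp add: penalty_grad_def abs_mult)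
    also have "\<dots> \<le> 2 * pi * 1" by (intro mult_left_mono) auto
    finally show "\<bar>penalty_grad r $ k\<bar> \<le> 2 * pi" by simp
  qed
  also have "\<dots> = 2 * pi * real CARD('n)" by simp
  finally show ?thesis .
qed

text \<open>The penalty vanishes exactly on the integer lattice. On a centred unit cell without a
  ball around 0 it therefore has a positive minimum, which serves as the threshold
  \<open>m\<close>.\<close>

lemma penalty_small:
  assumes "d > 0"
  obtains m where "m > 0" "\<And>r :: real^'n. penalty r < m \<Longrightarrow> \<exists>k. int_equiv k 0 \<and> norm (r + k) < d"
proof -
  let ?S = "{r :: real^'n. d \<le> norm r} \<inter> cbox (- (\<chi> k. 1/2)) (\<chi> k. 1/2)"
  have S: "compact ?S" by (intro closed_Int_compact compact_cbox closed_Collect_le continuous_intros)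
  have pos: "penalty r > 0" if r: "r \<in> ?S" for r
  proof (rule ccontr)
    assume "\<not> penalty r > 0"
    then have "penalty r = 0" using penalty_nonneg[of r] by simp
    then have c: "cos (2 * pi * r $ k) = 1" for k
      unfolding penalty_def by (subst (asm) sum_nonneg_eq_0_iff) auto
    have "r $ k = 0" for k
    proof -
      obtain n :: int where "2 * pi * r $ k = of_int n * (2 * pi)"
        using c[of k] by (auto simp: cos_one_2pi_int mult_ac)
      then have n: "r $ k = of_int n" by simp
      have "\<bar>r $ k\<bar> \<le> 1/2" using r by (auto simp: mem_box_cart abs_le_iff dest!: spec[of _ k])
      with n have "n = 0" by linarith
      with n show ?thesis by simp
    qed
    then have "r = 0" by (simp add: vec_eq_iff)
    with r assms show False by simp
  qed
  have "\<exists>m>0. \<forall>r\<in>?S. m \<le> penalty r"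
  proof (cases "?S = {}")
    case False
    obtain r0 where "r0 \<in> ?S" "\<And>r. r \<in> ?S \<Longrightarrow> penalty r0 \<le> penalty r"
      using continuous_attains_inf[OF S False continuous_on_penalty] by blast
    then show ?thesis using pos by blast
  qed (auto intro: exI[of _ 1])
  then obtain m where m: "m > 0" "\<And>r. r \<in> ?S \<Longrightarrow> m \<le> penalty r" by blast
  show ?thesis
  proof (rule that[OF m(1)])
    fix r :: "real^'n" assume r: "penalty r < m"
    \<comment> \<open>Subtracting the nearest integer in each coordinate moves \<open>r\<close> into
      the centred cell.\<close>
    define k :: "real^'n" where "k = (\<chi> i. - of_int (round (r $ i)))"
    have k: "int_equiv k 0" by (simp add: int_equiv_def k_def)
    have "\<bar>(r + k) $ i\<bar> \<le> 1/2" for i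
      using of_int_round_abs_le[of "r $ i"] by (simp add: k_def abs_minus_commute)
    then have "- (1/2) \<le> (r + k) $ i \<and> (r + k) $ i \<le> 1/2" for i
      by (meson abs_le_D1 abs_le_D2 minus_le_iff)
    then have "r + k \<in> cbox (- (\<chi> k. 1/2)) (\<chi> k. 1/2)" by (simp add: mem_box_cart)
    moreover have "penalty (r + k) = penalty r"
      using penalty_cong[of "r + k" r 0] k by (simp add: int_equiv_def)
    ultimately have "norm (r + k) < d" using m(2)[of "r + k"] r by force
    with k show "\<exists>k. int_equiv k 0 \<and> norm (r + k) < d" by blast
  qed
qed

text \<open>\<open>torus_rep\<close> picks representatives without any continuity, but the penalty
  and its gradient do not distinguish representatives.\<close>

lemma C1_gradient_penalty:
  "C1_gradient (\<lambda>x. penalty (torus_rep x - a) / \<epsilon>) (\<lambda>x. penalty_grad (torus_rep x - a) /\<^sub>R \<epsilon>)"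
proof -
  have 1: "penalty (torus_rep (torus_proj z) - a) = penalty (z - a)"
    "penalty_grad (torus_rep (torus_proj z) - a) = penalty_grad (z - a)" for z
    using penalty_cong penalty_grad_cong torus_rep_proj by blast+
  have "continuous_on UNIV (\<lambda>x. penalty_grad (torus_rep x - a) /\<^sub>R \<epsilon>)"
    by (rule continuous_on_torusI)
      (auto simp: 1 intro!: continuous_intros continuous_on_compose2[OF continuous_on_penalty_grad])
  moreover have "GDERIV (\<lambda>w. penalty (w - a) / \<epsilon>) z :> penalty_grad (z - a) /\<^sub>R \<epsilon>" for z
  proof -
    have "((\<lambda>w. w - a) has_derivative (\<lambda>h. h)) (at z)" by (auto intro!: derivative_eq_intros)
    from has_derivative_compose[OF this penalty_has_derivative]
    have "((\<lambda>w. penalty (w - a)) has_derivative (\<lambda>h. h \<bullet> penalty_grad (z - a))) (at z)" .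
    from bounded_linear.has_derivative[OF bounded_linear_divide this]
    have "((\<lambda>w. penalty (w - a) / \<epsilon>) has_derivative (\<lambda>h. (h \<bullet> penalty_grad (z - a)) / \<epsilon>)) (at z)" .
    then show ?thesis unfolding gderiv_def by (simp add: divide_inverse_commute)
  qed
  ultimately show ?thesis unfolding C1_gradient_def 1 by blast
qed

context controlled_system begin

lemma subsolution_bounded:
  assumes "subsolution H \<Lambda> \<alpha> u"
  obtains B where "B \<ge> 0" "\<And>x i. \<bar>u x $ i\<bar> \<le> B"
    "\<And>e. e > 0 \<Longrightarrow> \<exists>d>0. \<forall>z z' i. dist z z' < d \<longrightarrow> \<bar>u (torus_proj z) $ i - u (torus_proj z') $ i\<bar> < e"
proof -
  have uc: "continuous_on UNIV u" using assms by (simp add: subsolution_def)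
  \<comment> \<open>A dummy second argument adapts the function to the lemmas for functions of
    position and momentum.\<close>
  have c: "continuous_on (UNIV \<times> {0}) (\<lambda>(z, p :: real). u (torus_proj z) $ i)" for i
    unfolding case_prod_beta
    by (intro continuous_on_component continuous_on_compose2[OF uc] continuous_on_compose2[OF continuous_on_torus_proj] continuous_on_fst continuous_on_id) auto
  have "\<exists>B. B \<ge> 0 \<and> (\<forall>x. \<bar>u x $ i\<bar> \<le> B)" for i
    by (rule periodic_bounded[OF c compact_sing, of i]) auto
  then obtain B where B: "\<And>i. B i \<ge> 0" "\<And>i x. \<bar>u x $ i\<bar> \<le> B i" by metis
  have 1: "\<exists>d>0. \<forall>z z'. dist z z' < d \<longrightarrow> \<bar>u (torus_proj z) $ i - u (torus_proj z') $ i\<bar> < e" if "e > 0" for e i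
    by (rule periodic_uniformly_continuous[OF c compact_sing that, of i]) auto
  show ?thesis
  proof (rule that[of "\<Sum>i\<in>UNIV. B i"])
    show "\<bar>u x $ i\<bar> \<le> (\<Sum>i\<in>UNIV. B i)" for x i
      by (rule order_trans[OF B(2)]) (rule member_le_sum, auto simp: B)
    fix e :: real assume "e > 0"
    then have "\<forall>i. \<exists>d>0. \<forall>z z'. dist z z' < d \<longrightarrow> \<bar>u (torus_proj z) $ i - u (torus_proj z') $ i\<bar> < e"
      using 1 by (intro allI)
    from choice[OF this] obtain d where "\<And>i. d i > 0" "\<And>i z z'. dist z z' < d i \<Longrightarrow> \<bar>u (torus_proj z) $ i - u (torus_proj z') $ i\<bar> < e"
      by blast
    then show "\<exists>d>0. \<forall>z z' i. dist z z' < d \<longrightarrow> \<bar>u (torus_proj z) $ i - u (torus_proj z') $ i\<bar> < e"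
      by (intro exI[of _ "Min (range d)"]) auto
  qed (auto intro: sum_nonneg B)
qed

text \<open>With \<open>Z\<close> a maximum point of \<open>u\<close> minus the penalty centred at
  \<open>a\<close>, one slope \<open>p\<close> does both tasks. The penalty is a test function
  touching \<open>u\<close> from above at \<open>Z\<close>, which gives the Hamilton-Jacobi
  inequality there; and keeping \<open>Z\<close> as a competitor while \<open>a\<close> moves gives
  the paraboloid below \<open>V\<close>. The inequality is moved from \<open>Z\<close> to
  \<open>a\<close> by uniform continuity and rewritten by Fenchel's inequality in terms of
  velocities.\<close>

lemma sup_convolution:
  assumes sub: "subsolution H \<Lambda> \<alpha> u" and e: "e > 0"
  obtains V :: "'m \<Rightarrow> real^'n \<Rightarrow> real" and K K1 where
    "\<And>j a. \<bar>V j a - u (torus_proj a) $ j\<bar> \<le> e" "K \<ge> 0" "K1 \<ge> 0"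
    "\<And>j a. \<exists>p. norm p \<le> K1 \<and> (\<forall>w. V j a + p \<bullet> w - K * (norm w)\<^sup>2 \<le> V j (a + w)) \<and>
       (\<forall>\<xi>. norm \<xi> \<le> R \<longrightarrow> (\<Sum>k\<in>UNIV. \<Lambda> $ j $ k * V k a) - \<alpha> - e \<le> p \<bullet> \<xi> + L j (torus_proj a) (- \<xi>))"
proof -
  obtain B where B: "B \<ge> 0" "\<And>x i. \<bar>u x $ i\<bar> \<le> B"
    "\<And>e. e > 0 \<Longrightarrow> \<exists>d>0. \<forall>z z' i. dist z z' < d \<longrightarrow> \<bar>u (torus_proj z) $ i - u (torus_proj z') $ i\<bar> < e"
    by (rule subsolution_bounded[OF sub]) blast
  define N where "N = (\<Sum>i\<in>UNIV. \<Sum>j\<in>UNIV. \<bar>\<Lambda> $ i $ j\<bar>) + 1"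
  have N: "N \<ge> 1" by (simp add: N_def sum_nonneg)
  \<comment> \<open>The coupling term, bounded by \<open>N - 1\<close> times the deviation
    \<open>2 * e1\<close>, then costs at most \<open>e / 2\<close>; together with
    \<open>e / 4\<close> for the Lagrangian this stays below \<open>e\<close>.\<close>
  define e1 where "e1 = e / (4 * N)"
  have e1: "e1 > 0" "e1 \<le> e" "2 * e1 * N \<le> e / 2" using e N by (auto simp: e1_def field_simps)
  obtain d1 where d1: "d1 > 0" "\<And>z z' i. dist z z' < d1 \<Longrightarrow> \<bar>u (torus_proj z) $ i - u (torus_proj z') $ i\<bar> < e1"
    using B(3)[OF e1(1)] by blast
  have "e / 4 > 0" using e by simp
  then obtain d2 where d2: "d2 > 0" "\<And>i z z' q. dist z z' < d2 \<Longrightarrow> norm q \<le> R \<Longrightarrow> \<bar>L i (torus_proj z) q - L i (torus_proj z') q\<bar> < e / 4"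
    by (rule L_uniformly_continuous[where R=R]) blast
  have d12: "min d1 d2 > 0" using d1 d2 by simp
  obtain m where m: "m > 0" "\<And>r :: real^'n. penalty r < m \<Longrightarrow> \<exists>k. int_equiv k 0 \<and> norm (r + k) < min d1 d2"
    by (rule penalty_small[OF d12]) blast
  \<comment> \<open>Comparing a maximum point with \<open>a\<close> itself bounds the penalty by
    \<open>2 * B * \<epsilon>\<close>, which this choice puts below the threshold \<open>m\<close>.
    The maximum point is then close to \<open>a\<close> modulo the lattice.\<close>
  define \<epsilon> where "\<epsilon> = m / (2 * B + 1)"
  have \<epsilon>: "\<epsilon> > 0" using m B by (simp add: \<epsilon>_def)
  define f where "f j a z = u (torus_proj z) $ j - penalty (z - a) / \<epsilon>" for j a z
  have uc: "continuous_on UNIV u" using sub by (simp add: subsolution_def)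
  have "\<exists>z. dist z a < min d1 d2 \<and> (\<forall>z'. f j a z' \<le> f j a z)" for j a
  proof -
    have "continuous_on (cbox 0 1) (f j a)"
      unfolding f_def
      by (intro continuous_on_diff continuous_on_component continuous_on_divide continuous_on_const
          continuous_on_compose2[OF uc] continuous_on_torus_proj
          continuous_on_compose2[OF continuous_on_penalty[of UNIV]] continuous_on_id) (use \<epsilon> in auto)
    moreover have "cbox 0 (1 :: real^'n) \<noteq> {}" using frac_vec_in_cbox by (rule ex_in_conv[THEN iffD1, OF exI])
    ultimately have "\<exists>z0\<in>cbox 0 1. \<forall>z\<in>cbox 0 1. f j a z \<le> f j a z0"
      by (intro continuous_attains_sup compact_cbox)
    then obtain z0 where z0': "\<forall>z\<in>cbox 0 1. f j a z \<le> f j a z0" by (rule bexE)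
    note z0 = bspec[OF z0']
    have per: "f j a z = f j a z'" if "int_equiv z z'" for z z'
      using that penalty_cong[OF that] torus_proj_eq_iff[of z z'] by (simp add: f_def)
    have max: "f j a z \<le> f j a z0" for z
    proof -
      have "int_equiv (frac_vec z) z" using torus_proj_frac_vec torus_proj_eq_iff by blast
      then show ?thesis using z0[OF frac_vec_in_cbox, of z] per by metis
    qed
    have "f j a a \<le> f j a z0" by (rule max)
    then have "penalty (z0 - a) / \<epsilon> \<le> 2 * B"
      using B(2)[of "torus_proj a" j] B(2)[of "torus_proj z0" j] by (simp add: f_def abs_le_iff)
    then have "penalty (z0 - a) \<le> 2 * B * \<epsilon>" using \<epsilon> by (simp add: field_simps)
    also have "\<dots> < m" using m(1) B(1) by (simp add: \<epsilon>_def field_simps)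
    finally obtain k where k: "int_equiv k 0" "norm (z0 - a + k) < min d1 d2" using m(2) by blast
    have "int_equiv (z0 + k) z0" using k(1) by (simp add: int_equiv_def)
    then have "f j a (z0 + k) = f j a z0" by (rule per)
    moreover have "dist (z0 + k) a < min d1 d2" using k(2) by (simp add: dist_norm algebra_simps)
    ultimately show ?thesis using max by metis
  qed
  note ex = this
  \<comment> \<open>Any maximum point within the prescribed distance; \<open>V\<close> depends only
    on the maximum value, not on the selection.\<close>
  define Z where "Z j a = (SOME z. dist z a < min d1 d2 \<and> (\<forall>z'. f j a z' \<le> f j a z))" for j a
  have Z: "dist (Z j a) a < min d1 d2" "f j a z' \<le> f j a (Z j a)" for j a z'
    using someI_ex[OF ex[of a j]] unfolding Z_def by blast+
  define V where "V j a = f j a (Z j a)" for j a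
  have near: "u (torus_proj a) $ j \<le> V j a" "V j a \<le> u (torus_proj a) $ j + e1" for j a
  proof -
    show "u (torus_proj a) $ j \<le> V j a" using Z(2)[of j a a] by (simp add: V_def f_def)
    have "V j a \<le> u (torus_proj (Z j a)) $ j" using penalty_nonneg[of "Z j a - a"] \<epsilon> by (simp add: V_def f_def)
    then show "V j a \<le> u (torus_proj a) $ j + e1" using d1(2)[of "Z j a" a j] Z(1)[of j a] by (simp add: abs_less_iff)
  qed
  show ?thesis
  proof (rule that)
    show "\<bar>V j a - u (torus_proj a) $ j\<bar> \<le> e" for j a using near[where j=j and a=a] e1 by (simp add: abs_le_iff)
    show "0 \<le> 2 * pi\<^sup>2 / \<epsilon>" using \<epsilon> by simp
    show "0 \<le> 2 * pi * real CARD('n) / \<epsilon>" using \<epsilon> by simp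
    fix j a
    let ?z = "Z j a"
    define p where "p = penalty_grad (?z - a) /\<^sub>R \<epsilon>"
    have "norm p \<le> 2 * pi * real CARD('n) / \<epsilon>"
      using norm_penalty_grad[of "?z - a"] \<epsilon> by (simp add: p_def divide_inverse mult.commute mult_left_mono)
    moreover have "V j a + p \<bullet> w - 2 * pi\<^sup>2 / \<epsilon> * (norm w)\<^sup>2 \<le> V j (a + w)" for w
    proof -
      \<comment> \<open>The maximum point belonging to \<open>a\<close> competes at
        \<open>a + w\<close>, so only the change of the penalty counts.\<close>
      have "penalty (?z - a - w) / \<epsilon> \<le> (penalty (?z - a) - penalty_grad (?z - a) \<bullet> w + 2 * pi\<^sup>2 * (norm w)\<^sup>2) / \<epsilon>"
        using \<epsilon> by (intro divide_right_mono penalty_upper_quadratic) simp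
      also have "\<dots> = penalty (?z - a) / \<epsilon> - p \<bullet> w + 2 * pi\<^sup>2 / \<epsilon> * (norm w)\<^sup>2"
        by (simp add: p_def divide_inverse algebra_simps)
      finally have "V j a + p \<bullet> w - 2 * pi\<^sup>2 / \<epsilon> * (norm w)\<^sup>2 \<le> f j (a + w) ?z"
        by (simp add: V_def f_def diff_diff_eq)
      also have "\<dots> \<le> V j (a + w)" unfolding V_def by (rule Z(2))
      finally show ?thesis .
    qed
    moreover have "(\<Sum>k\<in>UNIV. \<Lambda> $ j $ k * V k a) - \<alpha> - e \<le> p \<bullet> \<xi> + L j (torus_proj a) (- \<xi>)" if xi: "norm \<xi> \<le> R" for \<xi>
    proof -
      let ?x = "torus_proj ?z"
      have rep: "penalty (torus_rep (torus_proj z) - a) = penalty (z - a)"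
        "penalty_grad (torus_rep (torus_proj z) - a) = penalty_grad (z - a)" for z
        using penalty_cong penalty_grad_cong torus_rep_proj by blast+
      have "u x $ j - penalty (torus_rep x - a) / \<epsilon> \<le> u ?x $ j - penalty (torus_rep ?x - a) / \<epsilon>" for x
      proof -
        obtain z where "x = torus_proj z" using torus_surj by blast
        then show ?thesis using Z(2)[of j a z] unfolding f_def by (simp add: rep)
      qed
      then have "H j ?x (penalty_grad (torus_rep ?x - a) /\<^sub>R \<epsilon>) + \<Lambda> $ j \<bullet> u ?x \<le> \<alpha>"
        using sub C1_gradient_penalty[of a \<epsilon>] unfolding subsolution_def by blast
      then have "H j ?x p + \<Lambda> $ j \<bullet> u ?x \<le> \<alpha>" by (simp add: rep p_def)
      moreover have "p \<bullet> (- \<xi>) \<le> H j ?x p + L j ?x (- \<xi>)" by (rule Fenchel_le)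
      moreover have "L j ?x (- \<xi>) \<le> L j (torus_proj a) (- \<xi>) + e / 4"
      proof -
        have "dist ?z a < d2" "norm (- \<xi>) \<le> R" using Z(1)[of j a] xi by simp_all
        from d2(2)[OF this, of j] show ?thesis by linarith
      qed
      moreover have "(\<Sum>k\<in>UNIV. \<Lambda> $ j $ k * V k a) - \<Lambda> $ j \<bullet> u ?x \<le> e / 2"
      proof -
        have "\<bar>V k a - u ?x $ k\<bar> \<le> 2 * e1" for k
          using near[where j=k and a=a] d1(2)[of ?z a k] Z(1)[of j a] by (simp add: abs_less_iff abs_le_iff)
        then have "\<bar>\<Sum>k\<in>UNIV. \<Lambda> $ j $ k * (V k a - u ?x $ k)\<bar> \<le> (N - 1) * (2 * e1)"
          unfolding N_def using matrix_row_bound[of "\<lambda>k. V k a - u ?x $ k" "2 * e1" \<Lambda> j] by simp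
        also have "\<dots> \<le> e / 2" using e1 by (simp add: algebra_simps)
        finally have "(\<Sum>k\<in>UNIV. \<Lambda> $ j $ k * (V k a - u ?x $ k)) \<le> e / 2" by (rule abs_le_D1)
        moreover have "(\<Sum>k\<in>UNIV. \<Lambda> $ j $ k * (V k a - u ?x $ k)) = (\<Sum>k\<in>UNIV. \<Lambda> $ j $ k * V k a) - \<Lambda> $ j \<bullet> u ?x"
          by (simp add: inner_vec_def right_diff_distrib sum_subtractf)
        ultimately show ?thesis by simp
      qed
      ultimately show ?thesis using e by simp
    qed
    ultimately show "\<exists>p. norm p \<le> 2 * pi * real CARD('n) / \<epsilon> \<and> (\<forall>w. V j a + p \<bullet> w - 2 * pi\<^sup>2 / \<epsilon> * (norm w)\<^sup>2 \<le> V j (a + w)) \<and>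
       (\<forall>\<xi>. norm \<xi> \<le> R \<longrightarrow> (\<Sum>k\<in>UNIV. \<Lambda> $ j $ k * V k a) - \<alpha> - e \<le> p \<bullet> \<xi> + L j (torus_proj a) (- \<xi>))"
      by blast
  qed
qed

end

subsection \<open>Verification\<close>

text \<open>Conditioning on the past up to \<open>s\<close>: the functions \<open>\<Phi> j\<close>
  are known at time \<open>s\<close>, and only the index that selects among them is random. Summing
  over the pairs of states at \<open>s\<close> and \<open>s + h\<close> reduces this to
  \<open>integral_transition\<close>.\<close>

lemma (in switching) expectation_transition:
  fixes \<Phi> :: "'m \<Rightarrow> (real \<Rightarrow> 'm) \<Rightarrow> real"
  assumes a: "a \<in> prob_simplex" and s: "0 \<le> s" and h: "0 < h"
    and m: "\<And>j. \<Phi> j \<in> borel_measurable (path_filtration s)" and b: "\<And>j \<omega>. \<bar>\<Phi> j \<omega>\<bar> \<le> B"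
  shows "integrable (P a) (\<lambda>\<omega>. \<Phi> (\<omega> (s + h)) \<omega>)"
    and "integrable (P a) (\<lambda>\<omega>. \<Sum>j\<in>UNIV. Q h $ \<omega> s $ j * \<Phi> j \<omega>)"
    and "(LINT \<omega>|P a. \<Phi> (\<omega> (s + h)) \<omega>) = (LINT \<omega>|P a. (\<Sum>j\<in>UNIV. Q h $ \<omega> s $ j * \<Phi> j \<omega>))"
proof -
  interpret prob_space "P a" by (rule prob_space_P[OF a])
  let ?A = "\<lambda>i. {\<omega> \<in> index_paths. \<omega> s = i}" and ?B = "\<lambda>i j. {\<omega> \<in> index_paths. \<omega> s = i \<and> \<omega> (s + h) = j}"
  have A: "?A i \<in> events" for i by (rule sets_eval_eq[OF a s])
  have AB: "?B i j \<in> events" for i j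
    using s h by (intro sets_eval_eq2[OF a]) simp_all
  have mP: "\<Phi> j \<in> borel_measurable (P a)" for j
  proof -
    have "\<Phi> j \<in> borel_measurable path_algebra" by (rule measurable_eval_algebra_mono[OF m]) (use s in auto)
    then show ?thesis using a by (simp add: measurable_P)
  qed
  have i\<Phi>: "integrable (P a) (\<Phi> j)" for j
    by (rule integrable_const_bound[where B=B]) (use b mP in auto)
  have iA: "integrable (P a) (\<lambda>\<omega>. indicator (?A i) \<omega> * \<Phi> j \<omega>)" for i j
    using integrable_mult_indicator[OF A i\<Phi>] by simp
  have iB: "integrable (P a) (\<lambda>\<omega>. indicator (?B i j) \<omega> * \<Phi> j \<omega>)" for i j
    using integrable_mult_indicator[OF AB i\<Phi>] by simp
  have 1: "\<Phi> (\<omega> (s + h)) \<omega> = (\<Sum>i\<in>UNIV. \<Sum>j\<in>UNIV. indicator (?B i j) \<omega> * \<Phi> j \<omega>)" if w: "\<omega> \<in> index_paths" for \<omega>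
  proof -
    have "(\<Sum>i\<in>UNIV. \<Sum>j\<in>UNIV. indicator (?B i j) \<omega> * \<Phi> j \<omega>) =
      (\<Sum>i\<in>UNIV. \<Sum>j\<in>UNIV. if j = \<omega> (s + h) then (if i = \<omega> s then \<Phi> j \<omega> else 0) else 0)"
      using w by (intro sum.cong refl) (auto simp: indicator_def)
    then show ?thesis by simp
  qed
  have 2: "(\<Sum>j\<in>UNIV. Q h $ \<omega> s $ j * \<Phi> j \<omega>) = (\<Sum>i\<in>UNIV. \<Sum>j\<in>UNIV. Q h $ i $ j * (indicator (?A i) \<omega> * \<Phi> j \<omega>))"
    if w: "\<omega> \<in> index_paths" for \<omega>
  proof -
    have "(\<Sum>i\<in>UNIV. \<Sum>j\<in>UNIV. Q h $ i $ j * (indicator (?A i) \<omega> * \<Phi> j \<omega>)) =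
      (\<Sum>i\<in>UNIV. if i = \<omega> s then (\<Sum>j\<in>UNIV. Q h $ i $ j * \<Phi> j \<omega>) else 0)"
      using w by (intro sum.cong refl) (auto simp: indicator_def)
    then show ?thesis by simp
  qed
  have i1: "integrable (P a) (\<lambda>\<omega>. \<Sum>i\<in>UNIV. \<Sum>j\<in>UNIV. indicator (?B i j) \<omega> * \<Phi> j \<omega>)"
    by (intro Bochner_Integration.integrable_sum iB)
  have i2: "integrable (P a) (\<lambda>\<omega>. \<Sum>i\<in>UNIV. \<Sum>j\<in>UNIV. Q h $ i $ j * (indicator (?A i) \<omega> * \<Phi> j \<omega>))"
    by (intro Bochner_Integration.integrable_sum integrable_mult_right iA)
  show "integrable (P a) (\<lambda>\<omega>. \<Phi> (\<omega> (s + h)) \<omega>)"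
    by (rule Bochner_Integration.integrable_cong[THEN iffD2, OF refl _ i1]) (use a 1 in simp)
  show "integrable (P a) (\<lambda>\<omega>. \<Sum>j\<in>UNIV. Q h $ \<omega> s $ j * \<Phi> j \<omega>)"
    by (rule Bochner_Integration.integrable_cong[THEN iffD2, OF refl _ i2]) (use a 2 in simp)
  have "(LINT \<omega>|P a. \<Phi> (\<omega> (s + h)) \<omega>) = (LINT \<omega>|P a. (\<Sum>i\<in>UNIV. \<Sum>j\<in>UNIV. indicator (?B i j) \<omega> * \<Phi> j \<omega>))"
    by (rule Bochner_Integration.integral_cong[OF refl]) (use a 1 in simp)
  also have "\<dots> = (\<Sum>i\<in>UNIV. \<Sum>j\<in>UNIV. LINT \<omega>|P a. indicator (?B i j) \<omega> * \<Phi> j \<omega>)"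
    by (simp only: Bochner_Integration.integral_sum[OF iB] Bochner_Integration.integral_sum[OF Bochner_Integration.integrable_sum[OF iB]])
  also have "\<dots> = (\<Sum>i\<in>UNIV. \<Sum>j\<in>UNIV. LINT \<omega>|P a. Q h $ i $ j * (indicator (?A i) \<omega> * \<Phi> j \<omega>))"
    by (intro sum.cong refl) (simp only: integral_transition[OF a s h m] integral_mult_right_zero)
  also have "\<dots> = (LINT \<omega>|P a. (\<Sum>i\<in>UNIV. \<Sum>j\<in>UNIV. Q h $ i $ j * (indicator (?A i) \<omega> * \<Phi> j \<omega>)))"
  proof -
    have *: "integrable (P a) (\<lambda>\<omega>. Q h $ i $ j * (indicator (?A i) \<omega> * \<Phi> j \<omega>))" for i j
      by (intro integrable_mult_right iA)
    show ?thesis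
      by (simp only: Bochner_Integration.integral_sum[OF *] Bochner_Integration.integral_sum[OF Bochner_Integration.integrable_sum[OF *]])
  qed
  also have "\<dots> = (LINT \<omega>|P a. (\<Sum>j\<in>UNIV. Q h $ \<omega> s $ j * \<Phi> j \<omega>))"
    by (rule Bochner_Integration.integral_cong[OF refl]) (use a 2 in simp)
  finally show "(LINT \<omega>|P a. \<Phi> (\<omega> (s + h)) \<omega>) = (LINT \<omega>|P a. (\<Sum>j\<in>UNIV. Q h $ \<omega> s $ j * \<Phi> j \<omega>))" .
qed

text \<open>The transition matrix acts as the identity minus \<open>h * \<Lambda>\<close> up to
  second order, so the added generator term cancels the linear part. The generator is averaged at
  the final index; replacing it by the initial one costs another second-order term, hence the
  contributions \<open>C * K\<close> and \<open>K * K\<close> to the constant.\<close>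

lemma (in switching) generator_step:
  obtains c where "c \<ge> 0" "\<And>h w i B. 0 \<le> h \<Longrightarrow> h \<le> 1 \<Longrightarrow> (\<And>j. \<bar>w j\<bar> \<le> B) \<Longrightarrow>
    w i - c * B * h\<^sup>2 \<le> (\<Sum>j\<in>UNIV. Q h $ i $ j * (h * (\<Sum>k\<in>UNIV. \<Lambda> $ j $ k * w k) + w j))"
proof -
  obtain C where C: "C \<ge> 0" "\<And>h B w i. 0 \<le> h \<Longrightarrow> h \<le> 1 \<Longrightarrow> (\<And>j. \<bar>w j\<bar> \<le> B) \<Longrightarrow>
      \<bar>(\<Sum>j\<in>UNIV. Q h $ i $ j * w j) - (w i - h * (\<Sum>j\<in>UNIV. \<Lambda> $ i $ j * w j))\<bar> \<le> C * B * h\<^sup>2"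
    by (rule Q_sum_expansion) blast
  define K where "K = (\<Sum>i\<in>UNIV. \<Sum>j\<in>UNIV. \<bar>\<Lambda> $ i $ j\<bar>)"
  have K: "K \<ge> 0" by (simp add: K_def sum_nonneg)
  have "w i - (C + C * K + K * K) * B * h\<^sup>2 \<le> (\<Sum>j\<in>UNIV. Q h $ i $ j * (h * (\<Sum>k\<in>UNIV. \<Lambda> $ j $ k * w k) + w j))"
    if h: "0 \<le> h" "h \<le> 1" and w: "\<And>j. \<bar>w j\<bar> \<le> B" for h w i B
  proof -
    have B: "B \<ge> 0" using w[of i] by linarith
    define g where "g j = (\<Sum>k\<in>UNIV. \<Lambda> $ j $ k * w k)" for j
    have g: "\<bar>g j\<bar> \<le> K * B" for j unfolding g_def K_def by (rule matrix_row_bound[OF w])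
    have gg: "\<bar>\<Sum>j\<in>UNIV. \<Lambda> $ i $ j * g j\<bar> \<le> K * (K * B)" unfolding K_def by (rule matrix_row_bound[OF g[unfolded K_def]])
    have 1: "w i - h * g i - C * B * h\<^sup>2 \<le> (\<Sum>j\<in>UNIV. Q h $ i $ j * w j)"
      using C(2)[of h w B i] h w unfolding g_def[symmetric] by (simp add: abs_le_iff)
    have "g i - h * (\<Sum>j\<in>UNIV. \<Lambda> $ i $ j * g j) - C * (K * B) * h\<^sup>2 \<le> (\<Sum>j\<in>UNIV. Q h $ i $ j * g j)"
      using C(2)[of h g "K * B" i] h g by (simp add: abs_le_iff)
    moreover have "h * (\<Sum>j\<in>UNIV. \<Lambda> $ i $ j * g j) \<le> h * (K * (K * B))"
      using gg h by (intro mult_left_mono) (auto simp: abs_le_iff)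
    moreover have "C * (K * B) * h\<^sup>2 \<le> C * (K * B) * h"
      using h C K B by (intro mult_left_mono) (auto simp: power2_eq_square mult_left_le)
    ultimately have "g i - (K * K + C * K) * B * h \<le> (\<Sum>j\<in>UNIV. Q h $ i $ j * g j)"
      by (simp add: algebra_simps)
    from mult_left_mono[OF this h(1)]
    have 2: "h * g i - (K * K + C * K) * B * h\<^sup>2 \<le> h * (\<Sum>j\<in>UNIV. Q h $ i $ j * g j)"
      by (simp add: algebra_simps power2_eq_square)
    have "(\<Sum>j\<in>UNIV. Q h $ i $ j * (h * g j + w j)) = h * (\<Sum>j\<in>UNIV. Q h $ i $ j * g j) + (\<Sum>j\<in>UNIV. Q h $ i $ j * w j)"
      by (simp add: algebra_simps sum.distrib sum_distrib_left)
    with 1 2 show ?thesis unfolding g_def[symmetric] by (simp add: algebra_simps)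
  qed
  moreover have "C + C * K + K * K \<ge> 0" using C K by simp
  ultimately show ?thesis using that by blast
qed

section \<open>Touching functions along controlled trajectories\<close>

context controlled_system begin

text \<open>A nonanticipating control agrees up to time \<open>s\<close> with the control evaluated
  on the path stopped at \<open>s\<close>, and the latter is measurable at time
  \<open>s\<close>.\<close>

lemma measurable_displacement_filtration:
  assumes c: "control P \<Xi>" and s: "0 \<le> s"
  shows "(\<lambda>\<omega>. displacement (\<Xi> \<omega>) s) \<in> borel_measurable (path_filtration s)"
proof -
  have "(\<lambda>\<omega>. displacement (\<Xi> (stop_path s \<omega>)) s) \<in> borel_measurable (path_filtration s)"
    by (rule measurable_compose[OF measurable_stop_path[OF s] measurable_displacement_at[OF control_measurable[OF c]]])
  moreover have "displacement (\<Xi> (stop_path s \<omega>)) s = displacement (\<Xi> \<omega>) s" if w: "\<omega> \<in> space (path_filtration s)" for \<omega>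
    unfolding displacement_def
  proof (rule set_integral_cong_Icc)
    fix r assume r: "0 \<le> r" "r \<le> s"
    show "\<Xi> (stop_path s \<omega>) r = \<Xi> \<omega> r"
      by (rule control_nonanticipating'[OF c r(1)]) (use r w s in \<open>auto simp: stop_path_def intro!: stop_path_in[unfolded stop_path_def]\<close>)
  qed
  ultimately show ?thesis by (subst (asm) measurable_cong) auto
qed

end

text \<open>\<open>V\<close> is touched from below by paraboloids of fixed opening whose slopes \<open>p\<close> satisfy the
  Fenchel dual form of the Hamilton-Jacobi inequality for all velocities up to \<open>R\<close>.\<close>

locale touching_family = controlled_system H \<Lambda> P
  for H :: "'m::finite \<Rightarrow> 'n::finite torus \<Rightarrow> real^'n \<Rightarrow> real" and \<Lambda> :: "real^'m^'m" and P +
  fixes V :: "'m \<Rightarrow> real^'n \<Rightarrow> real" and B K K1 R e \<alpha> :: real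
    and \<Xi> :: "(real \<Rightarrow> 'm) \<Rightarrow> real \<Rightarrow> real^'n" and T :: real and i :: 'm and z :: "real^'n"
  assumes V_bound: "\<And>j a. \<bar>V j a\<bar> \<le> B" and K: "K \<ge> 0" and K1: "K1 \<ge> 0" and e: "e > 0" and R: "R > 0" and T: "T > 0"
    and touch: "\<And>j a. \<exists>p. norm p \<le> K1 \<and> (\<forall>w. V j a + p \<bullet> w - K * (norm w)\<^sup>2 \<le> V j (a + w)) \<and>
       (\<forall>\<xi>. norm \<xi> \<le> R \<longrightarrow> (\<Sum>k\<in>UNIV. \<Lambda> $ j $ k * V k a) - \<alpha> - e \<le> p \<bullet> \<xi> + L j (torus_proj a) (- \<xi>))"
    and ctl: "control P \<Xi>"
    and \<Xi>_bound: "AE \<omega> in PI i. \<forall>s. 0 \<le> s \<longrightarrow> s \<le> T \<longrightarrow> norm (\<Xi> \<omega> s) \<le> R"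
begin

lemma B_nonneg: "B \<ge> 0"
  using V_bound[of undefined undefined] by linarith

definition X :: "real \<Rightarrow> (real \<Rightarrow> 'm) \<Rightarrow> real^'n" where
  "X t \<omega> = z + displacement (\<Xi> \<omega>) t"

text \<open>This process is nearly a submartingale on the grid. Its level is raised by
  \<open>2 * e\<close>: one \<open>e\<close> pays for the error in the touching inequality, the
  other for evaluating \<open>L\<close> at the moving instead of the initial position.\<close>

definition G :: "real \<Rightarrow> (real \<Rightarrow> 'm) \<Rightarrow> real" where
  "G t \<omega> = running_cost (\<alpha> + 2 * e) z \<omega> (\<Xi> \<omega>) t + V (\<omega> t) (X t \<omega>)"

text \<open>The paraboloid at \<open>a\<close> bounds the decrease from \<open>a\<close> to
  \<open>a + w\<close>; the one at \<open>a + w\<close>, used with \<open>- w\<close>, bounds the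
  increase.\<close>

lemma V_lipschitz: "\<bar>V j (a + w) - V j a\<bar> \<le> K1 * norm w + K * (norm w)\<^sup>2"
proof -
  have *: "V j a - V j (a + w) \<le> K1 * norm w + K * (norm w)\<^sup>2" for a w
  proof -
    obtain p where p: "norm p \<le> K1" "\<And>w. V j a + p \<bullet> w - K * (norm w)\<^sup>2 \<le> V j (a + w)" using touch by blast
    have "- (p \<bullet> w) \<le> norm p * norm w" using norm_cauchy_schwarz[of "-p" w] by simp
    also have "\<dots> \<le> K1 * norm w" by (intro mult_right_mono p) simp
    finally show ?thesis using p(2)[of w] by simp
  qed
  from *[of a w] *[of "a + w" "- w"] show ?thesis by (simp add: abs_le_iff)
qed

lemma V_isCont: "isCont (V j) a"
proof -
  have "(\<lambda>w. V j (a + w) - V j a) \<midarrow>0\<rightarrow> 0"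
  proof (rule Lim_null_comparison)
    show "\<forall>\<^sub>F w in at 0. norm (V j (a + w) - V j a) \<le> K1 * norm w + K * (norm w)\<^sup>2"
      using V_lipschitz by simp
    have "(\<lambda>w::real^'n. K1 * norm w + K * (norm w)\<^sup>2) \<midarrow>0\<rightarrow> K1 * norm (0::real^'n) + K * (norm (0::real^'n))\<^sup>2"
      by (intro tendsto_intros)
    then show "(\<lambda>w::real^'n. K1 * norm w + K * (norm w)\<^sup>2) \<midarrow>0\<rightarrow> 0" by simp
  qed
  then have "(\<lambda>w. V j (a + w)) \<midarrow>0\<rightarrow> V j a" by (rule Lim_null[THEN iffD2])
  then show ?thesis unfolding isCont_def by (rule LIM_offset_zero_cancel)
qed

lemma V_measurable: "V j \<in> borel_measurable borel"
  by (intro borel_measurable_continuous_onI) (simp add: continuous_on_eq_continuous_at V_isCont)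

lemma G_measurable:
  assumes S: "S \<in> borel_measurable path_algebra" "\<And>\<omega>. \<omega> \<in> index_paths \<Longrightarrow> 0 \<le> S \<omega>"
  shows "(\<lambda>\<omega>. G (S \<omega>) \<omega>) \<in> borel_measurable (PI i)"
proof -
  note cm = control_measurable[OF ctl]
  have "(\<lambda>\<omega>. running_cost (\<alpha> + 2 * e) z \<omega> (\<Xi> \<omega>) (S \<omega>)) \<in> borel_measurable path_algebra"
    by (rule measurable_running_cost[OF measurable_ident_sets[OF refl] cm S(1)]) (use S(2) in simp)
  moreover have "(\<lambda>\<omega>. V (\<omega> (S \<omega>)) (X (S \<omega>) \<omega>)) \<in> borel_measurable path_algebra"
  proof -
    have w: "(\<lambda>\<omega>. \<omega> (S \<omega>)) \<in> path_algebra \<rightarrow>\<^sub>M (count_space UNIV :: 'm measure)"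
      by (rule measurable_eval_at[OF measurable_ident_sets[OF refl] S(1)]) (use S(2) in simp)
    have "(\<lambda>\<omega>. (\<omega>, S \<omega>)) \<in> path_algebra \<rightarrow>\<^sub>M path_algebra \<Otimes>\<^sub>M borel"
      by (intro measurable_Pair S(1) measurable_ident_sets refl)
    from measurable_compose[OF this measurable_displacement[OF cm]]
    have "(\<lambda>\<omega>. displacement (\<Xi> \<omega>) (max 0 (S \<omega>))) \<in> borel_measurable path_algebra" by simp
    then have "(\<lambda>\<omega>. displacement (\<Xi> \<omega>) (S \<omega>)) \<in> borel_measurable path_algebra"
      by (rule measurable_cong[THEN iffD1, rotated]) (use S(2) in \<open>simp add: max_absorb2\<close>)
    then have "(\<lambda>\<omega>. X (S \<omega>) \<omega>) \<in> borel_measurable path_algebra"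
      unfolding X_def by (intro borel_measurable_add borel_measurable_const)
    note VX = measurable_compose[OF this V_measurable]
    show ?thesis
      by (rule measurable_compose_countable'[where f="\<lambda>j \<omega>. V j (X (S \<omega>) \<omega>)", OF VX w countable_finite[OF finite]])
  qed
  ultimately have "(\<lambda>\<omega>. G (S \<omega>) \<omega>) \<in> borel_measurable path_algebra"
    unfolding G_def by (rule borel_measurable_add)
  then show ?thesis by (simp add: measurable_P)
qed

lemma G_bound:
  obtains D where "D \<ge> 0" "AE \<omega> in PI i. \<forall>t. 0 \<le> t \<longrightarrow> t \<le> T \<longrightarrow> \<bar>G t \<omega>\<bar> \<le> D"
proof -
  obtain C where C: "C \<ge> 0" "\<And>z \<omega> \<xi> s. norm (\<xi> s) \<le> R \<Longrightarrow> \<bar>rate (\<alpha> + 2 * e) z \<omega> \<xi> s\<bar> \<le> C"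
    by (rule rate_bounded[where R=R and \<alpha>="\<alpha> + 2 * e"]) blast
  have "AE \<omega> in PI i. \<forall>t. 0 \<le> t \<longrightarrow> t \<le> T \<longrightarrow> \<bar>G t \<omega>\<bar> \<le> C * T + B"
    using \<Xi>_bound
  proof eventually_elim
    fix \<omega> assume w: "\<forall>s. 0 \<le> s \<longrightarrow> s \<le> T \<longrightarrow> norm (\<Xi> \<omega> s) \<le> R"
    show "\<forall>t. 0 \<le> t \<longrightarrow> t \<le> T \<longrightarrow> \<bar>G t \<omega>\<bar> \<le> C * T + B"
    proof (intro allI impI)
      fix t assume t: "0 \<le> t" "t \<le> T"
      have "\<bar>running_cost (\<alpha> + 2 * e) z \<omega> (\<Xi> \<omega>) t\<bar> \<le> C * t"
        by (rule running_cost_bound[OF _ t(1) C]) (use w t in auto)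
      also have "\<dots> \<le> C * T" using t C by (intro mult_left_mono) auto
      finally show "\<bar>G t \<omega>\<bar> \<le> C * T + B"
        unfolding G_def using V_bound[of "\<omega> t" "X t \<omega>"] by linarith
    qed
  qed
  moreover have "C * T + B \<ge> 0" using C T B_nonneg by simp
  ultimately show ?thesis using that by blast
qed

text \<open>The increment over \<open>[s, s + h]\<close> is split so that the position moves while the index is already
  the final one, \<open>\<omega> (s + h)\<close>, and the index switches at the initial position \<open>X s\<close>: the switching term
  is then \<open>\<F>\<^sub>s\<close>-measurable apart from the index, and the transition matrix applies.\<close>

lemma G_step:
  obtains c h0 where "c \<ge> 0" "h0 > 0" "\<And>s h D. 0 \<le> s \<Longrightarrow> 0 < h \<Longrightarrow> h \<le> h0 \<Longrightarrow> s + h \<le> T \<Longrightarrow>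
    Measurable.pred (path_filtration s) D \<Longrightarrow>
    - c * h\<^sup>2 \<le> (LINT \<omega>|PI i. of_bool (D \<omega>) * (G (s + h) \<omega> - G s \<omega>))"
proof -
  interpret prob_space "PI i" by (rule prob_space_P[OF axis_in_simplex])
  obtain C where C: "C \<ge> 0" "\<And>j x q. norm q \<le> R \<Longrightarrow> \<bar>L j x q\<bar> \<le> C" by (rule L_bounded[of R]) blast
  obtain J where J: "J \<ge> 0" "\<And>a s r0 h. a \<in> prob_simplex \<Longrightarrow> 0 \<le> s \<Longrightarrow> s \<le> r0 \<Longrightarrow> r0 \<le> s + h \<Longrightarrow> h \<le> 1 \<Longrightarrow>
      integrable (P a) (\<lambda>\<omega>. LINT r:{s..s + h}|lborel. of_bool (\<omega> r \<noteq> \<omega> r0) :: real) \<and>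
      (LINT \<omega>|P a. (LINT r:{s..s + h}|lborel. of_bool (\<omega> r \<noteq> \<omega> r0))) \<le> J * h\<^sup>2"
    by (rule jump_time) blast
  obtain c0 where c0: "c0 \<ge> 0" "\<And>h w i B. 0 \<le> h \<Longrightarrow> h \<le> 1 \<Longrightarrow> (\<And>j. \<bar>w j\<bar> \<le> B) \<Longrightarrow>
    w i - c0 * B * h\<^sup>2 \<le> (\<Sum>j\<in>UNIV. Q h $ i $ j * (h * (\<Sum>k\<in>UNIV. \<Lambda> $ j $ k * w k) + w j))"
    by (rule generator_step) blast
  obtain d where d: "d > 0" "\<And>i z z' q. dist z z' < d \<Longrightarrow> norm q \<le> R \<Longrightarrow> \<bar>L i (torus_proj z) q - L i (torus_proj z') q\<bar> < e"
    by (rule L_uniformly_continuous[OF e, where R=R]) blast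
  obtain DG where DG: "DG \<ge> 0" "AE \<omega> in PI i. \<forall>t. 0 \<le> t \<longrightarrow> t \<le> T \<longrightarrow> \<bar>G t \<omega>\<bar> \<le> DG" by (rule G_bound)
  \<comment> \<open>At speed at most \<open>R\<close> the trajectory stays within \<open>d\<close>
    of its initial position during a step.\<close>
  define h0 where "h0 = min 1 (d / (2 * R))"
  have h0: "h0 > 0" using d R by (simp add: h0_def)
  \<comment> \<open>The three terms come from the generator step, from the wrong index in the
    running cost, and from the paraboloid over a displacement of at most
    \<open>R * h\<close>.\<close>
  define c where "c = c0 * B + 2 * C * J + K * R\<^sup>2"
  have c: "c \<ge> 0" using c0 B_nonneg C J K by (simp add: c_def)
  define N where "N = (\<Sum>i\<in>UNIV. \<Sum>j\<in>UNIV. \<bar>\<Lambda> $ i $ j\<bar>) * B"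
  have "- c * h\<^sup>2 \<le> (LINT \<omega>|PI i. of_bool (D \<omega>) * (G (s + h) \<omega> - G s \<omega>))"
    if s: "0 \<le> s" and h: "0 < h" "h \<le> h0" and sT: "s + h \<le> T" and D: "Measurable.pred (path_filtration s) D" for s h D
  proof -
    have h1: "h \<le> 1" and hR: "R * h < d"
    proof -
      show "h \<le> 1" using h by (simp add: h0_def)
      have "R * h \<le> R * (d / (2 * R))" using h R by (intro mult_left_mono) (auto simp: h0_def)
      also have "\<dots> = d / 2" using R by simp
      finally show "R * h < d" using d(1) by linarith
    qed
    define g where "g j \<omega> = (\<Sum>k\<in>UNIV. \<Lambda> $ j $ k * V k (X s \<omega>))" for j \<omega>
    define \<Phi> where "\<Phi> j \<omega> = of_bool (D \<omega>) * (h * g j \<omega> + V j (X s \<omega>))" for j \<omega>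
    define \<Psi> where "\<Psi> \<omega> = of_bool (D \<omega>) * V (\<omega> s) (X s \<omega>)" for \<omega>
    define S where "S \<omega> = (LINT r:{s..s + h}|lborel. of_bool (\<omega> r \<noteq> \<omega> (s + h)) :: real)" for \<omega> :: "real \<Rightarrow> 'm"
    have S: "integrable (PI i) S" "(LINT \<omega>|PI i. S \<omega>) \<le> J * h\<^sup>2"
      unfolding S_def using J(2)[OF axis_in_simplex, of s "s + h" h i] s h h1 by auto
    have Xm: "X s \<in> borel_measurable (path_filtration s)"
      unfolding X_def[abs_def] by (intro borel_measurable_add borel_measurable_const measurable_displacement_filtration[OF ctl s])
    have Vm: "(\<lambda>\<omega>. V j (X s \<omega>)) \<in> borel_measurable (path_filtration s)" for j
      by (rule measurable_compose[OF Xm V_measurable])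
    have Dm: "(\<lambda>\<omega>. of_bool (D \<omega>) :: real) \<in> borel_measurable (path_filtration s)"
      by (rule measurable_compose[OF D]) simp
    have \<Phi>m: "\<Phi> j \<in> borel_measurable (path_filtration s)" for j
      unfolding \<Phi>_def[abs_def] g_def
      by (intro borel_measurable_times borel_measurable_add borel_measurable_sum borel_measurable_const Vm Dm)
    have gb: "\<bar>g j \<omega>\<bar> \<le> N" for j \<omega> unfolding g_def N_def by (rule matrix_row_bound) (rule V_bound)
    have \<Phi>b: "\<bar>\<Phi> j \<omega>\<bar> \<le> N + B" for j \<omega>
    proof -
      have "\<bar>h * g j \<omega>\<bar> \<le> 1 * N" unfolding abs_mult using gb[of j \<omega>] h h1 by (intro mult_mono) auto
      then have "\<bar>h * g j \<omega> + V j (X s \<omega>)\<bar> \<le> N + B" using V_bound[of j "X s \<omega>"] by linarith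
      then show ?thesis by (cases "D \<omega>") (auto simp: \<Phi>_def)
    qed
    note ET = expectation_transition[where \<Phi>=\<Phi>, OF axis_in_simplex[of i] s h(1) \<Phi>m \<Phi>b]
    have \<Psi>i: "integrable (PI i) \<Psi>"
    proof (rule integrable_const_bound[where B=B])
      show "AE \<omega> in PI i. norm (\<Psi> \<omega>) \<le> B" using V_bound B_nonneg by (auto simp: \<Psi>_def)
      have ws: "(\<lambda>\<omega>. \<omega> s) \<in> path_filtration s \<rightarrow>\<^sub>M (count_space UNIV :: 'm measure)"
        by (rule measurable_eval_discrete) (use s in simp)
      have "(\<lambda>\<omega>. V (\<omega> s) (X s \<omega>)) \<in> borel_measurable (path_filtration s)"
        by (rule measurable_compose_countable'[where f="\<lambda>j \<omega>. V j (X s \<omega>)", OF Vm ws countable_finite[OF finite]])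
      then have "\<Psi> \<in> borel_measurable (path_filtration s)"
        unfolding \<Psi>_def[abs_def] by (intro borel_measurable_times Dm)
      from measurable_eval_algebra_mono[OF this, of "{0..}"]
      show "\<Psi> \<in> borel_measurable (PI i)" by (simp add: measurable_P)
    qed
    have step: "\<Phi> (\<omega> (s + h)) \<omega> - \<Psi> \<omega> - 2 * C * S \<omega> - K * R\<^sup>2 * h\<^sup>2 \<le> of_bool (D \<omega>) * (G (s + h) \<omega> - G s \<omega>)"
      if w: "\<omega> \<in> index_paths" and wR: "\<forall>s. 0 \<le> s \<longrightarrow> s \<le> T \<longrightarrow> norm (\<Xi> \<omega> s) \<le> R" for \<omega>
    proof -
      have xi: "\<Xi> \<omega> \<in> vector_paths" by (rule control_in[OF ctl w])
      define l where "l = \<omega> (s + h)"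
      define a where "a = X s \<omega>"
      define W where "W = (LINT r:{s..s + h}|lborel. \<Xi> \<omega> r)"
      have Rr: "norm (\<Xi> \<omega> r) \<le> R" if "s \<le> r" "r \<le> s + h" for r using wR that s sT by auto
      have X1: "X (s + h) \<omega> = a + W"
        unfolding X_def a_def W_def using displacement_split[OF xi s, of "s + h"] h by simp
      have nW: "norm W \<le> R * h"
        unfolding W_def using set_integral_norm_le[of s "s + h" "\<Xi> \<omega>" R] Rr h R by simp
      obtain p where p: "\<And>w. V l a + p \<bullet> w - K * (norm w)\<^sup>2 \<le> V l (a + w)"
        "\<And>\<xi>. norm \<xi> \<le> R \<Longrightarrow> (\<Sum>k\<in>UNIV. \<Lambda> $ l $ k * V k a) - \<alpha> - e \<le> p \<bullet> \<xi> + L l (torus_proj a) (- \<xi>)"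
        using touch[of l a] by blast
      have xint: "set_integrable lborel {s..s + h} (\<Xi> \<omega>)" by (rule vector_path_set_integrable[OF xi s])
      have pint: "set_integrable lborel {s..s + h} (\<lambda>r. p \<bullet> \<Xi> \<omega> r)"
        using integrable_inner_right[of p lborel "\<lambda>r. indicator {s..s + h} r *\<^sub>R \<Xi> \<omega> r"] xint
        unfolding set_integrable_def by simp
      have pW: "p \<bullet> W = (LINT r:{s..s + h}|lborel. p \<bullet> \<Xi> \<omega> r)"
        unfolding W_def set_lebesgue_integral_def
        using integral_inner_right[of p lborel "\<lambda>r. indicator {s..s + h} r *\<^sub>R \<Xi> \<omega> r"] xint
        unfolding set_integrable_def by simp
      have rint: "set_integrable lborel {s..s + h} (rate (\<alpha> + 2 * e) z \<omega> (\<Xi> \<omega>))"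
        by (rule rate_set_integrable[OF w xi s])
      have jint: "set_integrable lborel {s..s + h} (\<lambda>r. of_bool (\<omega> r \<noteq> \<omega> (s + h)) :: real)"
      proof (rule set_integrable_bounded[where B=1])
        have "(\<lambda>r. (\<omega>, r)) \<in> borel \<rightarrow>\<^sub>M PI i \<Otimes>\<^sub>M borel" using w by (intro measurable_Pair1') simp
        from measurable_compose[OF this measurable_jump[OF axis_in_simplex, of "s + h"]] s h
        show "(\<lambda>r. of_bool (\<omega> (max 0 r) \<noteq> \<omega> (s + h)) :: real) \<in> borel_measurable borel" by simp
      qed (use s in auto)
      have jint2: "set_integrable lborel {s..s + h} (\<lambda>r. 2 * C * of_bool (\<omega> r \<noteq> \<omega> (s + h)))"
        by (intro set_integrable_mult_right) (rule jint)
      have cint: "set_integrable lborel {s..s + h} (\<lambda>r. g l \<omega>)" by (intro borel_integrable_atLeastAtMost' continuous_on_const)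
      \<comment> \<open>The touching slope is fixed during the whole step, while its inequality is
        applied to the actual velocity at each instant; integration turns the velocities into the
        displacement \<open>W\<close>.\<close>
      have pt: "g l \<omega> \<le> p \<bullet> \<Xi> \<omega> r + rate (\<alpha> + 2 * e) z \<omega> (\<Xi> \<omega>) r + 2 * C * of_bool (\<omega> r \<noteq> \<omega> (s + h))"
        if r: "r \<in> {s..s + h}" for r
      proof -
        have nr: "norm (\<Xi> \<omega> r) \<le> R" using Rr r by simp
        define x where "x = z + displacement (\<Xi> \<omega>) r"
        have "norm (x - a) \<le> R * (r - s)"
          unfolding x_def a_def X_def
          using displacement_lipschitz[OF xi s, of r R] Rr r R by simp
        also have "\<dots> \<le> R * h" using r R by (intro mult_left_mono) auto
        finally have "dist a x < d" using hR by (simp add: dist_norm norm_minus_commute)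
        then have "\<bar>L l (torus_proj a) (- \<Xi> \<omega> r) - L l (torus_proj x) (- \<Xi> \<omega> r)\<bar> < e"
          using nr by (intro d(2)) simp_all
        then have 1: "L l (torus_proj a) (- \<Xi> \<omega> r) \<le> L l (torus_proj x) (- \<Xi> \<omega> r) + e" by linarith
        have 2: "L l (torus_proj x) (- \<Xi> \<omega> r) \<le> L (\<omega> r) (torus_proj x) (- \<Xi> \<omega> r) + 2 * C * of_bool (\<omega> r \<noteq> \<omega> (s + h))"
        proof (cases "\<omega> r = l")
          case True
          then show ?thesis using C(1) by simp
        next
          case False
          have "\<bar>L l (torus_proj x) (- \<Xi> \<omega> r)\<bar> \<le> C" "\<bar>L (\<omega> r) (torus_proj x) (- \<Xi> \<omega> r)\<bar> \<le> C"
            using nr by (intro C(2); simp)+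
          then show ?thesis using False unfolding l_def by (simp add: abs_le_iff)
        qed
        have "g l \<omega> - \<alpha> - e \<le> p \<bullet> \<Xi> \<omega> r + L l (torus_proj a) (- \<Xi> \<omega> r)"
          using p(2)[OF nr] unfolding g_def a_def .
        with 1 2 show ?thesis unfolding rate_def x_def[symmetric] by linarith
      qed
      have "h * g l \<omega> = (LINT r:{s..s + h}|lborel. g l \<omega>)" using h by (simp add: set_integral_const)
      also have "\<dots> \<le> (LINT r:{s..s + h}|lborel. p \<bullet> \<Xi> \<omega> r + rate (\<alpha> + 2 * e) z \<omega> (\<Xi> \<omega>) r + 2 * C * of_bool (\<omega> r \<noteq> \<omega> (s + h)))"
        by (rule set_integral_mono[OF cint set_integral_add(1)[OF set_integral_add(1)[OF pint rint] jint2] pt])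
      also have "\<dots> = p \<bullet> W + (LINT r:{s..s + h}|lborel. rate (\<alpha> + 2 * e) z \<omega> (\<Xi> \<omega>) r) + 2 * C * S \<omega>"
        unfolding set_integral_add(2)[OF set_integral_add(1)[OF pint rint] jint2] set_integral_add(2)[OF pint rint] pW S_def
        by simp
      finally have A1: "h * g l \<omega> \<le> p \<bullet> W + (LINT r:{s..s + h}|lborel. rate (\<alpha> + 2 * e) z \<omega> (\<Xi> \<omega>) r) + 2 * C * S \<omega>" .
      have "(norm W)\<^sup>2 \<le> (R * h)\<^sup>2" using nW by (intro power_mono) auto
      then have "K * (norm W)\<^sup>2 \<le> K * R\<^sup>2 * h\<^sup>2"
        using mult_left_mono[OF _ K] by (simp add: power_mult_distrib mult.assoc)
      with p(1)[of W] have A2: "V l a + p \<bullet> W - K * R\<^sup>2 * h\<^sup>2 \<le> V l (a + W)" by linarith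
      have A3: "G (s + h) \<omega> - G s \<omega> = (LINT r:{s..s + h}|lborel. rate (\<alpha> + 2 * e) z \<omega> (\<Xi> \<omega>) r) + V l (a + W) - V (\<omega> s) a"
        unfolding G_def X1 using running_cost_split[OF w xi s, of "s + h" "\<alpha> + 2 * e" z] h
        by (simp add: l_def a_def)
      have "S \<omega> \<ge> 0" unfolding S_def set_lebesgue_integral_def by (rule Bochner_Integration.integral_nonneg) simp
      then have S0: "2 * C * S \<omega> \<ge> 0" using C(1) by simp
      have K0: "K * R\<^sup>2 * h\<^sup>2 \<ge> 0" using K by simp
      show ?thesis
      proof (cases "D \<omega>")
        case True
        then show ?thesis using A1 A2 A3 by (simp add: \<Phi>_def \<Psi>_def l_def a_def)
      next
        case False
        \<comment> \<open>Off the event \<open>D\<close> both functions vanish and only the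
          nonpositive error terms are left.\<close>
        then show ?thesis using S0 K0 by (simp add: \<Phi>_def \<Psi>_def)
      qed
    qed
    have iG: "integrable (PI i) (\<lambda>\<omega>. of_bool (D \<omega>) * (G (s + h) \<omega> - G s \<omega>))"
    proof (rule integrable_const_bound[where B="2 * DG"])
      show "AE \<omega> in PI i. norm (of_bool (D \<omega>) * (G (s + h) \<omega> - G s \<omega>)) \<le> 2 * DG"
        using DG(2)
      proof eventually_elim
        fix \<omega> assume "\<forall>t. 0 \<le> t \<longrightarrow> t \<le> T \<longrightarrow> \<bar>G t \<omega>\<bar> \<le> DG"
        then have "\<bar>G (s + h) \<omega>\<bar> \<le> DG" "\<bar>G s \<omega>\<bar> \<le> DG" using s h sT by auto
        then show "norm (of_bool (D \<omega>) * (G (s + h) \<omega> - G s \<omega>)) \<le> 2 * DG" by (cases "D \<omega>") auto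
      qed
      have "(\<lambda>\<omega>. of_bool (D \<omega>) :: real) \<in> borel_measurable (PI i)"
        using measurable_eval_algebra_mono[OF Dm, of "{0..}"] by (simp add: measurable_P)
      then show "(\<lambda>\<omega>. of_bool (D \<omega>) * (G (s + h) \<omega> - G s \<omega>)) \<in> borel_measurable (PI i)"
        using s h by (intro borel_measurable_times borel_measurable_diff G_measurable) auto
    qed
    define sQ where "sQ \<omega> = (\<Sum>j\<in>UNIV. Q h $ \<omega> s $ j * \<Phi> j \<omega>)" for \<omega>
    have "(LINT \<omega>|PI i. - c0 * B * h\<^sup>2) \<le> (LINT \<omega>|PI i. sQ \<omega> - \<Psi> \<omega>)"
    proof (rule integral_mono)
      show "integrable (PI i) (\<lambda>\<omega>. sQ \<omega> - \<Psi> \<omega>)"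
        unfolding sQ_def by (intro Bochner_Integration.integrable_diff ET(2) \<Psi>i)
      fix \<omega>
      have "V (\<omega> s) (X s \<omega>) - c0 * B * h\<^sup>2 \<le> (\<Sum>j\<in>UNIV. Q h $ \<omega> s $ j * (h * g j \<omega> + V j (X s \<omega>)))"
        unfolding g_def by (rule c0(2)[of h "\<lambda>j. V j (X s \<omega>)" B "\<omega> s"]) (use h h1 V_bound in auto)
      moreover have "c0 * B * h\<^sup>2 \<ge> 0" using c0 B_nonneg by simp
      ultimately show "- c0 * B * h\<^sup>2 \<le> sQ \<omega> - \<Psi> \<omega>"
        by (cases "D \<omega>") (auto simp: sQ_def \<Psi>_def \<Phi>_def)
    qed simp
    then have E1: "- c0 * B * h\<^sup>2 \<le> (LINT \<omega>|PI i. \<Phi> (\<omega> (s + h)) \<omega>) - (LINT \<omega>|PI i. \<Psi> \<omega>)"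
      unfolding ET(3) sQ_def using prob_space Bochner_Integration.integral_diff[OF ET(2) \<Psi>i] by simp
    have "(LINT \<omega>|PI i. \<Phi> (\<omega> (s + h)) \<omega> - \<Psi> \<omega> - 2 * C * S \<omega> - K * R\<^sup>2 * h\<^sup>2) \<le> (LINT \<omega>|PI i. of_bool (D \<omega>) * (G (s + h) \<omega> - G s \<omega>))"
    proof (rule integral_mono_AE)
      show "integrable (PI i) (\<lambda>\<omega>. \<Phi> (\<omega> (s + h)) \<omega> - \<Psi> \<omega> - 2 * C * S \<omega> - K * R\<^sup>2 * h\<^sup>2)"
        by (intro Bochner_Integration.integrable_diff ET(1) \<Psi>i integrable_mult_right S(1) integrable_const)
      show "AE \<omega> in PI i. \<Phi> (\<omega> (s + h)) \<omega> - \<Psi> \<omega> - 2 * C * S \<omega> - K * R\<^sup>2 * h\<^sup>2 \<le> of_bool (D \<omega>) * (G (s + h) \<omega> - G s \<omega>)"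
        using \<Xi>_bound AE_space by eventually_elim (rule step, simp_all)
    qed (rule iG)
    moreover have "(LINT \<omega>|PI i. \<Phi> (\<omega> (s + h)) \<omega> - \<Psi> \<omega> - 2 * C * S \<omega> - K * R\<^sup>2 * h\<^sup>2) =
      (LINT \<omega>|PI i. \<Phi> (\<omega> (s + h)) \<omega>) - (LINT \<omega>|PI i. \<Psi> \<omega>) - 2 * C * (LINT \<omega>|PI i. S \<omega>) - K * R\<^sup>2 * h\<^sup>2"
    proof -
      have i1: "integrable (PI i) (\<lambda>\<omega>. \<Phi> (\<omega> (s + h)) \<omega> - \<Psi> \<omega>)" by (intro Bochner_Integration.integrable_diff ET(1) \<Psi>i)
      have i2: "integrable (PI i) (\<lambda>\<omega>. 2 * C * S \<omega>)" by (intro integrable_mult_right S(1))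
      show ?thesis
        using prob_space
        by (simp add: Bochner_Integration.integral_diff[OF Bochner_Integration.integrable_diff[OF i1 i2] integrable_const]
            Bochner_Integration.integral_diff[OF i1 i2] Bochner_Integration.integral_diff[OF ET(1) \<Psi>i])
    qed
    moreover have "2 * C * (LINT \<omega>|PI i. S \<omega>) \<le> 2 * C * (J * h\<^sup>2)" using S(2) C(1) by (intro mult_left_mono) auto
    ultimately show ?thesis using E1 unfolding c_def by (simp add: algebra_simps)
  qed
  with c h0 that show ?thesis by blast
qed

lemma G_tendsto:
  assumes w: "\<omega> \<in> index_paths" and t: "0 \<le> t"
  shows "((\<lambda>s. G s \<omega>) \<longlongrightarrow> G t \<omega>) (at_right t)"
proof -
  have xi: "\<Xi> \<omega> \<in> vector_paths" by (rule control_in[OF ctl w])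
  have "((\<lambda>s. X s \<omega>) \<longlongrightarrow> X t \<omega>) (at_right t)"
    unfolding X_def by (intro tendsto_intros displacement_tendsto[OF xi t])
  from isCont_tendsto_compose[OF V_isCont this]
  have 1: "((\<lambda>s. V (\<omega> t) (X s \<omega>)) \<longlongrightarrow> V (\<omega> t) (X t \<omega>)) (at_right t)" .
  have "\<forall>\<^sub>F s in at_right t. \<omega> s = \<omega> t" using w t unfolding index_paths_iff by blast
  then have "\<forall>\<^sub>F s in at_right t. V (\<omega> t) (X s \<omega>) = V (\<omega> s) (X s \<omega>)" by eventually_elim simp
  from Lim_transform_eventually[OF 1 this]
  show ?thesis unfolding G_def by (intro tendsto_add running_cost_tendsto[OF w xi t])
qed

text \<open>The stopping time is rounded up to a grid. Whether a grid step still takes place,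
  \<open>real k * h n < \<tau> \<omega>\<close>, is known at its beginning, so each step contributes
  at least \<open>- c * (h n)\<^sup>2\<close>. The total loss is \<open>c * T * h n\<close>. Right
  continuity of \<open>G\<close> removes the rounding in the limit.\<close>

lemma verification:
  assumes \<tau>: "bounded_stopping_time \<tau>" and \<tau>T: "\<And>\<omega>. \<omega> \<in> index_paths \<Longrightarrow> \<tau> \<omega> \<le> T"
  shows "V i z \<le> (LINT \<omega>|PI i. G (\<tau> \<omega>) \<omega>)"
proof -
  interpret prob_space "PI i" by (rule prob_space_P[OF axis_in_simplex])
  have \<tau>0: "0 \<le> \<tau> \<omega>" if "\<omega> \<in> index_paths" for \<omega> using \<tau> that unfolding bounded_stopping_time_def by blast
  note \<tau>m = bounded_stopping_time_measurable[OF \<tau>]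
  obtain c h0 where c: "c \<ge> 0" and h0: "h0 > 0" and step: "\<And>s h D. 0 \<le> s \<Longrightarrow> 0 < h \<Longrightarrow> h \<le> h0 \<Longrightarrow> s + h \<le> T \<Longrightarrow>
    Measurable.pred (path_filtration s) D \<Longrightarrow>
    - c * h\<^sup>2 \<le> (LINT \<omega>|PI i. of_bool (D \<omega>) * (G (s + h) \<omega> - G s \<omega>))"
    by (rule G_step) blast
  obtain DG where DG: "DG \<ge> 0" "AE \<omega> in PI i. \<forall>t. 0 \<le> t \<longrightarrow> t \<le> T \<longrightarrow> \<bar>G t \<omega>\<bar> \<le> DG" by (rule G_bound)
  define h where "h n = T / real (Suc n)" for n
  \<comment> \<open>Rounding up keeps the rounded times to the right of \<open>\<tau>\<close>, the
    side on which paths are continuous.\<close>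
  define N where "N n \<omega> = nat \<lceil>\<tau> \<omega> / h n\<rceil>" for n \<omega>
  define \<sigma> where "\<sigma> n \<omega> = real (N n \<omega>) * h n" for n \<omega>
  have h: "h n > 0" for n using T by (simp add: h_def)
  have hT: "real (Suc n) * h n = T" for n by (simp add: h_def)
  have N_le: "N n \<omega> \<le> Suc n" if w: "\<omega> \<in> index_paths" for n \<omega>
  proof -
    have "\<tau> \<omega> / h n \<le> T / h n" using \<tau>T[OF w] h[of n] by (intro divide_right_mono) auto
    also have "T / h n = real (Suc n)" using T by (simp add: h_def)
    finally show ?thesis unfolding N_def by (simp add: nat_le_iff ceiling_le_iff)
  qed
  have N_iff: "k < N n \<omega> \<longleftrightarrow> real k * h n < \<tau> \<omega>" for k n \<omega>
  proof -
    have "k < N n \<omega> \<longleftrightarrow> int k < \<lceil>\<tau> \<omega> / h n\<rceil>" unfolding N_def by linarith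
    also have "\<dots> \<longleftrightarrow> real k < \<tau> \<omega> / h n" by (simp add: less_ceiling_iff)
    finally show ?thesis using h[of n] by (simp add: pos_less_divide_eq)
  qed
  have \<sigma>: "0 \<le> \<sigma> n \<omega>" "\<sigma> n \<omega> \<le> T" "\<tau> \<omega> \<le> \<sigma> n \<omega>" "\<sigma> n \<omega> \<le> \<tau> \<omega> + h n" if w: "\<omega> \<in> index_paths" for n \<omega>
  proof -
    have q: "0 \<le> \<tau> \<omega> / h n" using \<tau>0[OF w] h[of n] by simp
    show "0 \<le> \<sigma> n \<omega>" using h[of n] by (simp add: \<sigma>_def)
    have "real (N n \<omega>) * h n \<le> real (Suc n) * h n" using N_le[OF w, of n] h[of n] by (intro mult_right_mono) auto
    then show "\<sigma> n \<omega> \<le> T" unfolding \<sigma>_def hT .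
    have "\<tau> \<omega> / h n \<le> real (N n \<omega>)" unfolding N_def using q by linarith
    then show "\<tau> \<omega> \<le> \<sigma> n \<omega>" using h[of n] by (simp add: \<sigma>_def pos_divide_le_eq)
    have "real (N n \<omega>) \<le> \<tau> \<omega> / h n + 1" unfolding N_def using q by linarith
    then have "real (N n \<omega>) * h n \<le> (\<tau> \<omega> / h n + 1) * h n" using h[of n] by (intro mult_right_mono) auto
    then show "\<sigma> n \<omega> \<le> \<tau> \<omega> + h n" using h[of n] by (simp add: \<sigma>_def distrib_right)
  qed
  have \<sigma>m: "\<sigma> n \<in> borel_measurable path_algebra" for n
    unfolding \<sigma>_def[abs_def] N_def using \<tau>m by measurable
  have Gm: "(\<lambda>\<omega>. G (S \<omega>) \<omega>) \<in> borel_measurable (PI i)" "integrable (PI i) (\<lambda>\<omega>. G (S \<omega>) \<omega>)"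
    if S: "S \<in> borel_measurable path_algebra" "\<And>\<omega>. \<omega> \<in> index_paths \<Longrightarrow> 0 \<le> S \<omega> \<and> S \<omega> \<le> T" for S
  proof -
    show m: "(\<lambda>\<omega>. G (S \<omega>) \<omega>) \<in> borel_measurable (PI i)" by (rule G_measurable) (use S in auto)
    show "integrable (PI i) (\<lambda>\<omega>. G (S \<omega>) \<omega>)"
    proof (rule integrable_const_bound[OF _ m])
      show "AE \<omega> in PI i. norm (G (S \<omega>) \<omega>) \<le> DG"
        using DG(2) AE_space by eventually_elim (use S(2) in simp)
    qed
  qed
  have start: "AE \<omega> in PI i. G 0 \<omega> = V i z"
  proof -
    have "(LINT s:{0..0}|lborel. f s) = 0" for f :: "real \<Rightarrow> 'b::{banach, second_countable_topology}"
      using set_integral_norm_le[of 0 0 "\<lambda>s. f s" "norm (f 0)"] by simp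
    then have zero: "running_cost (\<alpha> + 2 * e) z \<omega> (\<Xi> \<omega>) 0 = 0" "displacement (\<Xi> \<omega>) 0 = 0" for \<omega>
      unfolding running_cost_def displacement_def by blast+
    show ?thesis using AE_initial_state[of i] by eventually_elim (simp add: G_def X_def zero)
  qed
  have G0: "(LINT \<omega>|PI i. G 0 \<omega>) = V i z"
  proof -
    have "(LINT \<omega>|PI i. G 0 \<omega>) = (LINT \<omega>|PI i. V i z)"
      by (rule integral_cong_AE) (use start G_measurable[of "\<lambda>_. 0"] in auto)
    then show ?thesis using prob_space by simp
  qed
  have lower: "V i z - c * T * h n \<le> (LINT \<omega>|PI i. G (\<sigma> n \<omega>) \<omega>)" if hn: "h n \<le> h0" for n
  proof -
    define F where "F k \<omega> = of_bool (real k * h n < \<tau> \<omega>) * (G (real (Suc k) * h n) \<omega> - G (real k * h n) \<omega>)" for k \<omega>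
    have tele: "(\<Sum>k<Suc n. F k \<omega>) = G (\<sigma> n \<omega>) \<omega> - G 0 \<omega>" if w: "\<omega> \<in> index_paths" for \<omega>
    proof -
      have "(\<Sum>k<Suc n. F k \<omega>) = (\<Sum>k<N n \<omega>. F k \<omega>)"
        by (rule sum.mono_neutral_right) (use N_le[OF w, of n] in \<open>auto simp: F_def N_iff[symmetric]\<close>)
      also have "\<dots> = (\<Sum>k<N n \<omega>. G (real (Suc k) * h n) \<omega> - G (real k * h n) \<omega>)"
        by (rule sum.cong) (auto simp: F_def N_iff)
      also have "\<dots> = G (\<sigma> n \<omega>) \<omega> - G 0 \<omega>"
        by (subst sum_lessThan_telescope) (simp add: \<sigma>_def)
      finally show ?thesis .
    qed
    have grid: "real k * h n + h n \<le> T" if "k < Suc n" for k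
    proof -
      have "real (Suc k) * h n \<le> real (Suc n) * h n" using that h[of n] by (intro mult_right_mono) auto
      then show ?thesis unfolding hT by (simp add: distrib_right add.commute)
    qed
    have kh0: "0 \<le> real k * h n" for k using h[of n] by simp
    have Fi: "integrable (PI i) (F k)" if k: "k < Suc n" for k
    proof (rule integrable_const_bound[where B="2 * DG"])
      show "AE \<omega> in PI i. norm (F k \<omega>) \<le> 2 * DG"
        using DG(2)
      proof eventually_elim
        fix \<omega> assume b: "\<forall>t. 0 \<le> t \<longrightarrow> t \<le> T \<longrightarrow> \<bar>G t \<omega>\<bar> \<le> DG"
        have "real (Suc k) * h n \<le> T" "real k * h n \<le> T" using grid[OF k] h[of n] by (simp_all add: distrib_right add.commute)
        then have "\<bar>G (real (Suc k) * h n) \<omega>\<bar> \<le> DG" "\<bar>G (real k * h n) \<omega>\<bar> \<le> DG" using b kh0 by blast+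
        then show "norm (F k \<omega>) \<le> 2 * DG" by (cases "real k * h n < \<tau> \<omega>") (auto simp: F_def)
      qed
      have "\<tau> \<in> borel_measurable (PI i)" using \<tau>m by (simp add: measurable_P)
      then have "(\<lambda>\<omega>. of_bool (real k * h n < \<tau> \<omega>) :: real) \<in> borel_measurable (PI i)" by measurable
      moreover have "(\<lambda>\<omega>. G (real k * h n) \<omega>) \<in> borel_measurable (PI i)" for k
        by (rule G_measurable) (use kh0 in auto)
      ultimately show "F k \<in> borel_measurable (PI i)"
        unfolding F_def[abs_def] by (intro borel_measurable_times borel_measurable_diff)
    qed
    \<comment> \<open>The \<open>Suc n\<close> steps of length \<open>h n\<close> fill the interval
      up to \<open>T\<close> exactly, so one factor \<open>h n\<close> is used up by their
      number.\<close>
    have "- c * T * h n = (\<Sum>k<Suc n. - c * (h n)\<^sup>2)"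
      using hT[of n] by (simp add: power2_eq_square)
    also have "\<dots> \<le> (\<Sum>k<Suc n. LINT \<omega>|PI i. F k \<omega>)"
    proof (rule sum_mono)
      fix k assume "k \<in> {..<Suc n}"
      then have k: "k < Suc n" by simp
      have "Measurable.pred (path_filtration (real k * h n)) (\<lambda>\<omega>. real k * h n < \<tau> \<omega>)"
        using \<tau> unfolding bounded_stopping_time_def by (intro stopping_timeD2) blast
      from step[OF kh0 h hn grid[OF k] this]
      show "- c * (h n)\<^sup>2 \<le> (LINT \<omega>|PI i. F k \<omega>)"
        unfolding F_def by (simp add: distrib_right add.commute)
    qed
    also have "\<dots> = (LINT \<omega>|PI i. (\<Sum>k<Suc n. F k \<omega>))"
      by (rule Bochner_Integration.integral_sum[symmetric]) (use Fi in simp)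
    also have "\<dots> = (LINT \<omega>|PI i. G (\<sigma> n \<omega>) \<omega> - G 0 \<omega>)"
      by (rule Bochner_Integration.integral_cong[OF refl]) (simp only: tele space_P[OF axis_in_simplex])
    also have "\<dots> = (LINT \<omega>|PI i. G (\<sigma> n \<omega>) \<omega>) - V i z"
      unfolding G0[symmetric]
      by (rule Bochner_Integration.integral_diff) (use Gm(2)[of "\<sigma> n"] Gm(2)[of "\<lambda>_. 0"] \<sigma> \<sigma>m T in auto)
    finally show ?thesis by simp
  qed
  have h_lim: "h \<longlonglongrightarrow> 0"
    unfolding h_def[abs_def] using tendsto_mult[OF tendsto_const LIMSEQ_inverse_real_of_nat, of T]
    by (simp add: divide_inverse)
  have lim: "(\<lambda>n. LINT \<omega>|PI i. G (\<sigma> n \<omega>) \<omega>) \<longlonglongrightarrow> (LINT \<omega>|PI i. G (\<tau> \<omega>) \<omega>)"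
  proof (rule integral_dominated_convergence[where w="\<lambda>_. DG"])
    show "(\<lambda>\<omega>. G (\<tau> \<omega>) \<omega>) \<in> borel_measurable (PI i)" by (rule Gm(1)) (use \<tau>m \<tau>0 \<tau>T in auto)
    show "(\<lambda>\<omega>. G (\<sigma> n \<omega>) \<omega>) \<in> borel_measurable (PI i)" for n by (rule Gm(1)) (use \<sigma>m \<sigma> in auto)
    show "AE \<omega> in PI i. norm (G (\<sigma> n \<omega>) \<omega>) \<le> DG" for n
      using DG(2) AE_space by eventually_elim (use \<sigma> in simp)
    show "AE \<omega> in PI i. (\<lambda>n. G (\<sigma> n \<omega>) \<omega>) \<longlonglongrightarrow> G (\<tau> \<omega>) \<omega>"
    proof (rule AE_I2)
      fix \<omega> assume "\<omega> \<in> space (PI i)"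
      then have w: "\<omega> \<in> index_paths" by simp
      \<comment> \<open>Rounded times may coincide with \<open>\<tau> \<omega>\<close>, so
        continuity within the closed half-line is used instead of a limit along
        \<open>at_right\<close>.\<close>
      have right: "continuous (at (\<tau> \<omega>) within {\<tau> \<omega>..}) (\<lambda>t. G t \<omega>)"
        unfolding continuous_within at_within_Ici_at_right by (rule G_tendsto[OF w \<tau>0[OF w]])
      have "(\<lambda>n. \<sigma> n \<omega>) \<longlonglongrightarrow> \<tau> \<omega>"
      proof (rule real_tendsto_sandwich[of "\<lambda>_. \<tau> \<omega>" _ _ "\<lambda>n. \<tau> \<omega> + h n"])
        show "(\<lambda>n. \<tau> \<omega> + h n) \<longlonglongrightarrow> \<tau> \<omega>" using tendsto_add[OF tendsto_const h_lim, of "\<tau> \<omega>"] by simp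
      qed (use \<sigma>[OF w] in auto)
      then show "(\<lambda>n. G (\<sigma> n \<omega>) \<omega>) \<longlonglongrightarrow> G (\<tau> \<omega>) \<omega>"
        by (intro continuous_within_tendsto_compose[OF right]) (use \<sigma>(3)[OF w] in auto)
    qed
  qed simp
  have "(\<lambda>n. V i z - c * T * h n) \<longlonglongrightarrow> V i z - c * T * 0"
    by (intro tendsto_intros h_lim)
  moreover have "\<forall>\<^sub>F n in sequentially. V i z - c * T * h n \<le> (LINT \<omega>|PI i. G (\<sigma> n \<omega>) \<omega>)"
    using order_tendstoD(2)[OF h_lim h0] by eventually_elim (rule lower, simp)
  ultimately show ?thesis
    using tendsto_le[OF sequentially_bot lim] by simp
qed

end

section \<open>Lower bound of the cost by subsolutions\<close>

context controlled_system begin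

lemma running_cost_add:
  assumes "\<omega> \<in> index_paths" "\<xi> \<in> vector_paths" "0 \<le> t"
  shows "running_cost (\<alpha> + \<beta>) z \<omega> \<xi> t = running_cost \<alpha> z \<omega> \<xi> t + \<beta> * t"
proof -
  have 1: "set_integrable lborel {0..t} (rate \<alpha> z \<omega> \<xi>)" by (intro rate_set_integrable assms(1,2) order_refl)
  have 2: "set_integrable lborel {0..t} (\<lambda>_. \<beta>)" by (intro borel_integrable_atLeastAtMost' continuous_on_const)
  have "rate (\<alpha> + \<beta>) z \<omega> \<xi> = (\<lambda>s. rate \<alpha> z \<omega> \<xi> s + \<beta>)" by (simp add: rate_def fun_eq_iff)
  then show ?thesis
    unfolding running_cost_def using set_integral_add(2)[OF 1 2] set_integral_const[OF assms(3), of \<beta>] by simp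
qed

text \<open>The terminal cost is \<open>u\<close> at the target because controls in
  \<open>controls_to\<close> are there almost surely at time \<open>\<tau>\<close>. Replacing
  \<open>u\<close> by \<open>V\<close> costs \<open>e\<close> at either end and the raised level
  costs \<open>2 * e\<close> per unit of time, in total \<open>(2 + 2 * T) * e\<close>, which
  vanishes with \<open>e\<close>.\<close>

lemma subsolution_le_cost:
  assumes sub: "subsolution H \<Lambda> \<alpha> u" and \<tau>: "bounded_stopping_time \<tau>"
    and \<Xi>: "\<Xi> \<in> controls_to P \<tau> (y - torus_proj z)"
  shows "u (torus_proj z) $ i \<le> cost P L \<alpha> (u y) i (torus_proj z) \<tau> \<Xi>"
proof -
  interpret prob_space "PI i" by (rule prob_space_P[OF axis_in_simplex])
  obtain T where T0: "T > 0" "\<And>\<omega>. \<omega> \<in> index_paths \<Longrightarrow> 0 \<le> \<tau> \<omega> \<and> \<tau> \<omega> \<le> T"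
    by (rule bounded_stopping_time_bounds[OF \<tau>]) blast
  have ctl: "control P \<Xi>" using \<Xi> by (simp add: controls_to_def)
  obtain R where R0: "R > 0" "\<And>j. AE \<omega> in PI j. \<forall>s. 0 \<le> s \<longrightarrow> s \<le> T \<longrightarrow> norm (\<Xi> \<omega> s) \<le> R"
    by (rule control_bounded[OF ctl, of T]) blast
  obtain B where B0: "B \<ge> 0" "\<And>x i. \<bar>u x $ i\<bar> \<le> B" by (rule subsolution_bounded[OF sub]) blast
  have hit: "AE \<omega> in PI i. torus_proj (z + displacement (\<Xi> \<omega>) (\<tau> \<omega>)) = y"
  proof -
    have "AE \<omega> in PI i. torus_primitive (\<Xi> \<omega>) (\<tau> \<omega>) = y - torus_proj z"
      using \<Xi> by (simp add: controls_to_def almost_surely_iff)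
    then show ?thesis by eventually_elim (simp add: torus_primitive_eq torus_proj_add)
  qed
  have "u (torus_proj z) $ i \<le> (LINT \<omega>|PI i. total_cost \<alpha> (u y) z \<tau> \<Xi> \<omega>) + (2 + 2 * T) * e" if e: "e > 0" for e
  proof -
    obtain V K K1 where V0: "\<And>j a. \<bar>V j a - u (torus_proj a) $ j\<bar> \<le> e" "K \<ge> 0" "K1 \<ge> 0"
      "\<And>j a. \<exists>p. norm p \<le> K1 \<and> (\<forall>w. V j a + p \<bullet> w - K * (norm w)\<^sup>2 \<le> V j (a + w)) \<and>
       (\<forall>\<xi>. norm \<xi> \<le> R \<longrightarrow> (\<Sum>k\<in>UNIV. \<Lambda> $ j $ k * V k a) - \<alpha> - e \<le> p \<bullet> \<xi> + L j (torus_proj a) (- \<xi>))"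
      by (rule sup_convolution[OF sub e, where R=R]) blast
    have VB: "\<bar>V j a\<bar> \<le> B + e" for j a using V0(1)[of j a] B0(2)[of "torus_proj a" j] by linarith
    interpret touching_family H \<Lambda> P V "B + e" K K1 R e \<alpha> \<Xi> T i z
      by unfold_locales (rule VB V0(2-4) e R0 T0(1) ctl)+
    have "u (torus_proj z) $ i \<le> V i z + e" using V0(1)[of i z] by linarith
    also have "V i z \<le> (LINT \<omega>|PI i. G (\<tau> \<omega>) \<omega>)" by (rule verification[OF \<tau>]) (use T0(2) in blast)
    also have "\<dots> \<le> (LINT \<omega>|PI i. total_cost \<alpha> (u y) z \<tau> \<Xi> \<omega> + (2 * T + 1) * e)"
    proof (rule integral_mono_AE)
      obtain DG where DG: "DG \<ge> 0" "AE \<omega> in PI i. \<forall>t. 0 \<le> t \<longrightarrow> t \<le> T \<longrightarrow> \<bar>G t \<omega>\<bar> \<le> DG" by (rule G_bound)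
      show "integrable (PI i) (\<lambda>\<omega>. G (\<tau> \<omega>) \<omega>)"
      proof (rule integrable_const_bound)
        show "AE \<omega> in PI i. norm (G (\<tau> \<omega>) \<omega>) \<le> DG"
          using DG(2) AE_space by eventually_elim (use T0(2) in simp)
        show "(\<lambda>\<omega>. G (\<tau> \<omega>) \<omega>) \<in> borel_measurable (PI i)"
          by (rule G_measurable[OF bounded_stopping_time_measurable[OF \<tau>]]) (use T0(2) in blast)
      qed
      show "integrable (PI i) (\<lambda>\<omega>. total_cost \<alpha> (u y) z \<tau> \<Xi> \<omega> + (2 * T + 1) * e)"
        by (intro Bochner_Integration.integrable_add integrable_total_cost[OF \<tau> ctl] integrable_const)
      show "AE \<omega> in PI i. G (\<tau> \<omega>) \<omega> \<le> total_cost \<alpha> (u y) z \<tau> \<Xi> \<omega> + (2 * T + 1) * e"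
        using hit AE_space
      proof eventually_elim
        fix \<omega> assume *: "torus_proj (z + displacement (\<Xi> \<omega>) (\<tau> \<omega>)) = y" and "\<omega> \<in> space (PI i)"
        then have w: "\<omega> \<in> index_paths" by simp
        have "running_cost (\<alpha> + 2 * e) z \<omega> (\<Xi> \<omega>) (\<tau> \<omega>) = running_cost \<alpha> z \<omega> (\<Xi> \<omega>) (\<tau> \<omega>) + 2 * e * \<tau> \<omega>"
          by (rule running_cost_add[OF w control_in[OF ctl w]]) (use T0(2)[OF w] in simp)
        moreover have "2 * e * \<tau> \<omega> \<le> 2 * e * T" using T0(2)[OF w] e by (intro mult_left_mono) auto
        moreover have "V (\<omega> (\<tau> \<omega>)) (X (\<tau> \<omega>) \<omega>) \<le> u y $ \<omega> (\<tau> \<omega>) + e"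
          using V0(1)[of "\<omega> (\<tau> \<omega>)" "X (\<tau> \<omega>) \<omega>"] * unfolding X_def by (simp add: abs_le_iff)
        ultimately show "G (\<tau> \<omega>) \<omega> \<le> total_cost \<alpha> (u y) z \<tau> \<Xi> \<omega> + (2 * T + 1) * e"
          unfolding G_def total_cost_def by (simp add: algebra_simps)
      qed
    qed
    also have "\<dots> = (LINT \<omega>|PI i. total_cost \<alpha> (u y) z \<tau> \<Xi> \<omega>) + (2 * T + 1) * e"
      using prob_space Bochner_Integration.integral_add[OF integrable_total_cost[OF \<tau> ctl] integrable_const] by simp
    finally show ?thesis by (simp add: algebra_simps)
  qed
  then have "u (torus_proj z) $ i \<le> (LINT \<omega>|PI i. total_cost \<alpha> (u y) z \<tau> \<Xi> \<omega>) + e" if "e > 0" for e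
  proof -
    have "e / (2 + 2 * T) > 0" using that T0(1) by simp
    moreover have "(2 + 2 * T) * (e / (2 + 2 * T)) = e" using T0(1) by simp
    ultimately show ?thesis
      using \<open>\<And>e. e > 0 \<Longrightarrow> u (torus_proj z) $ i \<le> (LINT \<omega>|PI i. total_cost \<alpha> (u y) z \<tau> \<Xi> \<omega>) + (2 + 2 * T) * e\<close> by metis
  qed
  then show ?thesis unfolding cost_total by (rule field_le_epsilon)
qed

end

text \<open>The states reachable from \<open>i\<close> form a set closed under nonzero entries of
  \<open>\<Lambda>\<close>: such an entry makes a short transition possible, and it can be appended
  to an earlier one. Irreducibility leaves only the full set. The time may depend on the pair of
  states.\<close>

lemma (in switching) Q_positive:
  assumes offdiag: "\<And>i j. i \<noteq> j \<Longrightarrow> \<Lambda> $ i $ j \<le> 0" and irr: "irreducible_matrix \<Lambda>"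
  shows "\<exists>t>0. Q t $ i $ j > 0"
proof -
  obtain C where C: "C \<ge> 0" "\<And>t i j. 0 \<le> t \<Longrightarrow> t \<le> 1 \<Longrightarrow> \<bar>Q t $ i $ j - mat 1 $ i $ j + t * \<Lambda> $ i $ j\<bar> \<le> C * t\<^sup>2"
    by (rule Q_expansion) blast
  have ex: "\<exists>t>0. Q t $ j $ k > 0" if "j = k \<or> \<Lambda> $ j $ k \<noteq> 0" for j k
  proof -
    \<comment> \<open>The leading coefficient of the entry for small times: of order 0 on the
      diagonal, of order 1 off it.\<close>
    define m where "m = (if j = k then 1 else - \<Lambda> $ j $ k)"
    have m: "m > 0" using that offdiag[of j k] by (auto simp: m_def less_le)
    define A where "A = C + \<bar>\<Lambda> $ j $ k\<bar> + 1"
    have A: "A > 0" using C(1) by (simp add: A_def add_nonneg_pos)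
    \<comment> \<open>So short that the other terms of the expansion take at most half of the
      leading coefficient.\<close>
    define t where "t = min 1 (m / (2 * A))"
    have t: "0 < t" "t \<le> 1" using m A by (auto simp: t_def)
    have "A * t \<le> A * (m / (2 * A))" using A by (intro mult_left_mono) (auto simp: t_def)
    also have "\<dots> = m / 2" using A by simp
    finally have small: "(C + \<bar>\<Lambda> $ j $ k\<bar> + 1) * t \<le> m / 2" unfolding A_def .
    then have small': "C * t + t * \<bar>\<Lambda> $ j $ k\<bar> + t \<le> m / 2" by (simp add: algebra_simps)
    have sq: "C * t\<^sup>2 \<le> C * t" using t C(1) by (intro mult_left_mono) (auto simp: power2_eq_square mult_left_le)
    have low: "Q t $ j $ k \<ge> mat 1 $ j $ k - t * \<Lambda> $ j $ k - C * t\<^sup>2"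
      using C(2)[of t j k] t by (simp add: abs_le_iff)
    have ab: "t * \<Lambda> $ j $ k \<le> t * \<bar>\<Lambda> $ j $ k\<bar>" using t by (intro mult_left_mono) auto
    have "Q t $ j $ k > 0"
    proof (cases "j = k")
      case True
      then have "mat 1 $ j $ k = (1::real)" "m = 1" by (simp_all add: mat_def m_def)
      with low sq ab small' t show ?thesis by linarith
    next
      case False
      then have "mat 1 $ j $ k = (0::real)" "t * m = - t * \<Lambda> $ j $ k" by (simp_all add: mat_def m_def)
      moreover have "C * t < m"
      proof -
        have "C * t \<le> (C + \<bar>\<Lambda> $ j $ k\<bar> + 1) * t" using t by (intro mult_right_mono) auto
        with small m show ?thesis by linarith
      qed
      then have "t * (C * t) < t * m" using t by simp
      ultimately show ?thesis using low by (simp add: power2_eq_square mult_ac)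
    qed
    with t show ?thesis by blast
  qed
  let ?S = "{j. \<exists>t>0. Q t $ i $ j > 0}"
  have "?S = UNIV"
  proof (rule ccontr)
    assume "?S \<noteq> UNIV"
    moreover have "?S \<noteq> {}" using ex[of i i] by blast
    ultimately have "\<exists>j\<in>?S. \<exists>k\<in>- ?S. \<Lambda> $ j $ k \<noteq> 0"
      using irr[unfolded irreducible_matrix_def, rule_format, of ?S] by simp
    then obtain j k where jk: "j \<in> ?S" "k \<notin> ?S" "\<Lambda> $ j $ k \<noteq> 0" by blast
    obtain s where s: "s > 0" "Q s $ i $ j > 0" using jk(1) by blast
    obtain t where t: "t > 0" "Q t $ j $ k > 0" using ex[of j k] jk(3) by blast
    interpret prob_space "PI i" by (rule prob_space_P[OF axis_in_simplex])
    have "0 < Q t $ j $ k * Q s $ i $ j" using s t by simp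
    also have "\<dots> = prob {\<omega> \<in> index_paths. \<omega> s = j \<and> \<omega> (s + t) = k}"
      using transition_indicator[OF axis_in_simplex, of s t i j k] measure_eval[OF axis_in_simplex, of s i j] s t
      by (simp add: axis_vector_matrix_mult)
    also have "\<dots> \<le> prob {\<omega> \<in> index_paths. \<omega> (s + t) = k}"
      by (rule finite_measure_mono) (use s t sets_eval_eq[OF axis_in_simplex] in auto)
    also have "\<dots> = Q (s + t) $ i $ k"
      using measure_eval[OF axis_in_simplex, of "s + t" i k] s t by (simp add: axis_vector_matrix_mult)
    finally have "k \<in> ?S" using s t by (intro CollectI exI[of _ "s + t"]) simp
    with jk(2) show False by blast
  qed
  then show ?thesis by blast
qed

section \<open>Uniform oscillation of subsolutions and conclusion\<close>

context controlled_system begin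

text \<open>Compare a near maximum point of \<open>u\<close> with any other point: the constant speed motion between
  them ends in the index \<open>j\<close> with positive probability.\<close>

lemma subsolution_oscillation:
  assumes offdiag: "\<And>i j. i \<noteq> j \<Longrightarrow> \<Lambda> $ i $ j \<le> 0" and irr: "irreducible_matrix \<Lambda>"
  obtains C where "\<forall>\<beta> u x x' i j. \<alpha> \<le> \<beta> \<longrightarrow> \<beta> \<le> \<alpha> + 1 \<longrightarrow> subsolution H \<Lambda> \<beta> u \<longrightarrow> u x $ i - u x' $ j \<le> C"
proof -
  have "\<exists>t>0. Q t $ i $ j > 0" for i j by (rule Q_positive[OF offdiag irr])
  then obtain t where t: "\<And>i j. t i j > 0" "\<And>i j. Q (t i j) $ i $ j > 0" by metis
  \<comment> \<open>Two representatives in the unit cube differ by at most this, so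
    \<open>D / t i j\<close> bounds the speed of the connecting motion.\<close>
  define D where "D = 2 * real CARD('n)"
  have "\<exists>C. C \<ge> 0 \<and> (\<forall>z \<omega> \<xi> s. norm (\<xi> s) \<le> D / t i j \<longrightarrow> \<bar>rate \<alpha> z \<omega> \<xi> s\<bar> \<le> C)" for i j
    by (rule rate_bounded[where R="D / t i j" and \<alpha>=\<alpha>]) blast
  then obtain C where C: "\<And>i j. C i j \<ge> 0" "\<And>i j z \<omega> \<xi> s. norm (\<xi> s) \<le> D / t i j \<Longrightarrow> \<bar>rate \<alpha> z \<omega> \<xi> s\<bar> \<le> C i j"
    by metis
  \<comment> \<open>This is the final inequality solved for the oscillation: the extra 1 next to
    \<open>C i j\<close> allows levels up to \<open>\<alpha> + 1\<close>, and the last 1 is the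
    distance of the near maximum from the supremum.\<close>
  define E where "E i j = ((C i j + 1) * t i j + 1) / Q (t i j) $ i $ j" for i j
  define Cmax where "Cmax = (\<Sum>i\<in>UNIV. \<Sum>j\<in>UNIV. E i j)"
  have E0: "E i j \<ge> 0" for i j using C(1)[of i j] t(1)[of i j] t(2)[of i j] by (simp add: E_def)
  have E: "E i j \<le> Cmax" for i j
  proof -
    have "E i j \<le> (\<Sum>j\<in>UNIV. E i j)" by (rule member_le_sum) (use E0 in auto)
    also have "\<dots> \<le> Cmax" unfolding Cmax_def
      by (rule member_le_sum[of i UNIV "\<lambda>i. \<Sum>j\<in>UNIV. E i j"]) (use E0 in \<open>auto intro: sum_nonneg\<close>)
    finally show ?thesis .
  qed
  have "u x $ i - u x' $ j \<le> Cmax"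
    if \<beta>: "\<alpha> \<le> \<beta>" "\<beta> \<le> \<alpha> + 1" and sub: "subsolution H \<Lambda> \<beta> u" for \<beta> u x x' i j
  proof -
    obtain B where B: "B \<ge> 0" "\<And>x i. \<bar>u x $ i\<bar> \<le> B" by (rule subsolution_bounded[OF sub]) blast
    define M where "M = Sup (range (\<lambda>(x, i). u x $ i))"
    have bdd: "bdd_above (range (\<lambda>(x, i). u x $ i))"
      using B(2) by (intro bdd_aboveI[of _ B]) (auto simp: abs_le_iff)
    have M: "u x $ i \<le> M" for x i unfolding M_def using cSUP_upper[OF _ bdd, of "(x, i)"] by simp
    obtain x0 k where xk: "M - 1 < u x0 $ k"
      using less_cSupD[of "range (\<lambda>(x, i). u x $ i)" "M - 1"] by (auto simp: M_def)
    obtain z z' where z: "x0 = torus_proj z" "norm z \<le> real CARD('n)" "x' = torus_proj z'" "norm z' \<le> real CARD('n)"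
    proof -
      obtain w w' where "x0 = torus_proj w" "x' = torus_proj w'" using torus_surj by metis
      then show ?thesis
        using that[of "frac_vec w" "frac_vec w'"] norm_cbox01[OF frac_vec_in_cbox, of w] norm_cbox01[OF frac_vec_in_cbox, of w'] by simp
    qed
    define r where "r = t k j"
    have r: "r > 0" using t(1) by (simp add: r_def)
    define q where "q = (z' - z) /\<^sub>R r"
    have "norm (z' - z) \<le> D" using norm_triangle_ineq4[of z' z] z by (simp add: D_def)
    then have nq: "norm q \<le> D / t k j"
      using r by (simp add: q_def r_def[symmetric] divide_inverse mult.commute mult_right_mono)
    have rq: "r *\<^sub>R q = z' - z" using r by (simp add: q_def)
    interpret prob_space "PI k" by (rule prob_space_P[OF axis_in_simplex])
    have bst: "bounded_stopping_time (\<lambda>_ :: real \<Rightarrow> 'm. r)" by (rule bounded_stopping_time_const) (use r in simp)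
    have "(\<lambda>_ :: real \<Rightarrow> 'm. const_path q) \<in> controls_to P (\<lambda>_. r) (torus_proj z' - torus_proj z)"
      using const_path_controls_to[of r q z] r by (simp add: rq)
    from subsolution_le_cost[OF sub bst this, of k]
    have "u x0 $ k \<le> (LINT \<omega>|PI k. total_cost \<beta> (u x') z (\<lambda>_. r) (\<lambda>_. const_path q) \<omega>)"
      unfolding cost_total z(1,3) .
    also have "\<dots> \<le> (LINT \<omega>|PI k. (C k j + 1) * r + M - (M - u x' $ j) * indicator {\<omega> \<in> index_paths. \<omega> r = j} \<omega>)"
    proof (rule integral_mono)
      show "integrable (PI k) (total_cost \<beta> (u x') z (\<lambda>_. r) (\<lambda>_. const_path q))"
        by (rule integrable_total_cost[OF bst control_const])
      show "integrable (PI k) (\<lambda>\<omega>. (C k j + 1) * r + M - (M - u x' $ j) * indicator {\<omega> \<in> index_paths. \<omega> r = j} \<omega>)"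
        using sets_eval_eq[OF axis_in_simplex, of r j k] r
        by (intro Bochner_Integration.integrable_diff integrable_const integrable_mult_right integrable_real_indicator) (auto simp: emeasure_eq_measure)
      fix \<omega> assume "\<omega> \<in> space (PI k)"
      then have w: "\<omega> \<in> index_paths" by simp
      have "\<bar>running_cost \<alpha> z \<omega> (const_path q) r\<bar> \<le> C k j * r"
        by (rule running_cost_bound[OF _ _ C(1) C(2)[of _ _ k j]]) (use nq r in \<open>auto simp: const_path_def\<close>)
      moreover have "running_cost (\<alpha> + (\<beta> - \<alpha>)) z \<omega> (const_path q) r = running_cost \<alpha> z \<omega> (const_path q) r + (\<beta> - \<alpha>) * r"
        by (rule running_cost_add[OF w const_path_in]) (use r in simp)
      moreover have "(\<beta> - \<alpha>) * r \<le> 1 * r" using \<beta> r by (intro mult_right_mono) auto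
      ultimately have "running_cost \<beta> z \<omega> (const_path q) r \<le> (C k j + 1) * r" by (simp add: algebra_simps)
      \<comment> \<open>The terminal value is bounded by the supremum \<open>M\<close> in general
        and equals the value to be compared when the chain ends in \<open>j\<close>.\<close>
      moreover have "u x' $ \<omega> r \<le> M - (M - u x' $ j) * indicator {\<omega> \<in> index_paths. \<omega> r = j} \<omega>"
        using M[of x' "\<omega> r"] w by (cases "\<omega> r = j") (auto simp: indicator_def)
      ultimately show "total_cost \<beta> (u x') z (\<lambda>_. r) (\<lambda>_. const_path q) \<omega> \<le> (C k j + 1) * r + M - (M - u x' $ j) * indicator {\<omega> \<in> index_paths. \<omega> r = j} \<omega>"
        unfolding total_cost_def by linarith
    qed
    also have "\<dots> = (C k j + 1) * r + M - (M - u x' $ j) * Q r $ k $ j"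
    proof -
      have "integrable (PI k) (\<lambda>\<omega>. (M - u x' $ j) * indicator {\<omega> \<in> index_paths. \<omega> r = j} \<omega> :: real)"
        using sets_eval_eq[OF axis_in_simplex, of r j k] r
        by (intro integrable_mult_right integrable_real_indicator) (auto simp: emeasure_eq_measure)
      from Bochner_Integration.integral_diff[OF integrable_const this]
      have "(LINT \<omega>|PI k. (C k j + 1) * r + M - (M - u x' $ j) * indicator {\<omega> \<in> index_paths. \<omega> r = j} \<omega>) =
        (C k j + 1) * r + M - (M - u x' $ j) * (LINT \<omega>|PI k. indicator {\<omega> \<in> index_paths. \<omega> r = j} \<omega>)"
        using prob_space by simp
      moreover have "(LINT \<omega>|PI k. indicator {\<omega> \<in> index_paths. \<omega> r = j} \<omega>) = Q r $ k $ j"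
      proof -
        have "{\<omega> \<in> index_paths. \<omega> r = j} \<inter> index_paths = {\<omega> \<in> index_paths. \<omega> r = j}" by auto
        then show ?thesis
          using measure_eval[OF axis_in_simplex, of r k j] r by (simp add: axis_vector_matrix_mult)
      qed
      ultimately show ?thesis by simp
    qed
    finally have "(M - u x' $ j) * Q r $ k $ j \<le> (C k j + 1) * r + 1" using xk by linarith
    then have "M - u x' $ j \<le> E k j"
      using t(2)[of k j] by (simp add: E_def r_def[symmetric] pos_le_divide_eq)
    with E[of k j] M[of x i] show ?thesis by linarith
  qed
  then show ?thesis by (intro that[of Cmax]) blast
qed

lemma subsolution_mono: "subsolution H \<Lambda> \<alpha> u \<Longrightarrow> \<alpha> \<le> \<beta> \<Longrightarrow> subsolution H \<Lambda> \<beta> u"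
  unfolding subsolution_def by (meson order_trans)

text \<open>For the zero function the gradient of a touching test function vanishes, so only the
  values \<open>H i x 0\<close> count, and these are bounded. Hence the infimum defining the
  critical value ranges over a nonempty set.\<close>

lemma subsolution_exists: "\<exists>\<alpha> u. subsolution H \<Lambda> \<alpha> u"
proof -
  have "\<exists>B. \<forall>x. H i x 0 \<le> B" for i
    using H_bounded[of 0 i] by (metis abs_le_D1 norm_zero order_refl)
  then obtain B where B: "\<And>i x. H i x 0 \<le> B i" by metis
  have "subsolution H \<Lambda> (Max (range B)) (\<lambda>_. 0)"
    unfolding subsolution_def
  proof (intro conjI allI impI)
    fix x :: "'n torus" and i \<psi> g assume g: "C1_gradient \<psi> g" and mx: "\<forall>z. (0 :: real^'m) $ i - \<psi> z \<le> 0 $ i - \<psi> x"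
    obtain z where z: "x = torus_proj z" using torus_surj by blast
    have "((\<lambda>w. \<psi> (torus_proj w)) has_derivative (\<lambda>h. h \<bullet> g x)) (at z)"
      using g unfolding C1_gradient_def gderiv_def z by blast
    then have "(\<lambda>h. h \<bullet> g x) = (\<lambda>h. 0)"
      by (intro differential_zero_maxmin[of z UNIV "\<lambda>w. \<psi> (torus_proj w)"]) (use mx z in auto)
    then have "g x \<bullet> g x = 0" by meson
    then have "g x = 0" by simp
    moreover have "H i x 0 \<le> Max (range B)" by (rule order_trans[OF B]) simp
    ultimately show "H i x (g x) + \<Lambda> $ i \<bullet> 0 \<le> Max (range B)" by simp
  qed simp
  then show ?thesis by blast
qed

text \<open>Subsolutions are available at every level strictly above \<alpha>, and the level may be
  chosen after the strategy, since a strategy has a bounded horizon. Their oscillation bound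
  \<open>C\<close> does not depend on the level, so the resulting bound
  \<open>- (C + norm b)\<close> is common to all strategies.\<close>

theorem value_function_is_subsolution:
  assumes offdiag: "\<And>i j. i \<noteq> j \<Longrightarrow> \<Lambda> $ i $ j \<le> 0" and irr: "irreducible_matrix \<Lambda>"
    and alpha: "\<alpha> \<ge> critical_value H \<Lambda>"
  shows "\<exists>v. (\<forall>i x. value_fun P L \<alpha> b y i x = ereal (v x $ i)) \<and> subsolution H \<Lambda> \<alpha> v"
proof -
  obtain C where C: "\<forall>\<beta> u x x' i j. \<alpha> \<le> \<beta> \<longrightarrow> \<beta> \<le> \<alpha> + 1 \<longrightarrow> subsolution H \<Lambda> \<beta> u \<longrightarrow> u x $ i - u x' $ j \<le> C"
    by (rule subsolution_oscillation[OF offdiag irr])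
  have ex: "\<exists>u. subsolution H \<Lambda> \<beta> u" if "\<alpha> < \<beta>" for \<beta>
  proof -
    have "Inf {\<alpha>. \<exists>u. subsolution H \<Lambda> \<alpha> u} < \<beta>" using alpha that unfolding critical_value_def by linarith
    from cInf_lessD[OF _ this] obtain s u where "subsolution H \<Lambda> s u" "s < \<beta>" using subsolution_exists by blast
    then show ?thesis using subsolution_mono[of s u \<beta>] by auto
  qed
  have "- (C + norm b) \<le> cost P L \<alpha> b i (torus_proj z) \<tau> \<Xi>"
    if \<tau>: "bounded_stopping_time \<tau>" and \<Xi>: "\<Xi> \<in> controls_to P \<tau> (torus_proj y - torus_proj z)" for i z \<tau> \<Xi>
  proof (rule field_le_epsilon)
    fix e :: real assume e: "e > 0"
    interpret prob_space "PI i" by (rule prob_space_P[OF axis_in_simplex])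
    obtain T where T: "T > 0" "\<And>\<omega>. \<omega> \<in> index_paths \<Longrightarrow> 0 \<le> \<tau> \<omega> \<and> \<tau> \<omega> \<le> T"
      by (rule bounded_stopping_time_bounds[OF \<tau>]) blast
    have ctl: "control P \<Xi>" using \<Xi> by (simp add: controls_to_def)
    \<comment> \<open>Over the horizon \<open>T\<close> the raised level costs at most
      \<open>e\<close>, while staying in the range where \<open>C\<close> is valid.\<close>
    define d where "d = min 1 (e / T)"
    have d: "0 < d" "d \<le> 1" "d * T \<le> e"
    proof -
      show "0 < d" "d \<le> 1" using e T(1) by (auto simp: d_def)
      have "d * T \<le> (e / T) * T" using T(1) by (intro mult_right_mono) (auto simp: d_def)
      then show "d * T \<le> e" using T(1) by simp
    qed
    obtain u where u: "subsolution H \<Lambda> (\<alpha> + d) u" using ex[of "\<alpha> + d"] d by auto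
    have "u (torus_proj z) $ i \<le> (LINT \<omega>|PI i. total_cost (\<alpha> + d) (u (torus_proj y)) z \<tau> \<Xi> \<omega>)"
      using subsolution_le_cost[OF u \<tau> \<Xi>, of i] unfolding cost_total .
    also have "\<dots> \<le> (LINT \<omega>|PI i. total_cost \<alpha> b z \<tau> \<Xi> \<omega> + (e + norm b + u (torus_proj z) $ i + C))"
    proof (rule integral_mono)
      show "integrable (PI i) (\<lambda>\<omega>. total_cost \<alpha> b z \<tau> \<Xi> \<omega> + (e + norm b + u (torus_proj z) $ i + C))"
        by (intro Bochner_Integration.integrable_add integrable_total_cost[OF \<tau> ctl] integrable_const)
      fix \<omega> assume "\<omega> \<in> space (PI i)"
      then have w: "\<omega> \<in> index_paths" by simp
      have "running_cost (\<alpha> + d) z \<omega> (\<Xi> \<omega>) (\<tau> \<omega>) = running_cost \<alpha> z \<omega> (\<Xi> \<omega>) (\<tau> \<omega>) + d * \<tau> \<omega>"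
        by (rule running_cost_add[OF w control_in[OF ctl w]]) (use T(2)[OF w] in simp)
      moreover have "d * \<tau> \<omega> \<le> d * T" using T(2)[OF w] d by (intro mult_left_mono) auto
      moreover have "u (torus_proj y) $ \<omega> (\<tau> \<omega>) - u (torus_proj z) $ i \<le> C" by (rule C[rule_format, OF _ _ u]) (use d in auto)
      moreover have "- norm b \<le> b $ \<omega> (\<tau> \<omega>)" using component_le_norm_cart[of b "\<omega> (\<tau> \<omega>)"] by (simp add: abs_le_iff)
      ultimately show "total_cost (\<alpha> + d) (u (torus_proj y)) z \<tau> \<Xi> \<omega> \<le> total_cost \<alpha> b z \<tau> \<Xi> \<omega> + (e + norm b + u (torus_proj z) $ i + C)"
        using d(3) unfolding total_cost_def by linarith
    qed (rule integrable_total_cost[OF \<tau> ctl])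
    also have "\<dots> = (LINT \<omega>|PI i. total_cost \<alpha> b z \<tau> \<Xi> \<omega>) + (e + norm b + u (torus_proj z) $ i + C)"
      using prob_space Bochner_Integration.integral_add[OF integrable_total_cost[OF \<tau> ctl] integrable_const] by simp
    finally show "- (C + norm b) \<le> cost P L \<alpha> b i (torus_proj z) \<tau> \<Xi> + e" unfolding cost_total by simp
  qed
  then show ?thesis by (rule value_fun_subsolution)
qed

end

theorem theorem5p2:
  fixes H :: "'m::finite \<Rightarrow> 'n::finite torus \<Rightarrow> real^'n \<Rightarrow> real"
    and \<Lambda> :: "real^'m^'m"
    and P :: "real^'m \<Rightarrow> (real \<Rightarrow> 'm) measure"
    and \<alpha> :: real and y :: "real^'n" and b :: "real^'m"
  assumes H_continuous: "\<And>i. continuous_on UNIV (\<lambda>(x, p). H i x p)"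
    and H_convex: "\<And>i x. convex_on UNIV (H i x)"
    and H_superlinear: "\<And>i x. superlinear (H i x)"
    and offdiag_nonpos: "\<And>i j. i \<noteq> j \<Longrightarrow> \<Lambda> $ i $ j \<le> 0"
    and row_sums: "\<And>i. (\<Sum>j\<in>UNIV. \<Lambda> $ i $ j) = 0"
    and irreducible: "irreducible_matrix \<Lambda>"
    and P: "\<And>a. a \<in> prob_simplex \<Longrightarrow> is_chain_law \<Lambda> a (P a)"
    and alpha: "\<alpha> \<ge> critical_value H \<Lambda>"
  shows "\<exists>v. (\<forall>i x. value_fun P (lagrangian H) \<alpha> b y i x = ereal (v x $ i)) \<and>
             subsolution H \<Lambda> \<alpha> v"
proof -
  interpret controlled_system H \<Lambda> P
    by unfold_locales (rule H_continuous H_convex H_superlinear P, assumption?)+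
  show ?thesis by (rule value_function_is_subsolution[OF offdiag_nonpos irreducible alpha])
qed

end
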